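(* Let $f\in Y^*$ and let $u \in X_v$ be the solution of $b(u,q)=\langle f,q\rangle_\Omega$ for all $q\in Y$. Let $(p_h,u_H) \in Y_h \times X_H$ be the unique solution of $$\int_\Omega \alpha(x)\,\nabla p_h(x)\cdot\nabla q_h(x)\,dx + b(u_H,q_h) = \langle f,q_h\rangle_\Omega \quad \text{for all } q_h \in Y_h, \qquad b(z_H,p_h) = 0 \quad \text{for all } z_H \in X_H,$$ and, with $X_h = Y_h$, let $(\overline{p}_h,u_h) \in Y_h\times X_h$ be the unique solution of $$\int_\Omega \alpha(x)\,\nabla \overline{p}_h(x)\cdot\nabla q_h(x)\,dx + b(u_h,q_h) = \langle f,q_h\rangle_\Omega \quad \text{for all } q_h \in Y_h, \qquad b(z_h,\overline{p}_h) = 0 \quad \text{for all } z_h \in X_h.$$ Assume the saturation condition $$\|u-u_h\|_{X_v,h} \leq \eta\,\|u-u_H\|_{X_v,h} \quad \text{for some } \eta \in (0,1).$$ Then there holds the reliability estimate $$\|u-u_H\|_{X_v,h} \leq \frac{1}{1-\eta}\,\|p_h\|_Y.$$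
   Context: $\Omega \subset \mathbb{R}^n$, $n=1,2,3$, is a bounded Lipschitz domain. The diffusion coefficient $\alpha:\Omega\to\mathbb{R}$ is measurable and satisfies $0 < \underline{\alpha} \leq \alpha(x) \leq \overline{\alpha}$ for all $x \in \Omega$, with constants $\underline\alpha,\overline\alpha$. $\boldsymbol{v}$ is a given, possibly unbounded, locally integrable velocity field on $\Omega$ with values in $\mathbb{R}^n$ with (weak) divergence $\operatorname{div}\boldsymbol{v}(x)\le 0$ for almost all $x\in\Omega$. $Y := H^1_0(\Omega)$ is equipped with the norm $\|q\|_Y^2 := \int_\Omega \alpha(x)\,|\nabla q(x)|^2\,dx$, and $Y^*=H^{-1}(\Omega)$ is its dual, with duality pairing $\langle\cdot,\cdot\rangle_\Omega$ extending the $L^2(\Omega)$ inner product. The velocity dependent ansatz space is $X_v := \{u \in Y : \boldsymbol{v}\cdot\nabla u \in Y^*\}$. The bilinear form $b : X_v\times Y\to\mathbb{R}$ is $$b(u,q) := \int_\Omega \alpha(x)\,\nabla u(x)\cdot\nabla q(x)\,dx + \int_\Omega \boldsymbol{v}(x)\cdot\nabla u(x)\,q(x)\,dx,$$ where for $u \in X_v$ and $q \in Y$ the last integral is understood as the duality pairing $\langle \boldsymbol{v}\cdot\nabla u, q\rangle_\Omega$. The operator $B:X_v\to Y^*$, $\langle Bu,q\rangle_\Omega = b(u,q)$, is assumed to be bijective. $X_H\subset X_v$ and $Y_h\subset Y$ are conforming (finite dimensional) finite element spaces of piecewise linear continuous functions, where $X_H$ is defined on an admissible shape regular simplicial decomposition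 of $\Omega$ and $Y_h$ on a refinement of it, so that $X_H\subset Y_h$, $X_H\ne Y_h$; moreover $X_h = Y_h \subset X_v$. For $u \in X_v$, $w_{u,h} \in Y_h$ is the unique solution of $$\int_\Omega \alpha(x)\,\nabla w_{u,h}(x)\cdot\nabla q_h(x)\,dx = \int_\Omega \boldsymbol{v}(x)\cdot\nabla u(x)\,q_h(x)\,dx \quad \text{for all } q_h \in Y_h,$$ and the discrete norm is $\|u\|_{X_v,h} := \sqrt{\|u\|_Y^2 + \|w_{u,h}\|_Y^2}$. *)

theory Defs
  imports "HOL-Analysis.Analysis"
begin

section \<open>Domains\<close>

text \<open>
  Locally, after a choice of the vertical direction \<open>e\<close>, the domain is the strict epigraph of
  a Lipschitz function \<open>g\<close> on the hyperplane orthogonal to \<open>e\<close>.  In dimension one that hyperplane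
  is the single point \<open>0\<close>.
\<close>

definition lipschitz_boundary :: "(real ^ 'n) set \<Rightarrow> bool" where
  "lipschitz_boundary \<Omega> \<longleftrightarrow>
     (\<forall>x0 \<in> frontier \<Omega>. \<exists>U e L. \<exists>g :: real ^ 'n \<Rightarrow> real.
        open U \<and> x0 \<in> U \<and> norm e = 1 \<and> L-lipschitz_on {y. y \<bullet> e = 0} g \<and>
        \<Omega> \<inter> U = {x \<in> U. g (x - (x \<bullet> e) *\<^sub>R e) < x \<bullet> e})"

definition bounded_lipschitz_domain :: "(real ^ 'n) set \<Rightarrow> bool" where
  "bounded_lipschitz_domain \<Omega> \<longleftrightarrow>
     open \<Omega> \<and> connected \<Omega> \<and> \<Omega> \<noteq> {} \<and> bounded \<Omega> \<and> lipschitz_boundary \<Omega>"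


section \<open>Test functions, weak gradient, weak divergence\<close>

definition partial :: "'n \<Rightarrow> (real ^ 'n \<Rightarrow> real) \<Rightarrow> real ^ 'n \<Rightarrow> real" where
  "partial i f x = frechet_derivative f (at x) (axis i 1)"

definition grad :: "(real ^ 'n \<Rightarrow> real) \<Rightarrow> real ^ 'n \<Rightarrow> real ^ 'n" where
  "grad f x = (\<chi> i. partial i f x)"

primrec k_times_C1 :: "nat \<Rightarrow> (real ^ 'n \<Rightarrow> real) \<Rightarrow> bool" where
  "k_times_C1 0 f \<longleftrightarrow> continuous_on UNIV f"
| "k_times_C1 (Suc k) f \<longleftrightarrow> f differentiable_on UNIV \<and> (\<forall>i. k_times_C1 k (partial i f))"

text \<open>The functions in \<open>C\<^sub>c\<^sup>\<infinity>(\<Omega>)\<close>, extended by zero to the whole space.\<close>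

definition test_function :: "(real ^ 'n) set \<Rightarrow> (real ^ 'n \<Rightarrow> real) \<Rightarrow> bool" where
  "test_function \<Omega> \<phi> \<longleftrightarrow>
     (\<forall>k. k_times_C1 k \<phi>) \<and> (\<exists>K. compact K \<and> K \<subseteq> \<Omega> \<and> (\<forall>x. x \<notin> K \<longrightarrow> \<phi> x = 0))"

definition locally_integrable ::
    "(real ^ 'n) set \<Rightarrow> (real ^ 'n \<Rightarrow> 'b::euclidean_space) \<Rightarrow> bool" where
  "locally_integrable \<Omega> g \<longleftrightarrow>
     g \<in> borel_measurable (lebesgue_on \<Omega>) \<and>
     (\<forall>K. compact K \<and> K \<subseteq> \<Omega> \<longrightarrow> integrable (lebesgue_on K) g)"

definition square_integrable ::
    "(real ^ 'n) set \<Rightarrow> (real ^ 'n \<Rightarrow> 'b::euclidean_space) \<Rightarrow> bool" where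
  "square_integrable \<Omega> g \<longleftrightarrow>
     g \<in> borel_measurable (lebesgue_on \<Omega>) \<and>
     integrable (lebesgue_on \<Omega>) (\<lambda>x. (norm (g x))\<^sup>2)"

definition has_weak_grad ::
    "(real ^ 'n) set \<Rightarrow> (real ^ 'n \<Rightarrow> real) \<Rightarrow> (real ^ 'n \<Rightarrow> real ^ 'n) \<Rightarrow> bool" where
  "has_weak_grad \<Omega> u G \<longleftrightarrow>
     locally_integrable \<Omega> u \<and> locally_integrable \<Omega> G \<and>
     (\<forall>\<phi>. test_function \<Omega> \<phi> \<longrightarrow>
        (\<forall>i. (LINT x|lebesgue_on \<Omega>. u x * partial i \<phi> x)
             = - (LINT x|lebesgue_on \<Omega>. G x $ i * \<phi> x)))"

text \<open>The weak gradient is determined only almost everywhere; a representative is chosen.\<close>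

definition wgrad ::
    "(real ^ 'n) set \<Rightarrow> (real ^ 'n \<Rightarrow> real) \<Rightarrow> real ^ 'n \<Rightarrow> real ^ 'n" where
  "wgrad \<Omega> u = (SOME G. has_weak_grad \<Omega> u G)"

definition has_weak_div ::
    "(real ^ 'n) set \<Rightarrow> (real ^ 'n \<Rightarrow> real ^ 'n) \<Rightarrow> (real ^ 'n \<Rightarrow> real) \<Rightarrow> bool" where
  "has_weak_div \<Omega> v d \<longleftrightarrow>
     locally_integrable \<Omega> v \<and> locally_integrable \<Omega> d \<and>
     (\<forall>\<phi>. test_function \<Omega> \<phi> \<longrightarrow>
        (LINT x|lebesgue_on \<Omega>. v x \<bullet> grad \<phi> x) = - (LINT x|lebesgue_on \<Omega>. d x * \<phi> x))"


section \<open>The spaces \<open>H\<^sup>1\<^sub>0(\<Omega>)\<close> and \<open>H\<^sup>-\<^sup>1(\<Omega>)\<close>\<close>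

text \<open>
  Elements of Sobolev spaces are functions, not equivalence classes: two functions that agree
  almost everywhere in \<open>\<Omega>\<close> represent the same element, and values outside \<open>\<Omega>\<close> are irrelevant.
\<close>

definition H1 :: "(real ^ 'n) set \<Rightarrow> (real ^ 'n \<Rightarrow> real) set" where
  "H1 \<Omega> = {u. square_integrable \<Omega> u \<and>
               (\<exists>G. has_weak_grad \<Omega> u G \<and> square_integrable \<Omega> G)}"

definition H1_norm :: "(real ^ 'n) set \<Rightarrow> (real ^ 'n \<Rightarrow> real) \<Rightarrow> real" where
  "H1_norm \<Omega> u = sqrt ((LINT x|lebesgue_on \<Omega>. (u x)\<^sup>2)
                       + (LINT x|lebesgue_on \<Omega>. (norm (wgrad \<Omega> u x))\<^sup>2))"

definition H10 :: "(real ^ 'n) set \<Rightarrow> (real ^ 'n \<Rightarrow> real) set" where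
  "H10 \<Omega> = {u \<in> H1 \<Omega>. \<exists>\<phi> :: nat \<Rightarrow> real ^ 'n \<Rightarrow> real.
               (\<forall>k. test_function \<Omega> (\<phi> k)) \<and>
               (\<lambda>k. H1_norm \<Omega> (\<lambda>x. u x - \<phi> k x)) \<longlonglongrightarrow> 0}"

definition Y_norm ::
    "(real ^ 'n) set \<Rightarrow> (real ^ 'n \<Rightarrow> real) \<Rightarrow> (real ^ 'n \<Rightarrow> real) \<Rightarrow> real" where
  "Y_norm \<Omega> \<alpha> q = sqrt (LINT x|lebesgue_on \<Omega>. \<alpha> x * (norm (wgrad \<Omega> q x))\<^sup>2)"

text \<open>
  The dual of \<open>H\<^sup>1\<^sub>0(\<Omega>)\<close>.  The value of a functional outside \<open>H10 \<Omega>\<close> is irrelevant.  A functional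
  in this set respects equality almost everywhere, by linearity and boundedness.
\<close>

definition Y_dual ::
    "(real ^ 'n) set \<Rightarrow> (real ^ 'n \<Rightarrow> real) \<Rightarrow> ((real ^ 'n \<Rightarrow> real) \<Rightarrow> real) set" where
  "Y_dual \<Omega> \<alpha> =
     {F. (\<forall>q\<in>H10 \<Omega>. \<forall>r\<in>H10 \<Omega>. \<forall>a b. F (\<lambda>x. a * q x + b * r x) = a * F q + b * F r) \<and>
         (\<exists>C. \<forall>q\<in>H10 \<Omega>. \<bar>F q\<bar> \<le> C * Y_norm \<Omega> \<alpha> q)}"

text \<open>
  A locally integrable function \<open>g\<close> belongs to the dual if the distribution
  \<open>\<phi> \<mapsto> \<integral>\<^sub>\<Omega> g \<phi>\<close> extends to a bounded functional on \<open>H\<^sup>1\<^sub>0(\<Omega>)\<close>.  Since the test functions are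
  dense, the extension is unique on \<open>H10 \<Omega>\<close>; it is the duality pairing with \<open>g\<close>.
\<close>

definition represents ::
    "(real ^ 'n) set \<Rightarrow> (real ^ 'n \<Rightarrow> real) \<Rightarrow> (real ^ 'n \<Rightarrow> real)
       \<Rightarrow> ((real ^ 'n \<Rightarrow> real) \<Rightarrow> real) \<Rightarrow> bool" where
  "represents \<Omega> \<alpha> g F \<longleftrightarrow>
     locally_integrable \<Omega> g \<and> F \<in> Y_dual \<Omega> \<alpha> \<and>
     (\<forall>\<phi>. test_function \<Omega> \<phi> \<longrightarrow> F \<phi> = (LINT x|lebesgue_on \<Omega>. g x * \<phi> x))"

definition pairing ::
    "(real ^ 'n) set \<Rightarrow> (real ^ 'n \<Rightarrow> real) \<Rightarrow> (real ^ 'n \<Rightarrow> real)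
       \<Rightarrow> (real ^ 'n \<Rightarrow> real) \<Rightarrow> real" where
  "pairing \<Omega> \<alpha> g = (SOME F. represents \<Omega> \<alpha> g F)"


section \<open>The convection-diffusion problem\<close>

definition convection ::
    "(real ^ 'n) set \<Rightarrow> (real ^ 'n \<Rightarrow> real ^ 'n) \<Rightarrow> (real ^ 'n \<Rightarrow> real) \<Rightarrow> real ^ 'n \<Rightarrow> real" where
  "convection \<Omega> v u x = v x \<bullet> wgrad \<Omega> u x"

definition X_space ::
    "(real ^ 'n) set \<Rightarrow> (real ^ 'n \<Rightarrow> real) \<Rightarrow> (real ^ 'n \<Rightarrow> real ^ 'n)
       \<Rightarrow> (real ^ 'n \<Rightarrow> real) set" where
  "X_space \<Omega> \<alpha> v = {u \<in> H10 \<Omega>. \<exists>F. represents \<Omega> \<alpha> (convection \<Omega> v u) F}"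

definition diffusion_form ::
    "(real ^ 'n) set \<Rightarrow> (real ^ 'n \<Rightarrow> real)
       \<Rightarrow> (real ^ 'n \<Rightarrow> real) \<Rightarrow> (real ^ 'n \<Rightarrow> real) \<Rightarrow> real" where
  "diffusion_form \<Omega> \<alpha> u q = (LINT x|lebesgue_on \<Omega>. \<alpha> x * (wgrad \<Omega> u x \<bullet> wgrad \<Omega> q x))"

definition b_form ::
    "(real ^ 'n) set \<Rightarrow> (real ^ 'n \<Rightarrow> real) \<Rightarrow> (real ^ 'n \<Rightarrow> real ^ 'n)
       \<Rightarrow> (real ^ 'n \<Rightarrow> real) \<Rightarrow> (real ^ 'n \<Rightarrow> real) \<Rightarrow> real" where
  "b_form \<Omega> \<alpha> v u q = diffusion_form \<Omega> \<alpha> u q + pairing \<Omega> \<alpha> (convection \<Omega> v u) q"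

text \<open>
  Bijectivity of \<open>u \<mapsto> b(u,\<cdot>)\<close> from \<open>X_space \<Omega> \<alpha> v\<close> to the dual.  Equality in the source is equality
  almost everywhere in \<open>\<Omega>\<close>, and equality in the target is agreement on \<open>H10 \<Omega>\<close>.
\<close>

definition B_bijective ::
    "(real ^ 'n) set \<Rightarrow> (real ^ 'n \<Rightarrow> real) \<Rightarrow> (real ^ 'n \<Rightarrow> real ^ 'n) \<Rightarrow> bool" where
  "B_bijective \<Omega> \<alpha> v \<longleftrightarrow>
     (\<forall>u \<in> X_space \<Omega> \<alpha> v. b_form \<Omega> \<alpha> v u \<in> Y_dual \<Omega> \<alpha>) \<and>
     (\<forall>u \<in> X_space \<Omega> \<alpha> v. \<forall>u' \<in> X_space \<Omega> \<alpha> v.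
        (\<forall>q \<in> H10 \<Omega>. b_form \<Omega> \<alpha> v u q = b_form \<Omega> \<alpha> v u' q)
        \<longrightarrow> (AE x in lebesgue_on \<Omega>. u x = u' x)) \<and>
     (\<forall>F \<in> Y_dual \<Omega> \<alpha>. \<exists>u \<in> X_space \<Omega> \<alpha> v. \<forall>q \<in> H10 \<Omega>. b_form \<Omega> \<alpha> v u q = F q)"


section \<open>Finite element spaces\<close>

definition simplicial_decomposition :: "(real ^ 'n) set \<Rightarrow> (real ^ 'n) set set \<Rightarrow> bool" where
  "simplicial_decomposition \<Omega> \<T> \<longleftrightarrow>
     triangulation \<T> \<and> (\<forall>K\<in>\<T>. int CARD('n) simplex K) \<and> \<Union>\<T> = closure \<Omega>"

definition shape_regular :: "real \<Rightarrow> (real ^ 'n) set set \<Rightarrow> bool" where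
  "shape_regular \<sigma> \<T> \<longleftrightarrow>
     (\<forall>K\<in>\<T>. \<exists>x r. 0 < r \<and> cball x r \<subseteq> K \<and> diameter K \<le> \<sigma> * r)"

definition mesh_refinement :: "(real ^ 'n) set set \<Rightarrow> (real ^ 'n) set set \<Rightarrow> bool" where
  "mesh_refinement \<T>' \<T> \<longleftrightarrow> (\<forall>K'\<in>\<T>'. \<exists>K\<in>\<T>. K' \<subseteq> K)"

text \<open>
  Continuous piecewise linear functions with zero boundary values, extended by zero.  The
  extension makes a finite element function unique as a function on the whole space.
\<close>

definition fe_space ::
    "(real ^ 'n) set \<Rightarrow> (real ^ 'n) set set \<Rightarrow> (real ^ 'n \<Rightarrow> real) set" where
  "fe_space \<Omega> \<T> =
     {u. continuous_on UNIV u \<and> (\<forall>x. x \<notin> \<Omega> \<longrightarrow> u x = 0) \<and>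
         (\<forall>K\<in>\<T>. \<exists>a c. \<forall>x\<in>K. u x = a \<bullet> x + c)}"

text \<open>
  For a finite element space contained in \<open>H10 \<Omega>\<close> the Galerkin solution exists and is unique.
\<close>

definition w_h ::
    "(real ^ 'n) set \<Rightarrow> (real ^ 'n \<Rightarrow> real) \<Rightarrow> (real ^ 'n \<Rightarrow> real ^ 'n)
       \<Rightarrow> (real ^ 'n \<Rightarrow> real) set \<Rightarrow> (real ^ 'n \<Rightarrow> real) \<Rightarrow> real ^ 'n \<Rightarrow> real" where
  "w_h \<Omega> \<alpha> v Y\<^sub>h u =
     (SOME w. w \<in> Y\<^sub>h \<and>
        (\<forall>q\<in>Y\<^sub>h. diffusion_form \<Omega> \<alpha> w q = pairing \<Omega> \<alpha> (convection \<Omega> v u) q))"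

definition X_h_norm ::
    "(real ^ 'n) set \<Rightarrow> (real ^ 'n \<Rightarrow> real) \<Rightarrow> (real ^ 'n \<Rightarrow> real ^ 'n)
       \<Rightarrow> (real ^ 'n \<Rightarrow> real) set \<Rightarrow> (real ^ 'n \<Rightarrow> real) \<Rightarrow> real" where
  "X_h_norm \<Omega> \<alpha> v Y\<^sub>h u =
     sqrt ((Y_norm \<Omega> \<alpha> u)\<^sup>2 + (Y_norm \<Omega> \<alpha> (w_h \<Omega> \<alpha> v Y\<^sub>h u))\<^sup>2)"

definition solves_mixed_system ::
    "(real ^ 'n) set \<Rightarrow> (real ^ 'n \<Rightarrow> real) \<Rightarrow> (real ^ 'n \<Rightarrow> real ^ 'n)
       \<Rightarrow> ((real ^ 'n \<Rightarrow> real) \<Rightarrow> real)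
       \<Rightarrow> (real ^ 'n \<Rightarrow> real) set \<Rightarrow> (real ^ 'n \<Rightarrow> real) set
       \<Rightarrow> (real ^ 'n \<Rightarrow> real) \<Rightarrow> (real ^ 'n \<Rightarrow> real) \<Rightarrow> bool" where
  "solves_mixed_system \<Omega> \<alpha> v f Y\<^sub>h X p u \<longleftrightarrow>
     p \<in> Y\<^sub>h \<and> u \<in> X \<and>
     (\<forall>q\<in>Y\<^sub>h. diffusion_form \<Omega> \<alpha> p q + b_form \<Omega> \<alpha> v u q = f q) \<and>
     (\<forall>z\<in>X. b_form \<Omega> \<alpha> v z p = 0)"

end

theory Submission
  imports Defs
begin

text \<open>
  Write \<open>a\<close> for the diffusion form, \<open>\<parallel>\<cdot>\<parallel>\<close> for the energy norm, \<open>e = u\<^sub>h - u\<^sub>H\<close>, and \<open>w\<close> for the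
  Galerkin representative of the convection term \<open>v \<bullet> \<nabla>e\<close>.  Subtracting the two mixed systems
  gives \<open>a(p\<^sub>h - pbar\<^sub>h, q) = b(e, q) = a(e + w, q)\<close> for all \<open>q\<close> in \<open>Y\<^sub>h\<close>, so \<open>p\<^sub>h - pbar\<^sub>h\<close> and
  \<open>e + w\<close> have the same energy norm.  Everything else rests on the positivity of the convection
  term, \<open>\<langle>v \<bullet> \<nabla>q, q\<rangle> \<ge> 0\<close> for \<open>q\<close> in \<open>Y\<^sub>h\<close>.  It is used twice.  Because \<open>X\<^sub>h = Y\<^sub>h\<close>, testing the
  constraint of the fine system with \<open>pbar\<^sub>h\<close> itself yields \<open>\<parallel>pbar\<^sub>h\<parallel> = 0\<close>.  And
  \<open>\<parallel>e + w\<parallel>\<^sup>2 = \<parallel>e\<parallel>\<^sup>2 + 2 \<langle>v \<bullet> \<nabla>e, e\<rangle> + \<parallel>w\<parallel>\<^sup>2\<close> bounds the square of the discrete norm of \<open>e\<close>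
  from above, so this norm is at most \<open>\<parallel>p\<^sub>h\<parallel>\<close>.  The triangle inequality for the discrete norm and
  the saturation condition then give the estimate.

  Formally \<open>\<langle>v \<bullet> \<nabla>q, q\<rangle> = \<integral> v \<bullet> \<nabla>(q\<^sup>2 / 2) = - 1/2 \<integral> (div v) q\<^sup>2\<close>.  Since \<open>v\<close> is only locally
  integrable and the pairing is known only on test functions, \<open>q\<close> is first truncated near zero,
  which gives it compact support, and then mollified.  A finite element function is Lipschitz and,
  outside a null set, affine near each point; its mollifications therefore have uniformly bounded
  gradients that are eventually constant at almost every point
  (\<open>lipschitz_test_function_approximation\<close>), and dominated convergence applies.  The result is
  \<open>convection_nonneg\<close>.

  The chosen weak gradients and pairings are linear only up to null sets and only because they are
  unique.  Uniqueness of weak gradients is the fundamental lemma of the calculus of variations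
  (\<open>orthogonal_imp_zero\<close>), which uses the same mollification; uniqueness of pairings
  (\<open>represents_unique\<close>) is the density of test functions.  The existence of the Galerkin
  representatives (\<open>w_h_solves\<close>) is the Riesz representation theorem in finite dimension.
\<close>

section \<open>Smooth functions\<close>

lemma partial_eqI:
  assumes "(f has_derivative f') (at x)"
  shows "partial i f x = f' (axis i 1)"
  using frechet_derivative_at[OF assms] by (simp add: partial_def)

lemma has_derivative_grad:
  fixes f :: "real ^ 'n \<Rightarrow> real"
  assumes "f differentiable (at x)"
  shows "(f has_derivative (\<lambda>h. grad f x \<bullet> h)) (at x)"
proof -
  let ?D = "frechet_derivative f (at x)"
  have D: "(f has_derivative ?D) (at x)"
    using assms by (simp add: frechet_derivative_works)
  have lin: "linear ?D"
    using D by (rule has_derivative_linear)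
  have "?D h = grad f x \<bullet> h" for h
  proof -
    have "?D h = ?D (\<Sum>i\<in>UNIV. h $ i *\<^sub>R axis i 1)"
      using basis_expansion[of h] by (simp add: scalar_mult_eq_scaleR)
    also have "\<dots> = (\<Sum>i\<in>UNIV. h $ i * ?D (axis i 1))"
      using lin by (simp add: linear_sum linear_scale)
    also have "\<dots> = grad f x \<bullet> h"
      by (simp add: inner_vec_def grad_def partial_def mult.commute)
    finally show ?thesis .
  qed
  then have "?D = (\<lambda>h. grad f x \<bullet> h)" by auto
  with D show ?thesis by simp
qed

lemma grad_eqI:
  fixes f :: "real ^ 'n \<Rightarrow> real"
  assumes "(f has_derivative (\<lambda>h. a \<bullet> h)) (at x)"
  shows "grad f x = a"
  using partial_eqI[OF assms] by (simp add: grad_def vec_eq_iff inner_axis)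

definition smooth :: "(real ^ 'n \<Rightarrow> real) \<Rightarrow> bool" where
  "smooth f \<longleftrightarrow> (\<forall>k. k_times_C1 k f)"

lemma smooth_differentiable: "smooth f \<Longrightarrow> f differentiable (at x)"
  unfolding smooth_def using k_times_C1.simps(2)[of 0 f]
  by (auto simp: differentiable_on_def)

lemma smooth_partial: "smooth f \<Longrightarrow> smooth (partial i f)"
  unfolding smooth_def using k_times_C1.simps(2) by blast

lemma smooth_continuous: "smooth f \<Longrightarrow> continuous_on UNIV f"
  unfolding smooth_def using k_times_C1.simps(1) by blast

lemma smooth_continuous_grad: "smooth f \<Longrightarrow> continuous_on UNIV (grad f)"
  unfolding grad_def by (intro continuous_on_vec_lambda smooth_continuous smooth_partial)

text \<open>
  Smoothness is the largest property that implies differentiability and is inherited by the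
  partial derivatives.
\<close>

lemma smooth_coinduct:
  assumes "P f"
    and diff: "\<And>f x. P f \<Longrightarrow> f differentiable (at x)"
    and part: "\<And>f i. P f \<Longrightarrow> P (partial i f)"
  shows "smooth f"
proof -
  have "k_times_C1 k f" if "P f" for k f
    using that
  proof (induction k arbitrary: f)
    case 0
    then show ?case
      by (auto intro!: continuous_at_imp_continuous_on differentiable_imp_continuous_within diff)
  next
    case (Suc k)
    then show ?case
      by (auto simp: differentiable_on_def intro: differentiable_at_withinI diff part)
  qed
  with \<open>P f\<close> show ?thesis by (auto simp: smooth_def)
qed

text \<open>
  The functions \<open>exp (-1/t) / t ^ m\<close>, cut off at \<open>0\<close>, span a space closed under differentiation,
  which is why negative powers are carried along.
\<close>

definition bump :: "nat \<Rightarrow> real \<Rightarrow> real" where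
  "bump m t = (if 0 < t then exp (- 1 / t) / t ^ m else 0)"

lemma bump_has_derivative:
  "(bump m has_real_derivative bump (m + 2) t - real m * bump (m + 1) t) (at t)"
proof -
  consider "t > 0" | "t < 0" | "t = 0" by linarith
  then show ?thesis
  proof cases
    case 1
    have "((\<lambda>t. exp (- 1 / t) / t ^ m) has_real_derivative
            bump (m + 2) t - real m * bump (m + 1) t) (at t)"
    proof -
      have "((\<lambda>t. exp (- inverse t) * inverse t ^ m) has_real_derivative
             exp (- inverse t) * (inverse t ^ 2) * inverse t ^ m
              + exp (- inverse t) * (real m * inverse t ^ (m - 1) * (- (inverse t ^ 2)))) (at t)"
        using 1 by (auto intro!: derivative_eq_intros simp: power2_eq_square)
      also have "exp (- inverse t) * (inverse t ^ 2) * inverse t ^ m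
              + exp (- inverse t) * (real m * inverse t ^ (m - 1) * (- (inverse t ^ 2))) =
              bump (m + 2) t - real m * bump (m + 1) t"
        using 1 by (cases m)
          (simp_all add: bump_def divide_inverse power_inverse[symmetric] power2_eq_square algebra_simps)
      finally show ?thesis by (simp add: divide_inverse power_inverse)
    qed
    then show ?thesis
      by (rule has_field_derivative_transform_within_open[of _ _ _ "{0<..}"])
        (use 1 in \<open>auto simp: bump_def\<close>)
  next
    case 2
    then have "bump (m + 2) t - real m * bump (m + 1) t = 0"
      by (simp add: bump_def)
    then show ?thesis
      using has_field_derivative_transform_within_open[of "\<lambda>_. 0" 0 t "{..<0}" "bump m"] 2
      by (auto simp: bump_def)
  next
    case 3
    have "((\<lambda>h. bump m h / h) \<longlongrightarrow> 0) (at 0)"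
      unfolding filterlim_at_split
    proof
      have "\<forall>\<^sub>F h in at_left 0. bump m h / h = (0::real)"
        unfolding eventually_at_filter by (simp add: bump_def)
      then show "((\<lambda>h. bump m h / h) \<longlongrightarrow> 0) (at_left 0)"
        by (rule tendsto_eventually)
      have "((\<lambda>h::real. inverse h ^ (m+1) / exp (inverse h)) \<longlongrightarrow> 0) (at_right 0)"
        by (rule filterlim_compose[OF tendsto_power_div_exp_0 filterlim_inverse_at_top_right])
      moreover have "\<forall>\<^sub>F h in at_right 0. inverse h ^ (m+1) / exp (inverse h) = bump m h / (h::real)"
        unfolding eventually_at_filter by (simp add: bump_def exp_minus field_simps)
      ultimately show "((\<lambda>h. bump m h / h) \<longlongrightarrow> 0) (at_right 0)"
        using Lim_transform_eventually by fast
    qed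
    with 3 show ?thesis by (simp add: DERIV_def bump_def)
  qed
qed

text \<open>
  The derivatives of the generators lie again in the algebra that they generate; coinduction
  therefore proves the smoothness of bump functions, sums and products in one argument.
\<close>

inductive smooth_generated :: "(real ^ 'n \<Rightarrow> real) \<Rightarrow> bool" where
  base: "smooth f \<Longrightarrow> smooth_generated f"
| const: "smooth_generated (\<lambda>x. c)"
| coord: "smooth_generated (\<lambda>x. x $ i)"
| bump: "smooth_generated (\<lambda>x. bump m (r - x \<bullet> x))"
| add: "smooth_generated f \<Longrightarrow> smooth_generated g \<Longrightarrow> smooth_generated (\<lambda>x. f x + g x)"
| mult: "smooth_generated f \<Longrightarrow> smooth_generated g \<Longrightarrow> smooth_generated (\<lambda>x. f x * g x)"

lemma partial_const: "partial i (\<lambda>x. c) = (\<lambda>x. 0)"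
  by (rule ext, rule partial_eqI[OF has_derivative_const])

lemma bump_ball_has_derivative:
  "((\<lambda>x::real^'n. bump m (r - x \<bullet> x)) has_derivative
     (\<lambda>h. (bump (m + 2) (r - x \<bullet> x) - real m * bump (m + 1) (r - x \<bullet> x)) * (- 2 * (x \<bullet> h)))) (at x)"
proof -
  have "((\<lambda>x::real^'n. r - x \<bullet> x) has_derivative (\<lambda>h. - 2 * (x \<bullet> h))) (at x)"
    by (auto intro!: derivative_eq_intros simp: inner_commute)
  from has_derivative_compose[OF this bump_has_derivative[unfolded has_field_derivative_def]]
  show ?thesis by (simp add: mult.commute)
qed

lemma partial_coord: "partial i (\<lambda>x. x $ j) = (\<lambda>x. axis i 1 $ j)"
  by (rule ext, rule partial_eqI, rule bounded_linear.has_derivative[OF bounded_linear_vec_nth has_derivative_ident])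

lemma partial_add:
  assumes "f differentiable (at x)" "g differentiable (at x)"
  shows "partial i (\<lambda>x. f x + g x) x = partial i f x + partial i g x"
  using assms by (subst partial_eqI[OF has_derivative_add[OF
        assms[unfolded frechet_derivative_works]]]) (simp add: partial_def)

lemma partial_mult:
  assumes "f differentiable (at x)" "g differentiable (at x)"
  shows "partial i (\<lambda>x. f x * g x) x = f x * partial i g x + partial i f x * g x"
  using assms by (subst partial_eqI[OF has_derivative_mult[OF
        assms[unfolded frechet_derivative_works]]]) (simp add: partial_def)

lemma smooth_generated_derivative:
  assumes "smooth_generated f"
  shows "f differentiable (at x) \<and> smooth_generated (partial i f)"
  using assms
proof (induction arbitrary: x)
  case (base f)
  then show ?case
    by (auto intro: smooth_generated.base smooth_differentiable smooth_partial)
next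
  case (const c)
  then show ?case by (simp add: partial_const smooth_generated.const)
next
  case (coord j)
  have "(\<lambda>x::real^'a. x $ j) differentiable (at x)"
    by (intro bounded_linear_imp_differentiable bounded_linear_vec_nth)
  then show ?case by (simp add: partial_coord smooth_generated.const)
next
  case (bump m r)
  have "(\<lambda>x::real^'a. bump m (r - x \<bullet> x)) differentiable (at x)"
    unfolding differentiable_def by (rule exI, rule bump_ball_has_derivative)
  moreover have "partial i (\<lambda>x::real^'a. bump m (r - x \<bullet> x)) =
      (\<lambda>x. (bump (m + 2) (r - x \<bullet> x) + (- real m) * bump (m + 1) (r - x \<bullet> x)) * (- 2 * (x $ i)))"
    by (rule ext) (simp add: partial_eqI[OF bump_ball_has_derivative] inner_axis)
  moreover have "smooth_generated (\<lambda>x::real^'a.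
      (bump (m + 2) (r - x \<bullet> x) + (- real m) * bump (m + 1) (r - x \<bullet> x)) * (- 2 * (x $ i)))"
    by (intro smooth_generated.mult smooth_generated.add smooth_generated.bump
        smooth_generated.const smooth_generated.coord)
  ultimately show ?case by simp
next
  case (add f g)
  then have d: "f differentiable (at x)" "g differentiable (at x)" for x by blast+
  have "partial i (\<lambda>x. f x + g x) = (\<lambda>x. partial i f x + partial i g x)"
    by (rule ext) (rule partial_add[OF d])
  moreover have "smooth_generated (\<lambda>x. partial i f x + partial i g x)"
    by (rule smooth_generated.add) (use add in blast)+
  ultimately show ?case using d by (simp add: differentiable_add)
next
  case (mult f g)
  then have d: "f differentiable (at x)" "g differentiable (at x)" for x by blast+
  have "partial i (\<lambda>x. f x * g x) = (\<lambda>x. f x * partial i g x + partial i f x * g x)"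
    by (rule ext) (rule partial_mult[OF d])
  moreover have "smooth_generated (\<lambda>x. f x * partial i g x + partial i f x * g x)"
    by (rule smooth_generated.add; rule smooth_generated.mult) (use mult in blast)+
  ultimately show ?case using d by (simp add: differentiable_mult)
qed

lemma smooth_generated_imp_smooth: "smooth_generated f \<Longrightarrow> smooth f"
  by (rule smooth_coinduct[of smooth_generated]) (auto simp: smooth_generated_derivative)

lemma smooth_const: "smooth (\<lambda>x. c)"
  by (rule smooth_generated_imp_smooth, rule smooth_generated.const)

lemma smooth_add: "smooth f \<Longrightarrow> smooth g \<Longrightarrow> smooth (\<lambda>x. f x + g x)"
  by (rule smooth_generated_imp_smooth, rule smooth_generated.add; erule smooth_generated.base)

lemma smooth_mult: "smooth f \<Longrightarrow> smooth g \<Longrightarrow> smooth (\<lambda>x. f x * g x)"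
  by (rule smooth_generated_imp_smooth, rule smooth_generated.mult; erule smooth_generated.base)

lemma smooth_diff: "smooth f \<Longrightarrow> smooth g \<Longrightarrow> smooth (\<lambda>x. f x - g x)"
  using smooth_add[OF _ smooth_mult[OF smooth_const[of "-1"]], of f g] by simp

lemma smooth_bump_ball: "smooth (\<lambda>x. c * bump m (r - x \<bullet> x))"
  by (rule smooth_generated_imp_smooth, rule smooth_generated.mult;
      rule smooth_generated.const smooth_generated.bump)

section \<open>Mollification\<close>

definition mollify :: "(real ^ 'n \<Rightarrow> real) \<Rightarrow> (real ^ 'n \<Rightarrow> real) \<Rightarrow> real ^ 'n \<Rightarrow> real" where
  "mollify \<rho> \<psi> x = (LINT y|lborel. \<rho> (x - y) * \<psi> y)"

lemma integrable_continuous_compact_support: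
  fixes f :: "real ^ 'n \<Rightarrow> real"
  assumes "continuous_on UNIV f" "compact K" "\<And>x. x \<notin> K \<Longrightarrow> f x = 0"
  shows "integrable lborel f"
proof -
  have "integrable lborel (\<lambda>x. indicator K x *\<^sub>R f x)"
    using assms by (intro borel_integrable_compact) (auto intro: continuous_on_subset)
  moreover have "(\<lambda>x. indicator K x *\<^sub>R f x) = f"
    by (rule ext) (use assms(3) in \<open>auto simp: indicator_def\<close>)
  ultimately show ?thesis by simp
qed

lemma continuous_on_shift:
  assumes "continuous_on UNIV (f :: real ^ 'n \<Rightarrow> real)"
  shows "continuous_on S (\<lambda>y. f (x - y))"
  by (rule continuous_on_compose2[OF assms]) (auto intro!: continuous_intros)

lemma integral_reflect_shift:
  fixes f :: "real ^ 'n \<Rightarrow> real"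
  assumes "continuous_on UNIV f"
  shows "(LINT y|lborel. f y) = (LINT z|lborel. f (x - z))"
proof -
  have "(LINT y|lborel. f y) =
      (LINT y|density (distr lborel borel (\<lambda>z. x + (-1) *\<^sub>R z)) (\<lambda>_. \<bar>-1::real\<bar> ^ DIM(real^'n)). f y)"
    by (subst lborel_affine[of "-1" x]) auto
  also have "\<dots> = (LINT y|distr lborel borel (\<lambda>z. x + (-1) *\<^sub>R z). f y)"
    by (simp add: density_1)
  also have "\<dots> = (LINT z|lborel. f (x - z))"
    using assms by (subst integral_distr) (auto intro: borel_measurable_continuous_onI)
  finally show ?thesis .
qed

lemma mollify_swap:
  assumes "continuous_on UNIV \<rho>" "continuous_on UNIV \<psi>"
  shows "mollify \<rho> \<psi> x = (LINT z|lborel. \<rho> z * \<psi> (x - z))"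
proof -
  have "continuous_on UNIV (\<lambda>y. \<rho> (x - y) * \<psi> y)"
    using assms by (intro continuous_intros continuous_on_shift)
  from integral_reflect_shift[OF this, of x] show ?thesis
    by (simp add: mollify_def)
qed

lemma mollify_has_derivative:
  fixes \<rho> \<psi> :: "real ^ 'n \<Rightarrow> real"
  assumes \<rho>: "smooth \<rho>" and \<psi>: "continuous_on UNIV \<psi>"
    and K: "compact K" "\<And>x. x \<notin> K \<Longrightarrow> \<psi> x = 0"
  shows "(mollify \<rho> \<psi> has_derivative
           (\<lambda>h. (LINT y|lborel. \<psi> y * (grad \<rho> (x - y) \<bullet> h)))) (at x)"
proof -
  obtain a b where ab: "K \<subseteq> cbox a b"
    using compact_imp_bounded[OF K(1)] bounded_subset_cbox_symmetric by metis
  have boxed: "(LINT y|lborel. f y * \<psi> y) = integral (cbox a b) (\<lambda>y. f y * \<psi> y)"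
    if f: "continuous_on UNIV f" for f
  proof -
    have "integrable lborel (\<lambda>y. f y * \<psi> y)"
      by (rule integrable_continuous_compact_support[OF _ K(1)]) (auto intro!: continuous_intros f \<psi> simp: K)
    from integral_lborel[OF this] have "(LINT y|lborel. f y * \<psi> y) = integral UNIV (\<lambda>y. f y * \<psi> y)"
      by simp
    also have "\<dots> = integral UNIV (\<lambda>y. if y \<in> cbox a b then f y * \<psi> y else 0)"
      by (intro arg_cong[where f="integral UNIV"] ext) (use ab K(2) in auto)
    also have "\<dots> = integral (cbox a b) (\<lambda>y. f y * \<psi> y)"
      by (rule integral_restrict_UNIV)
    finally show ?thesis .
  qed
  let ?D = "\<lambda>x y. \<psi> y *\<^sub>R blinfun_inner_right (grad \<rho> (x - y))"
  have grad_cont: "continuous_on S (\<lambda>x. grad \<rho> (f x))" if "continuous_on S f" for f and S :: "'b::topological_space set"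
    using continuous_on_compose2[OF smooth_continuous_grad[OF \<rho>] that] by auto
  have \<psi>_cont: "continuous_on S (\<lambda>x. \<psi> (f x))" if "continuous_on S f" for f and S :: "'b::topological_space set"
    using continuous_on_compose2[OF \<psi> that] by auto
  have cont: "continuous_on (UNIV \<times> cbox a b) (\<lambda>(x, y). ?D x y)"
    unfolding split_beta
    by (intro continuous_intros \<psi>_cont bounded_linear.continuous_on[OF bounded_linear_blinfun_inner_right] grad_cont)
  have "((\<lambda>x. integral (cbox a b) (\<lambda>y. \<rho> (x - y) * \<psi> y)) has_derivative
      integral (cbox a b) (?D x)) (at x within UNIV)"
  proof (rule leibniz_rule[where U = UNIV])
    fix x y
    have "((\<lambda>x. \<rho> (x - y)) has_derivative (\<lambda>h. grad \<rho> (x - y) \<bullet> h)) (at x)"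
      by (rule has_derivative_compose[of "\<lambda>x. x - y" "\<lambda>h. h" x UNIV \<rho>, OF _ has_derivative_grad[OF smooth_differentiable[OF \<rho>]]])
        (auto intro!: derivative_eq_intros)
    from has_derivative_mult_left[OF this, of "\<psi> y"]
    show "((\<lambda>x. \<rho> (x - y) * \<psi> y) has_derivative blinfun_apply (?D x y)) (at x within UNIV)"
      by (simp add: scaleR_blinfun.rep_eq mult.commute)
  next
    show "(\<lambda>y. \<rho> (x - y) * \<psi> y) integrable_on cbox a b" for x
      by (intro integrable_continuous continuous_intros continuous_on_shift smooth_continuous \<rho>
          continuous_on_subset[OF \<psi>]) auto
  qed (use cont in auto)
  moreover have "(\<lambda>x. integral (cbox a b) (\<lambda>y. \<rho> (x - y) * \<psi> y)) = mollify \<rho> \<psi>"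
    unfolding mollify_def
    by (rule ext, rule boxed[symmetric], intro continuous_on_shift smooth_continuous \<rho>)
  moreover have "blinfun_apply (integral (cbox a b) (?D x)) h = (LINT y|lborel. \<psi> y * (grad \<rho> (x - y) \<bullet> h))" for h
  proof -
    have "continuous_on (cbox a b) (?D x)"
      by (intro continuous_intros continuous_on_subset[OF \<psi>] bounded_linear.continuous_on[OF bounded_linear_blinfun_inner_right] grad_cont) auto
    then have "?D x integrable_on cbox a b" by (rule integrable_continuous)
    then have "blinfun_apply (integral (cbox a b) (?D x)) h = integral (cbox a b) (\<lambda>y. blinfun_apply (?D x y) h)"
      by (rule blinfun_apply_integral)
    also have "\<dots> = integral (cbox a b) (\<lambda>y. (grad \<rho> (x - y) \<bullet> h) * \<psi> y)"
      by (simp add: scaleR_blinfun.rep_eq mult.commute)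
    also have "\<dots> = (LINT y|lborel. (grad \<rho> (x - y) \<bullet> h) * \<psi> y)"
      by (rule boxed[symmetric]) (intro continuous_intros grad_cont)
    finally show ?thesis by (simp add: mult.commute)
  qed
  then have "blinfun_apply (integral (cbox a b) (?D x)) = (\<lambda>h. LINT y|lborel. \<psi> y * (grad \<rho> (x - y) \<bullet> h))"
    by (rule ext)
  ultimately show ?thesis by (simp only:)
qed

text \<open>
  Derivatives fall on the kernel, so the mollifications of \<open>\<psi>\<close> by all smooth kernels form a class
  that is closed under partial differentiation.
\<close>

lemma smooth_mollify:
  fixes \<rho> \<psi> :: "real ^ 'n \<Rightarrow> real"
  assumes "smooth \<rho>" and \<psi>: "continuous_on UNIV \<psi>" "compact K" "\<And>x. x \<notin> K \<Longrightarrow> \<psi> x = 0"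
  shows "smooth (mollify \<rho> \<psi>)"
proof (rule smooth_coinduct[of "\<lambda>f. \<exists>\<rho>. smooth \<rho> \<and> f = mollify \<rho> \<psi>"])
  fix f and x :: "real ^ 'n" assume "\<exists>\<rho>. smooth \<rho> \<and> f = mollify \<rho> \<psi>"
  then obtain \<rho> where \<rho>: "smooth \<rho>" "f = mollify \<rho> \<psi>" by blast
  show "f differentiable (at x)"
    unfolding \<rho> differentiable_def by (rule exI, rule mollify_has_derivative[OF \<rho>(1) \<psi>])
next
  fix f i assume "\<exists>\<rho>. smooth \<rho> \<and> f = mollify \<rho> \<psi>"
  then obtain \<rho> where \<rho>: "smooth \<rho>" "f = mollify \<rho> \<psi>" by blast
  have "partial i f x = mollify (partial i \<rho>) \<psi> x" for x
  proof -
    have "partial i (mollify \<rho> \<psi>) x = (LINT y|lborel. \<psi> y * (grad \<rho> (x - y) \<bullet> axis i 1))"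
      by (rule partial_eqI) (rule mollify_has_derivative[OF \<rho>(1) \<psi>])
    then show ?thesis
      by (simp add: \<rho>(2) mollify_def inner_axis grad_def mult.commute)
  qed
  then have "partial i f = mollify (partial i \<rho>) \<psi>" by auto
  then show "\<exists>\<rho>. smooth \<rho> \<and> partial i f = mollify \<rho> \<psi>"
    using smooth_partial[OF \<rho>(1)] by blast
qed (use assms(1) in blast)

definition mollifier :: "real \<Rightarrow> (real ^ 'n \<Rightarrow> real) \<Rightarrow> bool" where
  "mollifier \<delta> \<rho> \<longleftrightarrow> smooth \<rho> \<and> (\<forall>z. 0 \<le> \<rho> z) \<and> (\<forall>z. \<delta> \<le> norm z \<longrightarrow> \<rho> z = 0) \<and>
     (LINT z|lborel. \<rho> z) = 1"

lemma mollifier_exists: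
  assumes "0 < \<delta>"
  obtains \<rho> :: "real ^ 'n \<Rightarrow> real" where "mollifier \<delta> \<rho>"
proof -
  let ?\<beta> = "\<lambda>z::real^'n. bump 0 (\<delta>\<^sup>2 - z \<bullet> z)"
  have smooth: "smooth (\<lambda>z::real^'n. c * ?\<beta> z)" for c by (rule smooth_bump_ball)
  have nonneg: "0 \<le> ?\<beta> z" for z by (simp add: bump_def)
  have pos_iff: "?\<beta> z \<noteq> 0 \<longleftrightarrow> norm z < \<delta>" for z
    using assms abs_le_square_iff[of \<delta> "norm z"]
    by (auto simp: bump_def dot_square_norm not_le[symmetric])
  have cont: "continuous_on UNIV ?\<beta>" using smooth_continuous[OF smooth[of 1]] by simp
  have int: "integrable lborel ?\<beta>"
    by (rule integrable_continuous_compact_support[OF cont, of "cball 0 \<delta>"]) (use pos_iff in force)+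
  have "(LINT z|lborel. ?\<beta> z) \<noteq> 0"
  proof
    assume "(LINT z|lborel. ?\<beta> z) = 0"
    then have "AE z in lborel. ?\<beta> z = 0"
      using integral_nonneg_eq_0_iff_AE[OF int] nonneg by simp
    then have "ball 0 \<delta> \<in> null_sets (lborel :: (real^'n) measure)"
      by (subst AE_iff_null_sets) (use pos_iff in \<open>auto elim!: eventually_mono\<close>)
    then have "negligible (ball (0::real^'n) \<delta>)"
      by (simp add: negligible_iff_null_sets null_sets_completionI)
    then show False using assms open_not_negligible[of "ball (0::real^'n) \<delta>"] by auto
  qed
  moreover have "0 \<le> (LINT z|lborel. ?\<beta> z)" using nonneg by simp
  moreover have "?\<beta> z = 0" if "\<delta> \<le> norm z" for z using that pos_iff[of z] by linarith
  ultimately have "mollifier \<delta> (\<lambda>z. (1 / (LINT z|lborel. ?\<beta> z)) * ?\<beta> z)"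
    unfolding mollifier_def using smooth[of "1 / (LINT z|lborel. ?\<beta> z)"] nonneg by auto
  then show ?thesis by (rule that)
qed

lemma mollifier_integrable:
  assumes "mollifier \<delta> \<rho>" "continuous_on UNIV f"
  shows "integrable lborel (\<lambda>z. \<rho> z * f z)"
  by (rule integrable_continuous_compact_support[of _ "cball 0 \<delta>"])
    (use assms in \<open>auto simp: mollifier_def intro: continuous_on_mult smooth_continuous\<close>)

text \<open>
  A mollifier is a probability density on a small ball.
\<close>

lemma mollifier_average_le:
  fixes f :: "real ^ 'n \<Rightarrow> real"
  assumes \<rho>: "mollifier \<delta> \<rho>" and f: "continuous_on UNIV f"
    and le: "\<And>z. norm z < \<delta> \<Longrightarrow> \<bar>f z\<bar> \<le> C"
  shows "\<bar>LINT z|lborel. \<rho> z * f z\<bar> \<le> C"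
proof -
  have "\<bar>LINT z|lborel. \<rho> z * f z\<bar> \<le> (LINT z|lborel. \<bar>\<rho> z * f z\<bar>)"
    by (rule integral_abs_bound)
  also have "\<dots> \<le> (LINT z|lborel. \<rho> z * C)"
  proof (rule integral_mono)
    show "integrable lborel (\<lambda>z. \<bar>\<rho> z * f z\<bar>)"
      using mollifier_integrable[OF \<rho> f] by simp
    show "integrable lborel (\<lambda>z. \<rho> z * C)"
      using mollifier_integrable[OF \<rho>, of "\<lambda>_. C"] by simp
    show "\<bar>\<rho> z * f z\<bar> \<le> \<rho> z * C" for z
      using \<rho> le[of z] by (cases "norm z < \<delta>") (auto simp: mollifier_def abs_mult intro: mult_left_mono)
  qed
  also have "\<dots> = C" using \<rho> by (simp add: mollifier_def)
  finally show ?thesis .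
qed

text \<open>
  The notion of differentiability for which mollification at a sufficiently small scale returns
  the slope exactly, so that gradients of mollified functions converge without further analysis.
\<close>

definition locally_affine :: "(real ^ 'n \<Rightarrow> real) \<Rightarrow> real ^ 'n \<Rightarrow> real ^ 'n \<Rightarrow> bool" where
  "locally_affine f x a \<longleftrightarrow> (\<exists>r>0. \<forall>y\<in>ball x r. f y = f x + a \<bullet> (y - x))"

lemma locally_affine_has_derivative:
  assumes "locally_affine f x a"
  shows "(f has_derivative (\<lambda>h. a \<bullet> h)) (at x)"
proof -
  obtain r where r: "r > 0" "\<And>y. y \<in> ball x r \<Longrightarrow> f y = f x + a \<bullet> (y - x)"
    using assms unfolding locally_affine_def by blast
  have "((\<lambda>y. f x + a \<bullet> (y - x)) has_derivative (\<lambda>h. a \<bullet> h)) (at x)"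
    by (auto intro!: derivative_eq_intros)
  then show ?thesis
    by (rule has_derivative_transform_within_open[OF _ open_ball centre_in_ball[THEN iffD2, OF r(1)]])
      (rule r(2)[symmetric])
qed

lemma locally_affine_outside_support:
  assumes "compact K" "\<And>x. x \<notin> K \<Longrightarrow> f x = 0" "x \<notin> K"
  shows "locally_affine f x 0"
proof -
  have "open (- K)" using assms(1) by (simp add: compact_imp_closed open_Compl)
  then obtain r where "r > 0" "ball x r \<subseteq> - K"
    using assms(3) open_contains_ball by (metis ComplI)
  then show ?thesis
    unfolding locally_affine_def using assms by (intro exI[of _ r]) auto
qed

lemma grad_outside_support:
  assumes "compact K" "\<And>x. x \<notin> K \<Longrightarrow> f x = 0" "x \<notin> K"
  shows "grad f x = 0"
  by (rule grad_eqI[OF locally_affine_has_derivative[OF locally_affine_outside_support[OF assms]]])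

text \<open>
  After the substitution \<open>y = x - z\<close> a mollification is an average of translates, and translation
  preserves Lipschitz constants and slopes.
\<close>

lemma mollify_approx:
  fixes \<psi> :: "real ^ 'n \<Rightarrow> real"
  assumes \<rho>: "mollifier \<delta> \<rho>" and \<psi>: "L-lipschitz_on UNIV \<psi>"
  shows "\<bar>mollify \<rho> \<psi> x - \<psi> x\<bar> \<le> L * \<delta>"
    and "L-lipschitz_on UNIV (mollify \<rho> \<psi>)"
    and "\<And>r a. \<lbrakk>\<And>y. y \<in> ball x r \<Longrightarrow> \<psi> y = \<psi> x + a \<bullet> (y - x); 0 < \<delta>; \<delta> < r / 2\<rbrakk> \<Longrightarrow> grad (mollify \<rho> \<psi>) x = a"
    and "mollify \<rho> \<psi> x \<noteq> 0 \<Longrightarrow> \<exists>y. \<psi> y \<noteq> 0 \<and> dist x y < \<delta>"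
proof -
  have cont: "continuous_on UNIV \<psi>" and L: "0 \<le> L"
    using lipschitz_on_continuous_on[OF \<psi>] lipschitz_on_nonneg[OF \<psi>] by auto
  have lip: "\<bar>\<psi> x - \<psi> y\<bar> \<le> L * dist x y" for x y
    using lipschitz_onD[OF \<psi>] by (simp add: dist_real_def)
  have \<rho>cont: "continuous_on UNIV \<rho>" using \<rho> by (auto simp: mollifier_def intro: smooth_continuous)
  have eq: "mollify \<rho> \<psi> x = (LINT z|lborel. \<rho> z * \<psi> (x - z))" for x
    by (rule mollify_swap[OF \<rho>cont cont])
  have int: "integrable lborel (\<lambda>z. \<rho> z * \<psi> (x - z))" for x
    by (rule mollifier_integrable[OF \<rho> continuous_on_shift[OF cont]])
  have const: "integrable lborel (\<lambda>z. \<rho> z * c)" "(LINT z|lborel. \<rho> z * c) = c" for c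
    using mollifier_integrable[OF \<rho>, of "\<lambda>_. c"] \<rho> by (auto simp: mollifier_def)
  have "mollify \<rho> \<psi> x - \<psi> x = (LINT z|lborel. \<rho> z * (\<psi> (x - z) - \<psi> x))"
    unfolding eq right_diff_distrib Bochner_Integration.integral_diff[OF int const(1)] const ..
  also have "\<bar>\<dots>\<bar> \<le> L * \<delta>"
  proof (rule mollifier_average_le[OF \<rho>])
    fix z :: "real ^ 'n" assume "norm z < \<delta>"
    have "\<bar>\<psi> (x - z) - \<psi> x\<bar> \<le> L * norm z" using lip[of "x - z" x] by (simp add: dist_norm)
    also have "\<dots> \<le> L * \<delta>" using \<open>norm z < \<delta>\<close> L by (intro mult_left_mono) auto
    finally show "\<bar>\<psi> (x - z) - \<psi> x\<bar> \<le> L * \<delta>" .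
  qed (intro continuous_intros continuous_on_shift cont)
  finally show "\<bar>mollify \<rho> \<psi> x - \<psi> x\<bar> \<le> L * \<delta>" .
  show "L-lipschitz_on UNIV (mollify \<rho> \<psi>)"
  proof (rule lipschitz_onI)
    fix x y :: "real ^ 'n"
    have "mollify \<rho> \<psi> x - mollify \<rho> \<psi> y = (LINT z|lborel. \<rho> z * (\<psi> (x - z) - \<psi> (y - z)))"
      by (simp add: eq right_diff_distrib Bochner_Integration.integral_diff[OF int int])
    also have "\<bar>\<dots>\<bar> \<le> L * dist x y"
      by (rule mollifier_average_le[OF \<rho>])
        (use lip[of "x - z" "y - z" for z] in
          \<open>auto simp: dist_norm intro!: continuous_intros continuous_on_shift cont\<close>)
    finally show "dist (mollify \<rho> \<psi> x) (mollify \<rho> \<psi> y) \<le> L * dist x y"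
      by (simp add: dist_real_def)
  qed (rule L)
  show "grad (mollify \<rho> \<psi>) x = a"
    if aff: "\<And>y. y \<in> ball x r \<Longrightarrow> \<psi> y = \<psi> x + a \<bullet> (y - x)" and r: "0 < \<delta>" "\<delta> < r / 2" for r a
  proof (rule grad_eqI, rule locally_affine_has_derivative, unfold locally_affine_def, intro exI conjI ballI)
    show "0 < r / 2" using r by simp
    fix y assume y: "y \<in> ball x (r / 2)"
    have "mollify \<rho> \<psi> y - mollify \<rho> \<psi> x = (LINT z|lborel. \<rho> z * (\<psi> (y - z) - \<psi> (x - z)))"
      by (simp add: eq right_diff_distrib Bochner_Integration.integral_diff[OF int int])
    also have "\<dots> = (LINT z|lborel. \<rho> z * (a \<bullet> (y - x)))"
    proof (rule Bochner_Integration.integral_cong[OF refl])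
      fix z
      show "\<rho> z * (\<psi> (y - z) - \<psi> (x - z)) = \<rho> z * (a \<bullet> (y - x))"
      proof (cases "norm z < \<delta>")
        case True
        have "dist x (y - z) \<le> dist x y + norm z"
          using norm_triangle_ineq[of "x - y" z] by (simp add: dist_norm algebra_simps)
        then have "y - z \<in> ball x r" "x - z \<in> ball x r"
          using True y r by (auto simp: dist_norm)
        then show ?thesis using aff by (simp add: inner_diff_right)
      qed (use \<rho> in \<open>auto simp: mollifier_def\<close>)
    qed
    also have "\<dots> = a \<bullet> (y - x)" by (rule const)
    finally show "mollify \<rho> \<psi> y = mollify \<rho> \<psi> x + a \<bullet> (y - x)" by simp
  qed
  show "\<exists>y. \<psi> y \<noteq> 0 \<and> dist x y < \<delta>" if "mollify \<rho> \<psi> x \<noteq> 0"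
  proof (rule ccontr)
    assume none: "\<not> ?thesis"
    have "\<rho> (x - y) * \<psi> y = 0" for y
      using none \<rho> by (cases "dist x y < \<delta>") (auto simp: mollifier_def dist_norm)
    then have "mollify \<rho> \<psi> x = 0" by (simp only: mollify_def) simp
    with that show False by simp
  qed
qed

text \<open>
  Mollification at radii shrinking to zero and small enough for the supports to stay in \<open>\<Omega>\<close>.  The
  inherited Lipschitz constant bounds the gradients uniformly; at a point near which \<open>\<psi>\<close> is affine the gradients are eventually equal to its slope.
\<close>

proposition lipschitz_test_function_approximation:
  fixes \<psi> :: "real ^ 'n \<Rightarrow> real"
  assumes \<Omega>: "open \<Omega>" and K: "compact K" "K \<subseteq> \<Omega>"
    and \<psi>: "L-lipschitz_on UNIV \<psi>" "\<And>x. x \<notin> K \<Longrightarrow> \<psi> x = 0"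
  obtains \<phi> K' B where "compact K'" "K' \<subseteq> \<Omega>" "\<And>k. test_function \<Omega> (\<phi> k)"
    "\<And>k x. x \<notin> K' \<Longrightarrow> \<phi> k x = 0" "\<And>k. L-lipschitz_on UNIV (\<phi> k)"
    "\<And>k x. \<bar>\<phi> k x\<bar> \<le> B" "\<And>x. (\<lambda>k. \<phi> k x) \<longlonglongrightarrow> \<psi> x"
    "\<And>x a. locally_affine \<psi> x a \<Longrightarrow> \<forall>\<^sub>F k in sequentially. grad (\<phi> k) x = a"
proof -
  obtain e where e: "0 < e" "{x + y |x y. x \<in> K \<and> y \<in> cball 0 e} \<subseteq> \<Omega>"
  proof -
    obtain e where "0 < e" "(\<Union>x\<in>K. ball x e) \<subseteq> \<Omega>"
      using compact_in_open_separated compact_subset_open_imp_ball_epsilon_subset[OF K(1) \<Omega> K(2)] by blast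
    then have "0 < e / 2" "{x + y |x y. x \<in> K \<and> y \<in> cball 0 (e/2)} \<subseteq> \<Omega>"
      by (force simp: subset_iff dist_norm)+
    then show ?thesis by (rule that)
  qed
  define K' where "K' = {x + y |x y. x \<in> K \<and> y \<in> cball 0 e}"
  define \<delta> where "\<delta> k = e * inverse (real (Suc k))" for k
  have \<delta>: "0 < \<delta> k" "\<delta> k \<le> e" for k
    using e by (auto simp: \<delta>_def field_simps)
  have \<delta>_lim: "\<delta> \<longlonglongrightarrow> 0"
    unfolding \<delta>_def[abs_def] using tendsto_mult_left[OF LIMSEQ_inverse_real_of_nat, of e] by simp
  obtain \<rho> :: "nat \<Rightarrow> real ^ 'n \<Rightarrow> real" where \<rho>: "\<And>k. mollifier (\<delta> k) (\<rho> k)"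
    using mollifier_exists[OF \<delta>(1)] by metis
  define \<phi> where "\<phi> k = mollify (\<rho> k) \<psi>" for k
  have cont: "continuous_on UNIV \<psi>" and L: "0 \<le> L"
    using lipschitz_on_continuous_on[OF \<psi>(1)] lipschitz_on_nonneg[OF \<psi>(1)] by auto
  have K': "compact K'" unfolding K'_def by (rule compact_sums[OF K(1) compact_cball])
  have close: "\<bar>\<phi> k x - \<psi> x\<bar> \<le> L * \<delta> k" for k x
    unfolding \<phi>_def by (rule mollify_approx(1)[OF \<rho> \<psi>(1)])
  have supp: "\<phi> k x = 0" if "x \<notin> K'" for k x
  proof (rule ccontr)
    assume "\<phi> k x \<noteq> 0"
    then obtain y where y: "\<psi> y \<noteq> 0" "dist x y < \<delta> k"
      unfolding \<phi>_def using mollify_approx(4)[OF \<rho> \<psi>(1)] by blast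
    then have "y \<in> K" "x - y \<in> cball 0 e"
      using \<psi>(2) \<delta>(2)[of k] by (auto simp: dist_norm norm_minus_commute)
    then have "y + (x - y) \<in> K'" unfolding K'_def by blast
    with that show False by simp
  qed
  obtain C where C: "\<And>x. \<bar>\<psi> x\<bar> \<le> C"
  proof -
    have "bounded (\<psi> ` K)"
      by (intro compact_imp_bounded compact_continuous_image continuous_on_subset[OF cont] K) auto
    then obtain C where "\<forall>x\<in>K. \<bar>\<psi> x\<bar> \<le> C" by (auto simp: bounded_iff)
    then have "\<bar>\<psi> x\<bar> \<le> max C 0" for x using \<psi>(2)[of x] by (cases "x \<in> K") force+
    then show ?thesis by (rule that)
  qed
  show ?thesis
  proof (rule that)
    show "compact K'" "K' \<subseteq> \<Omega>" using K' e by (auto simp: K'_def)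
    show "test_function \<Omega> (\<phi> k)" for k
      unfolding test_function_def smooth_def[symmetric]
    proof (intro conjI exI[of _ K'])
      show "smooth (\<phi> k)" unfolding \<phi>_def
        by (rule smooth_mollify[OF _ cont K(1) \<psi>(2)]) (use \<rho> in \<open>auto simp: mollifier_def\<close>)
    qed (use K' e supp in \<open>auto simp: K'_def\<close>)
    show "\<phi> k x = 0" if "x \<notin> K'" for k x using supp[OF that] .
    show "L-lipschitz_on UNIV (\<phi> k)" for k
      unfolding \<phi>_def by (rule mollify_approx(2)[OF \<rho> \<psi>(1)])
    show "\<bar>\<phi> k x\<bar> \<le> C + L * e" for k x
      using close[of k x] C[of x] mult_left_mono[OF \<delta>(2)[of k] L] by linarith
    show "(\<lambda>k. \<phi> k x) \<longlonglongrightarrow> \<psi> x" for x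
    proof (rule LIM_zero_cancel, rule Lim_null_comparison)
      show "\<forall>\<^sub>F k in sequentially. norm (\<phi> k x - \<psi> x) \<le> L * \<delta> k"
        using close by (auto intro!: always_eventually)
      show "(\<lambda>k. L * \<delta> k) \<longlonglongrightarrow> 0"
        using tendsto_mult_left[OF \<delta>_lim, of L] by simp
    qed
    fix x a assume "locally_affine \<psi> x a"
    then obtain r where r: "0 < r" "\<And>y. y \<in> ball x r \<Longrightarrow> \<psi> y = \<psi> x + a \<bullet> (y - x)"
      unfolding locally_affine_def by blast
    have "\<forall>\<^sub>F k in sequentially. \<delta> k < r / 2"
      using order_tendstoD(2)[OF \<delta>_lim, of "r / 2"] r by simp
    then show "\<forall>\<^sub>F k in sequentially. grad (\<phi> k) x = a"
      by eventually_elim (use mollify_approx(3)[OF \<rho> \<psi>(1) r(2) \<delta>(1)] in \<open>auto simp: \<phi>_def\<close>)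
  qed
qed

section \<open>Uniqueness of weak gradients\<close>

lemma test_functionD:
  assumes "test_function \<Omega> \<phi>"
  shows "smooth \<phi>" and "\<exists>K. compact K \<and> K \<subseteq> \<Omega> \<and> (\<forall>x. x \<notin> K \<longrightarrow> \<phi> x = 0)"
  using assms by (auto simp: test_function_def smooth_def)

lemma integrable_on_domain:
  fixes f :: "real ^ 'n \<Rightarrow> 'b::euclidean_space"
  assumes "open \<Omega>" "\<And>x. x \<notin> \<Omega> \<Longrightarrow> f x = 0"
  shows "integrable (lebesgue_on \<Omega>) f \<longleftrightarrow> integrable lebesgue f"
    and "integral\<^sup>L (lebesgue_on \<Omega>) f = integral\<^sup>L lebesgue f"
proof -
  have "(\<lambda>x. indicator \<Omega> x *\<^sub>R f x) = f"
    by (rule ext) (use assms(2) in \<open>auto simp: indicator_def\<close>)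
  moreover have "\<Omega> \<inter> space lebesgue \<in> sets lebesgue" using assms(1) by auto
  ultimately show "integrable (lebesgue_on \<Omega>) f \<longleftrightarrow> integrable lebesgue f"
    "integral\<^sup>L (lebesgue_on \<Omega>) f = integral\<^sup>L lebesgue f"
    by (simp_all add: integrable_restrict_space integral_restrict_space)
qed

lemma AE_lebesgue_on:
  assumes "open (\<Omega> :: (real ^ 'n) set)"
  shows "(AE x in lebesgue_on \<Omega>. P x) \<longleftrightarrow> (AE x in lebesgue. x \<in> \<Omega> \<longrightarrow> P x)"
  using assms by (intro AE_restrict_space_iff) auto

lemma continuous_lebesgue_on_measurable:
  fixes f :: "real ^ 'n \<Rightarrow> 'b::euclidean_space"
  assumes "continuous_on UNIV f"
  shows "f \<in> borel_measurable (lebesgue_on \<Omega>)"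
  by (intro measurable_restrict_space1 measurable_completion)
    (simp add: assms borel_measurable_continuous_onI)

lemma locally_integrable_dominant:
  assumes "locally_integrable \<Omega> g" "open \<Omega>" "compact K" "K \<subseteq> \<Omega>"
  shows "integrable (lebesgue_on \<Omega>) (\<lambda>x. indicator K x *\<^sub>R g x)"
    and "integrable (lebesgue_on \<Omega>) (\<lambda>x. C * (indicator K x * norm (g x)))"
proof -
  have K: "K \<inter> space lebesgue \<in> sets lebesgue"
    using fmeasurableD[OF lmeasurable_compact[OF assms(3)]] by simp
  have "integrable (lebesgue_on K) g" using assms by (auto simp: locally_integrable_def)
  then have "integrable lebesgue (\<lambda>x. indicator K x *\<^sub>R g x)"
    using integrable_restrict_space[OF K] by blast
  then show 1: "integrable (lebesgue_on \<Omega>) (\<lambda>x. indicator K x *\<^sub>R g x)"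
    by (subst integrable_on_domain[OF assms(2)]) (use assms(4) in \<open>auto simp: indicator_def\<close>)
  show "integrable (lebesgue_on \<Omega>) (\<lambda>x. C * (indicator K x * norm (g x)))"
    using integrable_norm[OF 1] by simp
qed

text \<open>
  The approximating test functions are uniformly bounded and supported in one compact set, so
  dominated convergence carries the identity over to their limit.
\<close>

lemma orthogonal_to_lipschitz:
  fixes g :: "real ^ 'n \<Rightarrow> real"
  assumes g: "locally_integrable \<Omega> g" and \<Omega>: "open \<Omega>"
    and zero: "\<And>\<phi>. test_function \<Omega> \<phi> \<Longrightarrow> (LINT x|lebesgue_on \<Omega>. g x * \<phi> x) = 0"
    and \<psi>: "L-lipschitz_on UNIV \<psi>" "compact K" "K \<subseteq> \<Omega>" "\<And>x. x \<notin> K \<Longrightarrow> \<psi> x = 0"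
  shows "(LINT x|lebesgue_on \<Omega>. g x * \<psi> x) = 0"
proof -
  obtain \<phi> K' B where \<phi>: "compact K'" "K' \<subseteq> \<Omega>" "\<And>k. test_function \<Omega> (\<phi> k)"
    "\<And>k x. x \<notin> K' \<Longrightarrow> \<phi> k x = 0" "\<And>k x. \<bar>\<phi> k x\<bar> \<le> B" "\<And>x. (\<lambda>k. \<phi> k x) \<longlonglongrightarrow> \<psi> x"
    using lipschitz_test_function_approximation[OF \<Omega> \<psi>(2,3,1,4)] by metis
  have gm: "g \<in> borel_measurable (lebesgue_on \<Omega>)" using g by (simp add: locally_integrable_def)
  have "(\<lambda>k. LINT x|lebesgue_on \<Omega>. g x * \<phi> k x) \<longlonglongrightarrow> (LINT x|lebesgue_on \<Omega>. g x * \<psi> x)"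
  proof (rule integral_dominated_convergence[where w = "\<lambda>x. B * (indicator K' x * norm (g x))"])
    show "(\<lambda>x. g x * \<psi> x) \<in> borel_measurable (lebesgue_on \<Omega>)"
      by (intro borel_measurable_times gm continuous_lebesgue_on_measurable lipschitz_on_continuous_on[OF \<psi>(1)])
    show "(\<lambda>x. g x * \<phi> k x) \<in> borel_measurable (lebesgue_on \<Omega>)" for k
      by (intro borel_measurable_times gm continuous_lebesgue_on_measurable smooth_continuous test_functionD(1)[OF \<phi>(3)])
    show "integrable (lebesgue_on \<Omega>) (\<lambda>x. B * (indicator K' x * norm (g x)))"
      by (rule locally_integrable_dominant[OF g \<Omega> \<phi>(1,2)])
    show "AE x in lebesgue_on \<Omega>. (\<lambda>k. g x * \<phi> k x) \<longlonglongrightarrow> g x * \<psi> x"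
      by (intro AE_I2 tendsto_intros \<phi>(6))
    show "AE x in lebesgue_on \<Omega>. norm (g x * \<phi> k x) \<le> B * (indicator K' x * norm (g x))" for k
    proof (rule AE_I2)
      fix x
      show "norm (g x * \<phi> k x) \<le> B * (indicator K' x * norm (g x))"
        using \<phi>(4)[of x k] mult_right_mono[OF \<phi>(5)[of k x], of "\<bar>g x\<bar>"]
        by (cases "x \<in> K'") (auto simp: abs_mult mult.commute)
    qed
  qed
  then show ?thesis using zero[OF \<phi>(3)] by (simp add: LIMSEQ_const_iff)
qed

text \<open>
  The indicator of \<open>K\<close> is the decreasing limit of Lipschitz cut-offs in the distance to \<open>K\<close>.
\<close>

lemma orthogonal_to_compact_indicator:
  fixes g :: "real ^ 'n \<Rightarrow> real"
  assumes g: "locally_integrable \<Omega> g" and \<Omega>: "open \<Omega>"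
    and zero: "\<And>\<phi>. test_function \<Omega> \<phi> \<Longrightarrow> (LINT x|lebesgue_on \<Omega>. g x * \<phi> x) = 0"
    and K: "compact K" "K \<subseteq> \<Omega>"
  shows "(LINT x|lebesgue_on \<Omega>. g x * indicator K x) = 0"
proof (cases "K = {}")
  case False
  obtain e where e: "0 < e" "(\<Union>x\<in>K. cball x e) \<subseteq> \<Omega>"
    using compact_subset_open_imp_cball_epsilon_subset[OF K(1) \<Omega> K(2)] by metis
  define K' where "K' = {x. infdist x K \<le> e}"
  have K': "compact K'" unfolding K'_def by (rule compact_infdist_le[OF False K(1) e(1)])
  have K'_sub: "K' \<subseteq> \<Omega>"
  proof
    fix x assume "x \<in> K'"
    moreover obtain y where "y \<in> K" "infdist x K = dist x y"
      using infdist_attains_inf[OF compact_imp_closed[OF K(1)] False] by metis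
    ultimately have "x \<in> cball y e" by (simp add: K'_def dist_commute)
    then show "x \<in> \<Omega>" using e \<open>y \<in> K\<close> by blast
  qed
  define \<psi> where "\<psi> m x = max 0 (1 - real (Suc m) / e * infdist x K)" for m x
  have lip: "(real (Suc m) / e)-lipschitz_on UNIV (\<psi> m)" for m
  proof (rule lipschitz_onI)
    fix x y :: "real ^ 'n"
    have "dist (\<psi> m x) (\<psi> m y) \<le> \<bar>real (Suc m) / e * infdist x K - real (Suc m) / e * infdist y K\<bar>"
    proof -
      have "\<bar>max 0 (1 - a) - max 0 (1 - b)\<bar> \<le> \<bar>a - b\<bar>" for a b :: real
        by (auto simp: max_def)
      then show ?thesis unfolding \<psi>_def dist_real_def .
    qed
    also have "\<dots> = real (Suc m) / e * \<bar>infdist x K - infdist y K\<bar>"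
      using e(1) by (subst right_diff_distrib[symmetric]) (simp only: abs_mult, simp)
    also have "\<dots> \<le> real (Suc m) / e * dist x y"
      using e(1) by (intro mult_left_mono infdist_triangle_abs) auto
    finally show "dist (\<psi> m x) (\<psi> m y) \<le> real (Suc m) / e * dist x y" .
  qed (use e(1) in auto)
  have supp: "\<psi> m x = 0" if "x \<notin> K'" for m x
  proof -
    have "1 * e \<le> real (Suc m) * infdist x K"
      using that e(1) by (intro mult_mono) (auto simp: K'_def)
    then show ?thesis using e(1) by (simp add: \<psi>_def field_simps)
  qed
  have lim: "(\<lambda>m. \<psi> m x) \<longlonglongrightarrow> indicator K x" for x
  proof (cases "x \<in> K")
    case True
    then show ?thesis by (simp add: \<psi>_def)
  next
    case nin: False
    then have pos: "0 < infdist x K"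
      using infdist_pos_not_in_closed compact_imp_closed[OF K(1)] False by blast
    obtain N where N: "e / infdist x K < real N" using reals_Archimedean2 by blast
    have "\<psi> m x = 0" if "m \<ge> N" for m
    proof -
      have "e / infdist x K \<le> real (Suc m)" using N that by linarith
      then have "e \<le> real (Suc m) * infdist x K" using pos by (simp add: divide_le_eq)
      then show ?thesis using e(1) by (simp add: \<psi>_def field_simps)
    qed
    then have "\<forall>\<^sub>F m in sequentially. \<psi> m x = indicator K x"
      using nin eventually_sequentially by auto
    then show ?thesis by (rule tendsto_eventually)
  qed
  have gm: "g \<in> borel_measurable (lebesgue_on \<Omega>)" using g by (simp add: locally_integrable_def)
  have "(\<lambda>m. LINT x|lebesgue_on \<Omega>. g x * \<psi> m x) \<longlonglongrightarrow> (LINT x|lebesgue_on \<Omega>. g x * indicator K x)"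
  proof (rule integral_dominated_convergence[where w = "\<lambda>x. 1 * (indicator K' x * norm (g x))"])
    show "(\<lambda>x. g x * indicator K x) \<in> borel_measurable (lebesgue_on \<Omega>)"
      using borel_measurable_integrable[OF locally_integrable_dominant(1)[OF g \<Omega> K]]
      by (simp add: mult.commute)
    show "(\<lambda>x. g x * \<psi> k x) \<in> borel_measurable (lebesgue_on \<Omega>)" for k
      by (intro borel_measurable_times gm continuous_lebesgue_on_measurable lipschitz_on_continuous_on[OF lip])
    show "integrable (lebesgue_on \<Omega>) (\<lambda>x. 1 * (indicator K' x * norm (g x)))"
      by (rule locally_integrable_dominant[OF g \<Omega> K' K'_sub])
    show "AE x in lebesgue_on \<Omega>. (\<lambda>k. g x * \<psi> k x) \<longlonglongrightarrow> g x * indicator K x"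
      by (intro AE_I2 tendsto_intros lim)
    show "AE x in lebesgue_on \<Omega>. norm (g x * \<psi> k x) \<le> 1 * (indicator K' x * norm (g x))" for k
    proof (rule AE_I2)
      fix x
      have "\<bar>\<psi> k x\<bar> \<le> 1" using e(1) infdist_nonneg[of x K] by (simp add: \<psi>_def)
      then show "norm (g x * \<psi> k x) \<le> 1 * (indicator K' x * norm (g x))"
        using supp[of x k] mult_left_mono[of "\<bar>\<psi> k x\<bar>" 1 "\<bar>g x\<bar>"]
        by (cases "x \<in> K'") (auto simp: abs_mult)
    qed
  qed
  moreover have "(LINT x|lebesgue_on \<Omega>. g x * \<psi> m x) = 0" for m
    by (rule orthogonal_to_lipschitz[OF g \<Omega> zero lip K' K'_sub supp])
  ultimately show ?thesis by (simp add: LIMSEQ_const_iff)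
qed simp

text \<open>
  The set where \<open>g\<close> is positive is, up to a null set, a countable union of compact sets; the
  integral of \<open>g\<close> over each of these vanishes, so each of them is a null set.
\<close>

lemma orthogonal_imp_nonpos:
  fixes g :: "real ^ 'n \<Rightarrow> real"
  assumes g: "locally_integrable \<Omega> g" and \<Omega>: "open \<Omega>"
    and zero: "\<And>\<phi>. test_function \<Omega> \<phi> \<Longrightarrow> (LINT x|lebesgue_on \<Omega>. g x * \<phi> x) = 0"
  shows "AE x in lebesgue_on \<Omega>. g x \<le> 0"
proof -
  have gm: "g \<in> borel_measurable (lebesgue_on \<Omega>)" using g by (simp add: locally_integrable_def)
  define P where "P = {x \<in> \<Omega>. 0 < g x}"
  have "{x \<in> space (lebesgue_on \<Omega>). 0 < g x} \<in> sets (lebesgue_on \<Omega>)"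
    using gm by measurable
  then have "P \<in> sets lebesgue"
    using \<Omega> by (auto simp: P_def sets_restrict_space_iff)
  then obtain C T where CT: "fsigma C" "T \<in> null_sets lebesgue" "C \<union> T = P"
    using lebesgue_set_almost_fsigma by metis
  obtain F :: "nat \<Rightarrow> (real ^ 'n) set" where F: "\<And>i. compact (F i)" "C = (\<Union>i. F i)"
    using CT(1) unfolding fsigma_Union_compact by (metis image_subset_iff iso_tuple_UNIV_I mem_Collect_eq)
  have "F i \<in> null_sets lebesgue" for i
  proof -
    have sub: "F i \<subseteq> P" using CT F by blast
    then have sub\<Omega>: "F i \<subseteq> \<Omega>" by (auto simp: P_def)
    have int: "integrable (lebesgue_on \<Omega>) (\<lambda>x. g x * indicator (F i) x)"
      using locally_integrable_dominant(1)[OF g \<Omega> F(1) sub\<Omega>] by (simp add: mult.commute)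
    have "AE x in lebesgue_on \<Omega>. g x * indicator (F i) x = 0"
    proof (subst integral_nonneg_eq_0_iff_AE[OF int, symmetric])
      show "AE x in lebesgue_on \<Omega>. 0 \<le> g x * indicator (F i) x"
        using sub by (intro AE_I2) (auto simp: P_def indicator_def)
      show "(LINT x|lebesgue_on \<Omega>. g x * indicator (F i) x) = 0"
        by (rule orthogonal_to_compact_indicator[OF g \<Omega> zero F(1) sub\<Omega>])
    qed
    then have "AE x in lebesgue. x \<notin> F i"
      unfolding AE_lebesgue_on[OF \<Omega>] using sub by (auto simp: P_def elim!: eventually_mono)
    then show ?thesis
      using AE_iff_null_sets[OF fmeasurableD[OF lmeasurable_compact[OF F(1)]]] by simp
  qed
  then have "C \<in> null_sets lebesgue" unfolding F(2) by (rule null_sets_UN)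
  then have "P \<in> null_sets lebesgue" using CT by (metis null_sets.Un)
  then have "AE x in lebesgue. x \<notin> P" by (rule AE_not_in)
  then show ?thesis unfolding AE_lebesgue_on[OF \<Omega>] by (auto simp: P_def elim!: eventually_mono)
qed

lemma locally_integrable_lincomb:
  assumes "locally_integrable \<Omega> f" "locally_integrable \<Omega> g"
  shows "locally_integrable \<Omega> (\<lambda>x. a *\<^sub>R f x + b *\<^sub>R g x)"
  using assms unfolding locally_integrable_def by auto

lemma locally_integrable_component:
  assumes "locally_integrable \<Omega> (G :: _ \<Rightarrow> real ^ 'm)"
  shows "locally_integrable \<Omega> (\<lambda>x. G x $ i)"
  using assms unfolding locally_integrable_def
  by (auto intro: integrable_bounded_linear[OF bounded_linear_vec_nth]
      measurable_compose[OF _ borel_measurable_continuous_onI[OF linear_continuous_on[OF bounded_linear_vec_nth]]])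

text \<open>
  The fundamental lemma of the calculus of variations.
\<close>

lemma orthogonal_imp_zero:
  fixes g :: "real ^ 'n \<Rightarrow> real"
  assumes g: "locally_integrable \<Omega> g" and \<Omega>: "open \<Omega>"
    and zero: "\<And>\<phi>. test_function \<Omega> \<phi> \<Longrightarrow> (LINT x|lebesgue_on \<Omega>. g x * \<phi> x) = 0"
  shows "AE x in lebesgue_on \<Omega>. g x = 0"
proof -
  have "locally_integrable \<Omega> (\<lambda>x. - g x)"
    using locally_integrable_lincomb[OF g g, of "-1" 0] by simp
  moreover have "(LINT x|lebesgue_on \<Omega>. - g x * \<phi> x) = 0" if "test_function \<Omega> \<phi>" for \<phi>
    using zero[OF that] by simp
  ultimately have "AE x in lebesgue_on \<Omega>. - g x \<le> 0"
    using orthogonal_imp_nonpos[OF _ \<Omega>] by blast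
  moreover have "AE x in lebesgue_on \<Omega>. g x \<le> 0"
    by (rule orthogonal_imp_nonpos[OF g \<Omega> zero])
  ultimately show ?thesis by eventually_elim auto
qed

lemma integrable_test_product:
  fixes g :: "real ^ 'n \<Rightarrow> real"
  assumes g: "locally_integrable \<Omega> g" and \<Omega>: "open \<Omega>"
    and K: "compact K" "K \<subseteq> \<Omega>" "\<And>x. x \<notin> K \<Longrightarrow> \<phi> x = 0" and \<phi>: "continuous_on UNIV \<phi>"
  shows "integrable (lebesgue_on \<Omega>) (\<lambda>x. g x * \<phi> x)"
proof -
  have "bounded (\<phi> ` K)"
    by (intro compact_imp_bounded compact_continuous_image continuous_on_subset[OF \<phi>] K) auto
  then obtain C where C: "\<forall>x\<in>K. \<bar>\<phi> x\<bar> \<le> C" by (auto simp: bounded_iff)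
  show ?thesis
  proof (rule Bochner_Integration.integrable_bound[OF locally_integrable_dominant(2)[OF g \<Omega> K(1,2), of C]])
    show "(\<lambda>x. g x * \<phi> x) \<in> borel_measurable (lebesgue_on \<Omega>)"
      using g by (intro borel_measurable_times continuous_lebesgue_on_measurable[OF \<phi>]) (simp add: locally_integrable_def)
    show "AE x in lebesgue_on \<Omega>. norm (g x * \<phi> x) \<le> norm (C * (indicator K x * norm (g x)))"
    proof (rule AE_I2)
      fix x
      show "norm (g x * \<phi> x) \<le> norm (C * (indicator K x * norm (g x)))"
        using K(3)[of x] C mult_left_mono[of "\<bar>\<phi> x\<bar>" "\<bar>C\<bar>" "\<bar>g x\<bar>"]
        by (cases "x \<in> K") (force simp: abs_mult mult.commute)+
    qed
  qed
qed

lemma has_weak_grad_lincomb: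
  assumes \<Omega>: "open \<Omega>" and u: "has_weak_grad \<Omega> u G" and w: "has_weak_grad \<Omega> w H"
  shows "has_weak_grad \<Omega> (\<lambda>x. a * u x + b * w x) (\<lambda>x. a *\<^sub>R G x + b *\<^sub>R H x)"
proof -
  note int = integrable_test_product[OF _ \<Omega>]
  have loc: "locally_integrable \<Omega> u" "locally_integrable \<Omega> w" "locally_integrable \<Omega> G" "locally_integrable \<Omega> H"
    using u w by (auto simp: has_weak_grad_def)
  have "(LINT x|lebesgue_on \<Omega>. (a * u x + b * w x) * partial i \<phi> x)
             = - (LINT x|lebesgue_on \<Omega>. (a *\<^sub>R G x + b *\<^sub>R H x) $ i * \<phi> x)" if \<phi>: "test_function \<Omega> \<phi>" for \<phi> i
  proof -
    obtain K where K: "compact K" "K \<subseteq> \<Omega>" "\<And>x. x \<notin> K \<Longrightarrow> \<phi> x = 0"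
      using test_functionD(2)[OF \<phi>] by blast
    have K': "partial i \<phi> x = 0" if "x \<notin> K" for x
      using grad_outside_support[OF K(1,3) that] by (simp add: grad_def vec_eq_iff)
    have cont: "continuous_on UNIV \<phi>" "continuous_on UNIV (partial i \<phi>)"
      using smooth_continuous smooth_partial test_functionD(1)[OF \<phi>] by blast+
    have "(LINT x|lebesgue_on \<Omega>. (a * u x + b * w x) * partial i \<phi> x) =
        a * (LINT x|lebesgue_on \<Omega>. u x * partial i \<phi> x) + b * (LINT x|lebesgue_on \<Omega>. w x * partial i \<phi> x)"
      using int[OF loc(1) K(1,2) K' cont(2)] int[OF loc(2) K(1,2) K' cont(2)]
      by (simp add: distrib_right mult.assoc)
    also have "\<dots> = - (a * (LINT x|lebesgue_on \<Omega>. G x $ i * \<phi> x) + b * (LINT x|lebesgue_on \<Omega>. H x $ i * \<phi> x))"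
      using u w \<phi> by (simp add: has_weak_grad_def)
    also have "\<dots> = - (LINT x|lebesgue_on \<Omega>. (a *\<^sub>R G x + b *\<^sub>R H x) $ i * \<phi> x)"
      using int[OF locally_integrable_component[OF loc(3), of i] K cont(1)]
        int[OF locally_integrable_component[OF loc(4), of i] K cont(1)]
      by (simp add: distrib_right mult.assoc)
    finally show ?thesis .
  qed
  then show ?thesis
    using locally_integrable_lincomb[OF loc(1,2), of a b] locally_integrable_lincomb[OF loc(3,4)]
    by (simp add: has_weak_grad_def)
qed

lemma has_weak_grad_unique:
  assumes \<Omega>: "open \<Omega>" and u: "has_weak_grad \<Omega> u G" "has_weak_grad \<Omega> u H"
  shows "AE x in lebesgue_on \<Omega>. G x = H x"
proof -
  have z: "has_weak_grad \<Omega> (\<lambda>x. 0) (\<lambda>x. G x - H x)"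
    using has_weak_grad_lincomb[OF \<Omega> u, of 1 "-1"] by simp
  have "AE x in lebesgue_on \<Omega>. (G x - H x) $ i = 0" for i
  proof (rule orthogonal_imp_zero[OF _ \<Omega>])
    show "locally_integrable \<Omega> (\<lambda>x. (G x - H x) $ i)"
      using z locally_integrable_component unfolding has_weak_grad_def by blast
    show "(LINT x|lebesgue_on \<Omega>. (G x - H x) $ i * \<phi> x) = 0" if "test_function \<Omega> \<phi>" for \<phi>
      using z that by (simp add: has_weak_grad_def)
  qed
  then have "AE x in lebesgue_on \<Omega>. \<forall>i\<in>UNIV. (G x - H x) $ i = 0"
    by (intro AE_finite_allI) auto
  then show ?thesis by eventually_elim (auto simp: vec_eq_iff)
qed

lemma wgrad_eq:
  assumes "open \<Omega>" "has_weak_grad \<Omega> u G"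
  shows "has_weak_grad \<Omega> u (wgrad \<Omega> u)" and "AE x in lebesgue_on \<Omega>. wgrad \<Omega> u x = G x"
proof -
  show "has_weak_grad \<Omega> u (wgrad \<Omega> u)"
    unfolding wgrad_def using assms(2) by (rule someI[of "has_weak_grad \<Omega> u"])
  from has_weak_grad_unique[OF assms(1) this assms(2)]
  show "AE x in lebesgue_on \<Omega>. wgrad \<Omega> u x = G x" .
qed

section \<open>Lipschitz functions\<close>

lemma difference_quotient_tendsto:
  fixes f :: "real ^ 'n \<Rightarrow> real"
  assumes "(f has_derivative (\<lambda>h. a \<bullet> h)) (at x)"
  shows "(\<lambda>k. real (Suc k) * (f (x + inverse (real (Suc k)) *\<^sub>R d) - f x)) \<longlonglongrightarrow> a \<bullet> d"
proof -
  have g: "((\<lambda>t::real. x + t *\<^sub>R d) has_derivative (\<lambda>t. t *\<^sub>R d)) (at 0)"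
    by (auto intro!: derivative_eq_intros)
  have "((\<lambda>t::real. f (x + t *\<^sub>R d)) has_derivative (\<lambda>t. a \<bullet> (t *\<^sub>R d))) (at 0)"
    by (rule has_derivative_compose[OF g]) (use assms in simp)
  then have "((\<lambda>t. f (x + t *\<^sub>R d)) has_real_derivative a \<bullet> d) (at 0)"
    by (rule has_derivative_imp_has_field_derivative) simp
  then have D: "((\<lambda>h. (f (x + h *\<^sub>R d) - f x) / h) \<longlongrightarrow> a \<bullet> d) (at 0)"
    by (simp add: DERIV_def)
  have "filterlim (\<lambda>k. inverse (real (Suc k))) (at 0) sequentially"
    by (rule filterlim_atI[OF LIMSEQ_inverse_real_of_nat]) simp
  from filterlim_compose[OF D this] show ?thesis
    by (simp add: divide_inverse mult.commute)
qed

lemma lipschitz_derivative_bound: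
  fixes f :: "real ^ 'n \<Rightarrow> real"
  assumes "L-lipschitz_on UNIV f" "(f has_derivative (\<lambda>h. a \<bullet> h)) (at x)"
  shows "norm a \<le> L"
proof (cases "a = 0")
  case False
  have "\<bar>real (Suc k) * (f (x + inverse (real (Suc k)) *\<^sub>R a) - f x)\<bar> \<le> L * norm a" for k
  proof -
    have "\<bar>f (x + inverse (real (Suc k)) *\<^sub>R a) - f x\<bar> \<le> L * norm (inverse (real (Suc k)) *\<^sub>R a)"
      using lipschitz_onD[OF assms(1), of "x + inverse (real (Suc k)) *\<^sub>R a" x] by (simp add: dist_norm)
    then have "real (Suc k) * \<bar>f (x + inverse (real (Suc k)) *\<^sub>R a) - f x\<bar>
        \<le> real (Suc k) * (L * norm (inverse (real (Suc k)) *\<^sub>R a))"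
      by (intro mult_left_mono) auto
    also have "\<dots> = L * norm a" by simp
    finally show ?thesis by (simp only: abs_mult abs_of_nat)
  qed
  then have "\<bar>a \<bullet> a\<bar> \<le> L * norm a"
    by (intro LIMSEQ_le_const2[OF tendsto_rabs[OF difference_quotient_tendsto[OF assms(2)]]]) auto
  then show ?thesis using False by (simp add: dot_square_norm power2_eq_square)
qed (use lipschitz_on_nonneg[OF assms(1)] in simp)

lemma locally_integrable_bounded:
  fixes G :: "real ^ 'n \<Rightarrow> 'b::euclidean_space"
  assumes G: "G \<in> borel_measurable lebesgue" "AE x in lebesgue. norm (G x) \<le> C"
  shows "locally_integrable \<Omega> G"
  unfolding locally_integrable_def
proof (intro conjI allI impI)
  show "G \<in> borel_measurable (lebesgue_on \<Omega>)"
    by (rule measurable_restrict_space1[OF G(1)])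
  fix K assume "compact K \<and> K \<subseteq> \<Omega>"
  then have K: "K \<in> lmeasurable" by (simp add: lmeasurable_compact)
  have Ks: "K \<in> sets lebesgue" using fmeasurableD[OF K] .
  have "integrable lebesgue (\<lambda>x. indicator K x *\<^sub>R G x)"
  proof (rule Bochner_Integration.integrable_bound)
    show "integrable lebesgue (\<lambda>x. C * indicator K x)"
      using K by (intro integrable_mult_right integrable_real_indicator) (auto simp: fmeasurable_def)
    show "(\<lambda>x. indicator K x *\<^sub>R G x) \<in> borel_measurable lebesgue"
      using G(1) Ks by measurable
    show "AE x in lebesgue. norm (indicator K x *\<^sub>R G x) \<le> norm (C * indicator K x)"
      using G(2) by eventually_elim (auto simp: indicator_def)
  qed
  then show "integrable (lebesgue_on K) G"
    using integrable_restrict_space[of K lebesgue G] Ks by simp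
qed

lemma ae_gradient_measurable:
  fixes f :: "real ^ 'n \<Rightarrow> real"
  assumes f: "continuous_on UNIV f" and G: "AE x in lebesgue. (f has_derivative (\<lambda>h. G x \<bullet> h)) (at x)"
  shows "G \<in> borel_measurable lebesgue"
  unfolding borel_measurable_euclidean_space[of G]
proof
  fix d :: "real ^ 'n"
  let ?D = "\<lambda>k x. real (Suc k) * (f (x + inverse (real (Suc k)) *\<^sub>R d) - f x)"
  have "?D k \<in> borel_measurable lebesgue" for k
  proof -
    have "continuous_on UNIV (?D k)"
      by (intro continuous_intros f continuous_on_compose2[OF f]) auto
    then show ?thesis
      by (intro measurable_completion) (simp add: borel_measurable_continuous_onI del: of_nat_Suc)
  qed
  then have "(\<lambda>x. lim (\<lambda>k. ?D k x)) \<in> borel_measurable lebesgue"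
    by (rule borel_measurable_lim_metric)
  moreover have "AE x in lebesgue. lim (\<lambda>k. ?D k x) = G x \<bullet> d"
    using G by eventually_elim (rule limI[OF difference_quotient_tendsto])
  ultimately show "(\<lambda>x. G x \<bullet> d) \<in> borel_measurable lebesgue"
    by (rule borel_measurable_AE)
qed

lemma integral_shift:
  fixes h :: "real ^ 'n \<Rightarrow> real"
  assumes "continuous_on UNIV h"
  shows "(LINT x|lborel. h (x + c)) = (LINT x|lborel. h x)"
proof -
  have "(LINT x|lborel. h x) = (LINT x|distr lborel borel ((+) c). h x)"
    by (simp add: lborel_distr_plus)
  also have "\<dots> = (LINT x|lborel. h (c + x))"
    using assms by (subst integral_distr) (auto intro: borel_measurable_continuous_onI)
  finally show ?thesis by (simp add: add.commute)
qed

text \<open>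
  The integrals of the difference quotients of a compactly supported function vanish because
  Lebesgue measure is invariant under translations.
\<close>

lemma integral_partial_derivative_zero:
  fixes h :: "real ^ 'n \<Rightarrow> real"
  assumes h: "L-lipschitz_on UNIV h" and K: "compact K" "\<And>x. x \<notin> K \<Longrightarrow> h x = 0"
    and G: "AE x in lebesgue. (h has_derivative (\<lambda>d. G x \<bullet> d)) (at x)"
  shows "(LINT x|lebesgue. G x $ i) = 0"
proof -
  let ?d = "\<lambda>k. inverse (real (Suc k)) *\<^sub>R axis i (1::real) :: real ^ 'n"
  let ?D = "\<lambda>k x. real (Suc k) * (h (x + ?d k) - h x)"
  have cont: "continuous_on UNIV h" by (rule lipschitz_on_continuous_on[OF h])
  have D_cont: "continuous_on UNIV (?D k)" for k
    by (intro continuous_intros cont continuous_on_compose2[OF cont]) (auto intro!: continuous_intros)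
  have Dm: "?D k \<in> borel_measurable lborel" for k
    using borel_measurable_continuous_onI[OF D_cont[of k]] by simp
  obtain R where R: "\<And>x. x \<in> K \<Longrightarrow> norm x \<le> R"
    using compact_imp_bounded[OF K(1)] by (auto simp: bounded_iff)
  have d1: "norm (?d k) \<le> 1" for k
    by (simp add: field_simps)
  have supp: "?D k x = 0" if "x \<notin> cball 0 (R + 1)" for k x
  proof -
    have "norm (x + ?d k) \<ge> norm x - norm (?d k)"
      using norm_diff_ineq by blast
    with that d1[of k] have "\<not> norm (x + ?d k) \<le> R" "\<not> norm x \<le> R" by auto
    then show ?thesis using K(2) R by (metis diff_zero mult_zero_right)
  qed
  have "(LINT x|lebesgue. ?D k x) = 0" for k
  proof -
    have int: "integrable lborel (\<lambda>x. h (x + c))" for c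
    proof (rule integrable_continuous_compact_support)
      show "continuous_on UNIV (\<lambda>x. h (x + c))"
        by (rule continuous_on_compose2[OF cont]) (auto intro!: continuous_intros)
      show "compact ((\<lambda>x. x - c) ` K)"
        by (intro compact_continuous_image K continuous_intros)
      show "h (x + c) = 0" if "x \<notin> (\<lambda>x. x - c) ` K" for x
        using that K(2)[of "x + c"] by (force simp: image_iff)
    qed
    have "(LINT x|lebesgue. ?D k x) = (LINT x|lborel. ?D k x)"
      by (rule integral_completion[OF Dm])
    also have "\<dots> = real (Suc k) * ((LINT x|lborel. h (x + ?d k)) - (LINT x|lborel. h x))"
      using int[of "?d k"] int[of 0] by simp
    finally show ?thesis by (simp add: integral_shift[OF cont])
  qed
  moreover have "(\<lambda>k. LINT x|lebesgue. ?D k x) \<longlonglongrightarrow> (LINT x|lebesgue. G x $ i)"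
  proof (rule integral_dominated_convergence[where w = "\<lambda>x. L * indicator (cball 0 (R + 1)) x"])
    have "G \<in> borel_measurable lebesgue" by (rule ae_gradient_measurable[OF cont G])
    then have "(\<lambda>x. G x \<bullet> axis i 1) \<in> borel_measurable lebesgue"
      unfolding borel_measurable_euclidean_space[of G] by simp
    then show "(\<lambda>x. G x $ i) \<in> borel_measurable lebesgue" by (simp add: inner_axis)
    show "?D k \<in> borel_measurable lebesgue" for k by (rule measurable_completion[OF Dm])
    show "integrable lebesgue (\<lambda>x::real^'n. L * indicator (cball 0 (R + 1)) x)"
      using lmeasurable_cball[of "0::real^'n" "R + 1"]
      by (intro integrable_mult_right integrable_real_indicator) (auto simp: fmeasurable_def)
    show "AE x in lebesgue. (\<lambda>k. ?D k x) \<longlonglongrightarrow> G x $ i"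
      using G
    proof eventually_elim
      case (elim x)
      from difference_quotient_tendsto[OF this, of "axis i 1"] show ?case by (simp add: inner_axis)
    qed
    show "AE x in lebesgue. norm (?D k x) \<le> L * indicator (cball 0 (R + 1)) x" for k
    proof (rule AE_I2)
      fix x
      have "\<bar>h (x + ?d k) - h x\<bar> \<le> L * inverse (real (Suc k))"
        using lipschitz_onD[OF h, of "x + ?d k" x] by (simp add: dist_norm)
      then have "real (Suc k) * \<bar>h (x + ?d k) - h x\<bar> \<le> real (Suc k) * (L * inverse (real (Suc k)))"
        by (intro mult_left_mono) auto
      also have "\<dots> = L" by simp
      finally have "\<bar>?D k x\<bar> \<le> L" by (simp only: abs_mult abs_of_nat)
      then show "norm (?D k x) \<le> L * indicator (cball 0 (R + 1)) x"
        using supp[of x k] by (cases "x \<in> cball 0 (R + 1)") (simp_all only: real_norm_def indicator_simps, auto)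
    qed
  qed
  ultimately show ?thesis by (simp add: LIMSEQ_const_iff)
qed

lemma test_function_bounds:
  assumes "test_function \<Omega> \<phi>"
  obtains L B where "L-lipschitz_on UNIV \<phi>" "\<And>x. \<bar>\<phi> x\<bar> \<le> B" "0 \<le> B"
proof -
  obtain K where K: "compact K" "\<And>x. x \<notin> K \<Longrightarrow> \<phi> x = 0"
    using test_functionD(2)[OF assms] by blast
  have smooth: "smooth \<phi>" by (rule test_functionD[OF assms])
  note D = has_derivative_grad[OF smooth_differentiable[OF smooth]]
  have G0: "grad \<phi> x = 0" if "x \<notin> K" for x
    using grad_outside_support[OF K that] .
  have "bounded (\<phi> ` K)" "bounded (grad \<phi> ` K)"
    by (intro compact_imp_bounded compact_continuous_image K
        continuous_on_subset[OF smooth_continuous[OF smooth]]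
        continuous_on_subset[OF smooth_continuous_grad[OF smooth]]; simp)+
  then obtain B L where "\<forall>x\<in>K. \<bar>\<phi> x\<bar> \<le> B" "\<forall>x\<in>K. norm (grad \<phi> x) \<le> L"
    by (auto simp: bounded_iff)
  then have B: "\<bar>\<phi> x\<bar> \<le> max B 0" and L: "norm (grad \<phi> x) \<le> max L 0" for x
    using K(2)[of x] G0[of x] by (cases "x \<in> K"; force)+
  have "(max L 0)-lipschitz_on UNIV \<phi>"
  proof (rule bounded_derivative_imp_lipschitz)
    show "(\<phi> has_derivative (\<bullet>) (grad \<phi> x)) (at x within UNIV)" for x using D by simp
    show "onorm ((\<bullet>) (grad \<phi> x)) \<le> max L 0" for x
      using L[of x] onorm_inner_right[OF bounded_linear_ident, of "grad \<phi> x"] by (simp add: onorm_id)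
  qed auto
  with B show ?thesis using that by fastforce
qed

text \<open>
  Integration by parts: the gradient of \<open>f \<phi>\<close> has integral zero for every test function \<open>\<phi>\<close>,
  and the product rule splits it into the two sides of the defining identity.
\<close>

lemma lipschitz_has_weak_grad:
  fixes f :: "real ^ 'n \<Rightarrow> real"
  assumes \<Omega>: "open \<Omega>" and f: "L-lipschitz_on UNIV f" "\<And>x. \<bar>f x\<bar> \<le> B"
    and G: "AE x in lebesgue. (f has_derivative (\<lambda>h. G x \<bullet> h)) (at x)"
  shows "G \<in> borel_measurable lebesgue" and "AE x in lebesgue. norm (G x) \<le> L"
    and "has_weak_grad \<Omega> f G"
proof -
  have cont: "continuous_on UNIV f" by (rule lipschitz_on_continuous_on[OF f(1)])
  show Gm: "G \<in> borel_measurable lebesgue" by (rule ae_gradient_measurable[OF cont G])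
  show Gb: "AE x in lebesgue. norm (G x) \<le> L"
    using G by eventually_elim (rule lipschitz_derivative_bound[OF f(1)])
  have locf: "locally_integrable \<Omega> f"
  proof (rule locally_integrable_bounded)
    show "f \<in> borel_measurable lebesgue"
      by (rule measurable_completion) (simp add: borel_measurable_continuous_onI[OF cont])
    show "AE x in lebesgue. norm (f x) \<le> B" using f(2) by simp
  qed
  have locG: "locally_integrable \<Omega> G" by (rule locally_integrable_bounded[OF Gm Gb])
  have "(LINT x|lebesgue_on \<Omega>. f x * partial i \<phi> x) = - (LINT x|lebesgue_on \<Omega>. G x $ i * \<phi> x)"
    if \<phi>: "test_function \<Omega> \<phi>" for \<phi> i
  proof -
    obtain K where K: "compact K" "K \<subseteq> \<Omega>" "\<And>x. x \<notin> K \<Longrightarrow> \<phi> x = 0"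
      using test_functionD(2)[OF \<phi>] by blast
    obtain L' B' where \<phi>b: "L'-lipschitz_on UNIV \<phi>" "\<And>x. \<bar>\<phi> x\<bar> \<le> B'" "0 \<le> B'"
      using test_function_bounds[OF \<phi>] by metis
    have smooth: "smooth \<phi>" by (rule test_functionD[OF \<phi>])
    have K': "partial i \<phi> x = 0" if "x \<notin> K" for x
      using grad_outside_support[OF K(1,3) that] by (simp add: grad_def vec_eq_iff)
    have B0: "0 \<le> B" using f(2)[of 0] by linarith
    have L0: "0 \<le> L" "0 \<le> L'" using lipschitz_on_nonneg f(1) \<phi>b(1) by blast+
    let ?H = "\<lambda>x. f x *\<^sub>R grad \<phi> x + \<phi> x *\<^sub>R G x"
    have "(LINT x|lebesgue. ?H x $ i) = 0"
    proof (rule integral_partial_derivative_zero[where h = "\<lambda>x. f x * \<phi> x"])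
      show "(B * L' + B' * L)-lipschitz_on UNIV (\<lambda>x. f x * \<phi> x)"
      proof (rule lipschitz_onI)
        fix x y :: "real ^ 'n"
        have "f x * \<phi> x - f y * \<phi> y = f x * (\<phi> x - \<phi> y) + \<phi> y * (f x - f y)"
          by (simp add: algebra_simps)
        also have "\<bar>\<dots>\<bar> \<le> \<bar>f x\<bar> * \<bar>\<phi> x - \<phi> y\<bar> + \<bar>\<phi> y\<bar> * \<bar>f x - f y\<bar>"
          by (metis abs_mult abs_triangle_ineq)
        also have "\<dots> \<le> B * (L' * dist x y) + B' * (L * dist x y)"
          using f(2) \<phi>b(2) lipschitz_onD[OF f(1), of x y] lipschitz_onD[OF \<phi>b(1), of x y] B0 \<phi>b(3)
          by (intro add_mono mult_mono) (auto simp: dist_real_def)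
        finally show "dist (f x * \<phi> x) (f y * \<phi> y) \<le> (B * L' + B' * L) * dist x y"
          by (simp add: dist_real_def algebra_simps)
      qed (use B0 L0 \<phi>b(3) in auto)
      show "AE x in lebesgue. ((\<lambda>x. f x * \<phi> x) has_derivative (\<bullet>) (?H x)) (at x)"
        using G
      proof eventually_elim
        case (elim x)
        show ?case
          by (rule has_derivative_eq_rhs[OF has_derivative_mult[OF elim has_derivative_grad[OF smooth_differentiable[OF smooth]]]])
            (auto simp: inner_add_left)
      qed
    qed (use K in auto)
    moreover have "?H x $ i = 0" if "x \<notin> \<Omega>" for x
    proof -
      have "x \<notin> K" using that K(2) by blast
      then show ?thesis using K(3) K' by (simp add: grad_def)
    qed
    ultimately have "(LINT x|lebesgue_on \<Omega>. ?H x $ i) = 0"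
      using integrable_on_domain(2)[OF \<Omega>, of "\<lambda>x. ?H x $ i"] by simp
    then have "(LINT x|lebesgue_on \<Omega>. f x * partial i \<phi> x + G x $ i * \<phi> x) = 0"
      by (simp add: grad_def mult.commute)
    then show ?thesis
      using integrable_test_product[OF locf \<Omega> K(1,2) K' smooth_continuous[OF smooth_partial[OF smooth]]]
        integrable_test_product[OF locally_integrable_component[OF locG, of i] \<Omega> K smooth_continuous[OF smooth]]
      by simp
  qed
  with locf locG show "has_weak_grad \<Omega> f G" by (simp add: has_weak_grad_def)
qed

section \<open>Finite element functions\<close>

lemma locally_affine_grad: "locally_affine f x a \<Longrightarrow> grad f x = a"
  by (rule grad_eqI[OF locally_affine_has_derivative])

lemma fe_space_affine:
  assumes "q \<in> fe_space \<Omega> T"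
  obtains a c where "\<And>K x. K \<in> T \<Longrightarrow> x \<in> K \<Longrightarrow> q x = a K \<bullet> x + c K"
  using assms unfolding fe_space_def by simp metis

text \<open>
  The slopes of the finitely many affine pieces are bounded, and along a segment the pieces fit
  together continuously.
\<close>

lemma fe_space_lipschitz:
  fixes \<Omega> :: "(real ^ 'n) set"
  assumes \<Omega>: "open \<Omega>" and T: "simplicial_decomposition \<Omega> T" and q: "q \<in> fe_space \<Omega> T"
  obtains L where "L-lipschitz_on UNIV q"
proof -
  obtain a c where ac: "\<And>K x. K \<in> T \<Longrightarrow> x \<in> K \<Longrightarrow> q x = a K \<bullet> x + c K"
    using fe_space_affine[OF q] by metis
  have fin: "finite T" and closed: "\<And>K. K \<in> T \<Longrightarrow> closed K" and cover: "\<Union>T = closure \<Omega>"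
    using T unfolding simplicial_decomposition_def triangulation_def
    by (auto dest: closed_simplex)
  have zero: "\<And>x. x \<notin> \<Omega> \<Longrightarrow> q x = 0" using q by (simp add: fe_space_def)
  define L where "L = (\<Sum>K\<in>T. norm (a K))"
  have L0: "0 \<le> L" by (simp add: L_def sum_nonneg)
  have aL: "norm (a K) \<le> L" if "K \<in> T" for K
    unfolding L_def using fin that by (intro member_le_sum) auto
  have piece: "\<bar>q x - q y\<bar> \<le> L * norm (x - y)" if "S \<in> insert (- \<Omega>) T" "x \<in> S" "y \<in> S" for S x y
  proof (cases "S = - \<Omega>")
    case True
    then show ?thesis using that zero L0 by simp
  next
    case False
    then have S: "S \<in> T" using that by simp
    then have "\<bar>q x - q y\<bar> = \<bar>a S \<bullet> (x - y)\<bar>"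
      using ac that by (simp add: inner_diff_right)
    also have "\<dots> \<le> norm (a S) * norm (x - y)" by (rule Cauchy_Schwarz_ineq2)
    also have "\<dots> \<le> L * norm (x - y)" using aL[OF S] by (intro mult_right_mono) auto
    finally show ?thesis .
  qed
  have "L-lipschitz_on UNIV q"
  proof (rule lipschitz_onI)
    fix x y :: "real ^ 'n"
    \<comment> \<open>The segment from \<open>x\<close> to \<open>y\<close> is covered by finitely many closed pieces: the traces of the
      simplices and of the complement of \<open>\<Omega>\<close>.\<close>
    let ?l = "\<lambda>t::real. x + t *\<^sub>R (y - x)"
    have l_cont: "continuous_on UNIV ?l" by (intro continuous_intros)
    have "(L * norm (y - x))-lipschitz_on {0..1} (\<lambda>t. q (?l t))"
    proof (rule lipschitz_on_closed_Union[where I = "insert (- \<Omega>) T" and U = "\<lambda>S. ?l -` S"])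
      fix S assume S: "S \<in> insert (- \<Omega>) T"
      show "(L * norm (y - x))-lipschitz_on (?l -` S) (\<lambda>t. q (?l t))"
      proof (rule lipschitz_onI)
        fix s t assume "s \<in> ?l -` S" "t \<in> ?l -` S"
        then have "\<bar>q (?l s) - q (?l t)\<bar> \<le> L * norm (?l s - ?l t)" using piece[OF S, of "?l s" "?l t"] by blast
        also have "?l s - ?l t = (s - t) *\<^sub>R (y - x)" by (simp add: algebra_simps)
        finally show "dist (q (?l s)) (q (?l t)) \<le> L * norm (y - x) * dist s t"
          by (simp add: dist_real_def mult_ac)
      qed (use L0 in simp)
      have "closed S" using S closed \<Omega> by auto
      then show "closed (?l -` S)" using continuous_on_closed_vimage[of UNIV ?l] l_cont by simp
    next
      have "- \<Omega> \<union> \<Union>T = UNIV" using cover closure_subset by blast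
      then show "{0..1} \<subseteq> (\<Union>S\<in>insert (- \<Omega>) T. ?l -` S)" by auto
    qed (use fin L0 in auto)
    from lipschitz_onD[OF this, of 0 1]
    show "dist (q x) (q y) \<le> L * dist x y"
      by (simp add: dist_norm norm_minus_commute)
  qed (rule L0)
  then show ?thesis by (rule that)
qed

text \<open>
  Away from the boundaries of the simplices a finite element function is affine near \<open>x\<close>, and
  where it is not constant its level sets are hyperplanes.
\<close>

lemma fe_space_ae_affine:
  fixes \<Omega> :: "(real ^ 'n) set"
  assumes \<Omega>: "bounded \<Omega>" and T: "simplicial_decomposition \<Omega> T" and q: "q \<in> fe_space \<Omega> T"
  shows "AE x in lebesgue. \<exists>a. locally_affine q x a \<and> (a \<noteq> 0 \<longrightarrow> q x \<noteq> s)"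
proof -
  obtain a c where ac: "\<And>K x. K \<in> T \<Longrightarrow> x \<in> K \<Longrightarrow> q x = a K \<bullet> x + c K"
    using fe_space_affine[OF q] by metis
  have fin: "finite T" and convex: "\<And>K. K \<in> T \<Longrightarrow> convex K" and closed: "\<And>K. K \<in> T \<Longrightarrow> closed K"
    and cover: "\<Union>T = closure \<Omega>"
    using T unfolding simplicial_decomposition_def triangulation_def
    by (auto dest: closed_simplex convex_simplex)
  have zero: "\<And>x. x \<notin> closure \<Omega> \<Longrightarrow> q x = 0"
    using q closure_subset by (auto simp: fe_space_def)
  define N where "N = (\<Union>K\<in>T. frontier K) \<union> (\<Union>K\<in>{K\<in>T. a K \<noteq> 0}. {x. a K \<bullet> x = s - c K})"
  have "negligible N"
    unfolding N_def using fin
    by (intro negligible_Un negligible_Union) (auto intro: negligible_convex_frontier convex negligible_hyperplane)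
  then have "AE x in lebesgue. x \<notin> N"
    by (intro AE_not_in) (simp add: negligible_iff_null_sets)
  then show ?thesis
  proof eventually_elim
    case (elim x)
    show ?case
    proof (cases "x \<in> closure \<Omega>")
      case True
      then obtain K where K: "K \<in> T" "x \<in> K" using cover by blast
      then have "x \<in> interior K"
        using elim closed[OF K(1)] by (auto simp: N_def frontier_def)
      then obtain r where r: "0 < r" "ball x r \<subseteq> K" by (auto simp: mem_interior)
      have "locally_affine q x (a K)"
        unfolding locally_affine_def
        using r K ac by (intro exI[of _ r]) (auto simp: inner_diff_right subset_iff)
      moreover have "a K \<noteq> 0 \<longrightarrow> q x \<noteq> s"
        using elim K ac[OF K] by (auto simp: N_def)
      ultimately show ?thesis by blast
    next
      case False
      have "locally_affine q x 0"
        by (rule locally_affine_outside_support[OF _ zero False]) (use \<Omega> in simp)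
      then show ?thesis by blast
    qed
  qed
qed

lemma fe_space_bounded:
  assumes "bounded \<Omega>" "q \<in> fe_space \<Omega> T"
  obtains B where "\<And>x. \<bar>q x\<bar> \<le> B"
proof -
  have q: "continuous_on UNIV q" "\<And>x. x \<notin> \<Omega> \<Longrightarrow> q x = 0" using assms(2) by (auto simp: fe_space_def)
  have "bounded (q ` closure \<Omega>)"
    using assms(1)
    by (intro compact_imp_bounded compact_continuous_image continuous_on_subset[OF q(1)]) auto
  then obtain B where B: "\<forall>x\<in>closure \<Omega>. \<bar>q x\<bar> \<le> B" by (auto simp: bounded_iff)
  have "\<bar>q x\<bar> \<le> max B 0" for x
  proof (cases "x \<in> closure \<Omega>")
    case False
    then have "x \<notin> \<Omega>" using closure_subset by blast
    then show ?thesis using q(2) by simp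
  qed (use B in fastforce)
  then show ?thesis by (rule that)
qed

lemma fe_space_lincomb:
  assumes "q \<in> fe_space \<Omega> T" "r \<in> fe_space \<Omega> T"
  shows "(\<lambda>x. s * q x + t * r x) \<in> fe_space \<Omega> T"
proof -
  obtain a c where ac: "\<And>K x. K \<in> T \<Longrightarrow> x \<in> K \<Longrightarrow> q x = a K \<bullet> x + c K"
    using fe_space_affine[OF assms(1)] by metis
  obtain a' c' where ac': "\<And>K x. K \<in> T \<Longrightarrow> x \<in> K \<Longrightarrow> r x = a' K \<bullet> x + c' K"
    using fe_space_affine[OF assms(2)] by metis
  have "\<forall>K\<in>T. \<exists>a c. \<forall>x\<in>K. s * q x + t * r x = a \<bullet> x + c"
  proof
    fix K assume K: "K \<in> T"
    have "\<forall>x\<in>K. s * q x + t * r x = (s *\<^sub>R a K + t *\<^sub>R a' K) \<bullet> x + (s * c K + t * c' K)"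
      using ac[OF K] ac'[OF K] by (simp add: inner_add_left algebra_simps)
    then show "\<exists>a c. \<forall>x\<in>K. s * q x + t * r x = a \<bullet> x + c" by blast
  qed
  moreover have "continuous_on UNIV (\<lambda>x. s * q x + t * r x)"
    using assms by (intro continuous_intros) (auto simp: fe_space_def)
  ultimately show ?thesis using assms by (simp add: fe_space_def)
qed

text \<open>
  Nodal values serve as coordinates: they make the space finite dimensional.
\<close>

lemma fe_space_determined_by_vertices:
  fixes \<Omega> :: "(real ^ 'n) set"
  assumes T: "simplicial_decomposition \<Omega> T"
  obtains V where "finite V" "\<And>q. q \<in> fe_space \<Omega> T \<Longrightarrow> \<forall>x\<in>V. q x = 0 \<Longrightarrow> q = (\<lambda>x. 0)"
proof -
  have fin: "finite T" and hull: "\<And>K. K \<in> T \<Longrightarrow> \<exists>C. finite C \<and> K = convex hull C" and cover: "\<Union>T = closure \<Omega>"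
    using T unfolding simplicial_decomposition_def triangulation_def by (auto simp: simplex)
  then obtain C where C: "\<And>K. K \<in> T \<Longrightarrow> finite (C K)" "\<And>K. K \<in> T \<Longrightarrow> K = convex hull C K" by metis
  have "q = (\<lambda>x. 0)" if q: "q \<in> fe_space \<Omega> T" and z: "\<forall>x\<in>(\<Union>K\<in>T. C K). q x = 0" for q
  proof
    fix x
    obtain a c where ac: "\<And>K x. K \<in> T \<Longrightarrow> x \<in> K \<Longrightarrow> q x = a K \<bullet> x + c K"
      using fe_space_affine[OF q] by metis
    show "q x = 0"
    proof (cases "x \<in> \<Omega>")
      case True
      then obtain K where K: "K \<in> T" "x \<in> K" using cover closure_subset by blast
      have "convex {x. a K \<bullet> x = - c K}" by (rule convex_hyperplane)
      moreover have "C K \<subseteq> {x. a K \<bullet> x = - c K}"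
      proof
        fix y assume y: "y \<in> C K"
        then have "y \<in> K" using C(2)[OF K(1)] hull_inc by metis
        then have "a K \<bullet> y + c K = 0" using ac[OF K(1)] z y K(1) by force
        then show "y \<in> {x. a K \<bullet> x = - c K}" by simp
      qed
      ultimately have "K \<subseteq> {x. a K \<bullet> x = - c K}"
        using C(2)[OF K(1)] hull_minimal by metis
      then show ?thesis using K ac[OF K] by auto
    qed (use q in \<open>simp add: fe_space_def\<close>)
  qed
  then show ?thesis using that[of "\<Union>K\<in>T. C K"] fin C(1) by auto
qed

section \<open>The energy form\<close>

definition finite_energy :: "(real ^ 'n) set \<Rightarrow> (real ^ 'n \<Rightarrow> real) \<Rightarrow> bool" where
  "finite_energy \<Omega> u \<longleftrightarrow> (\<exists>G. has_weak_grad \<Omega> u G \<and> square_integrable \<Omega> G)"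

lemma square_integrable_AE:
  assumes "square_integrable \<Omega> G" "H \<in> borel_measurable (lebesgue_on \<Omega>)" "AE x in lebesgue_on \<Omega>. H x = G x"
  shows "square_integrable \<Omega> H"
  unfolding square_integrable_def
proof
  show "integrable (lebesgue_on \<Omega>) (\<lambda>x. (norm (H x))\<^sup>2)"
  proof (rule integrable_cong_AE_imp)
    show "integrable (lebesgue_on \<Omega>) (\<lambda>x. (norm (G x))\<^sup>2)" using assms(1) by (simp add: square_integrable_def)
    show "(\<lambda>x. (norm (H x))\<^sup>2) \<in> borel_measurable (lebesgue_on \<Omega>)" using assms(2) by measurable
    show "AE x in lebesgue_on \<Omega>. (norm (G x))\<^sup>2 = (norm (H x))\<^sup>2"
      using assms(3) by eventually_elim simp
  qed
qed (rule assms(2))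

lemma square_integrable_lincomb:
  fixes G H :: "real ^ 'n \<Rightarrow> 'b::euclidean_space"
  assumes "square_integrable \<Omega> G" "square_integrable \<Omega> H"
  shows "square_integrable \<Omega> (\<lambda>x. a *\<^sub>R G x + b *\<^sub>R H x)"
  unfolding square_integrable_def
proof
  have m: "G \<in> borel_measurable (lebesgue_on \<Omega>)" "H \<in> borel_measurable (lebesgue_on \<Omega>)"
    using assms by (auto simp: square_integrable_def)
  then show "(\<lambda>x. a *\<^sub>R G x + b *\<^sub>R H x) \<in> borel_measurable (lebesgue_on \<Omega>)" by measurable
  show "integrable (lebesgue_on \<Omega>) (\<lambda>x. (norm (a *\<^sub>R G x + b *\<^sub>R H x))\<^sup>2)"
  proof (rule Bochner_Integration.integrable_bound)
    show "integrable (lebesgue_on \<Omega>) (\<lambda>x. 2 * a\<^sup>2 * (norm (G x))\<^sup>2 + 2 * b\<^sup>2 * (norm (H x))\<^sup>2)"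
      using assms by (auto simp: square_integrable_def)
    show "(\<lambda>x. (norm (a *\<^sub>R G x + b *\<^sub>R H x))\<^sup>2) \<in> borel_measurable (lebesgue_on \<Omega>)"
      using m by measurable
    show "AE x in lebesgue_on \<Omega>. norm ((norm (a *\<^sub>R G x + b *\<^sub>R H x))\<^sup>2)
        \<le> norm (2 * a\<^sup>2 * (norm (G x))\<^sup>2 + 2 * b\<^sup>2 * (norm (H x))\<^sup>2)"
    proof (rule AE_I2)
      fix x
      have "(norm (a *\<^sub>R G x + b *\<^sub>R H x))\<^sup>2 \<le> (norm (a *\<^sub>R G x) + norm (b *\<^sub>R H x))\<^sup>2"
        by (intro power_mono norm_triangle_ineq) auto
      also have "\<dots> \<le> 2 * (norm (a *\<^sub>R G x))\<^sup>2 + 2 * (norm (b *\<^sub>R H x))\<^sup>2"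
        using zero_le_power2[of "norm (a *\<^sub>R G x) - norm (b *\<^sub>R H x)"]
        by (simp add: power2_sum power2_diff)
      also have "\<dots> = 2 * a\<^sup>2 * (norm (G x))\<^sup>2 + 2 * b\<^sup>2 * (norm (H x))\<^sup>2"
        by (simp add: power_mult_distrib)
      finally show "norm ((norm (a *\<^sub>R G x + b *\<^sub>R H x))\<^sup>2)
        \<le> norm (2 * a\<^sup>2 * (norm (G x))\<^sup>2 + 2 * b\<^sup>2 * (norm (H x))\<^sup>2)" by simp
    qed
  qed
qed

lemma finite_energyD:
  assumes "open \<Omega>" "finite_energy \<Omega> u"
  shows "has_weak_grad \<Omega> u (wgrad \<Omega> u)" "square_integrable \<Omega> (wgrad \<Omega> u)"
proof -
  obtain G where G: "has_weak_grad \<Omega> u G" "square_integrable \<Omega> G"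
    using assms(2) by (auto simp: finite_energy_def)
  show w: "has_weak_grad \<Omega> u (wgrad \<Omega> u)" by (rule wgrad_eq[OF assms(1) G(1)])
  show "square_integrable \<Omega> (wgrad \<Omega> u)"
    by (rule square_integrable_AE[OF G(2) _ wgrad_eq(2)[OF assms(1) G(1)]])
      (use w in \<open>simp add: has_weak_grad_def locally_integrable_def\<close>)
qed

lemma finite_energy_lincomb:
  assumes \<Omega>: "open \<Omega>" and u: "finite_energy \<Omega> u" and w: "finite_energy \<Omega> w"
  shows "finite_energy \<Omega> (\<lambda>x. a * u x + b * w x)"
    and "AE x in lebesgue_on \<Omega>. wgrad \<Omega> (\<lambda>x. a * u x + b * w x) x = a *\<^sub>R wgrad \<Omega> u x + b *\<^sub>R wgrad \<Omega> w x"
proof -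
  note G = has_weak_grad_lincomb[OF \<Omega> finite_energyD(1)[OF \<Omega> u] finite_energyD(1)[OF \<Omega> w], of a b]
  show "finite_energy \<Omega> (\<lambda>x. a * u x + b * w x)"
    unfolding finite_energy_def
    using G square_integrable_lincomb[OF finite_energyD(2)[OF \<Omega> u] finite_energyD(2)[OF \<Omega> w]] by blast
  show "AE x in lebesgue_on \<Omega>. wgrad \<Omega> (\<lambda>x. a * u x + b * w x) x = a *\<^sub>R wgrad \<Omega> u x + b *\<^sub>R wgrad \<Omega> w x"
    by (rule wgrad_eq(2)[OF \<Omega> G])
qed

lemma H1_finite_energy: "u \<in> H1 \<Omega> \<Longrightarrow> finite_energy \<Omega> u"
  by (auto simp: H1_def finite_energy_def)

lemma H10_finite_energy: "u \<in> H10 \<Omega> \<Longrightarrow> finite_energy \<Omega> u"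
  by (auto simp: H10_def H1_finite_energy)

lemma H1_lincomb:
  assumes "open \<Omega>" "u \<in> H1 \<Omega>" "w \<in> H1 \<Omega>"
  shows "(\<lambda>x. a * u x + b * w x) \<in> H1 \<Omega>"
  using finite_energy_lincomb(1)[OF assms(1) H1_finite_energy[OF assms(2)] H1_finite_energy[OF assms(3)], of a b]
    square_integrable_lincomb[of \<Omega> u w a b] assms(2,3)
  by (simp add: H1_def finite_energy_def)

lemma bounded_integrable:
  fixes f :: "real ^ 'n \<Rightarrow> 'b::euclidean_space"
  assumes "open \<Omega>" "bounded \<Omega>" "f \<in> borel_measurable (lebesgue_on \<Omega>)" "AE x in lebesgue_on \<Omega>. norm (f x) \<le> C"
  shows "integrable (lebesgue_on \<Omega>) f"
proof -
  have "finite_measure (lebesgue_on \<Omega>)"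
    by (rule finite_measure_lebesgue_on[OF lmeasurable_open[OF assms(2,1)]])
  then show ?thesis using finite_measure.integrable_const_bound assms(3,4) by blast
qed

lemma test_function_has_weak_grad:
  assumes "open \<Omega>" "test_function \<Omega> \<phi>"
  shows "has_weak_grad \<Omega> \<phi> (grad \<phi>)"
proof -
  obtain L B where LB: "L-lipschitz_on UNIV \<phi>" "\<And>x. \<bar>\<phi> x\<bar> \<le> B"
    using test_function_bounds[OF assms(2)] by metis
  show ?thesis
    by (rule lipschitz_has_weak_grad(3)[OF assms(1) LB])
      (simp add: has_derivative_grad smooth_differentiable test_functionD(1)[OF assms(2)])
qed

text \<open>
  The constant sequence approximates \<open>\<phi>\<close>; its distance to \<open>\<phi>\<close> vanishes because the chosen weak
  gradient of the zero function is zero almost everywhere.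
\<close>

lemma test_function_H10:
  fixes \<Omega> :: "(real ^ 'n) set"
  assumes \<Omega>: "open \<Omega>" "bounded \<Omega>" and \<phi>: "test_function \<Omega> \<phi>"
  shows "\<phi> \<in> H10 \<Omega>"
proof -
  obtain L B where LB: "L-lipschitz_on UNIV \<phi>" "\<And>x. \<bar>\<phi> x\<bar> \<le> B" "0 \<le> B"
    using test_function_bounds[OF \<phi>] by metis
  have D: "(\<phi> has_derivative (\<lambda>h. grad \<phi> x \<bullet> h)) (at x)" for x
    by (rule has_derivative_grad[OF smooth_differentiable[OF test_functionD(1)[OF \<phi>]]])
  have gL: "norm (grad \<phi> x) \<le> L" for x by (rule lipschitz_derivative_bound[OF LB(1) D])
  have sq: "square_integrable \<Omega> f" if "continuous_on UNIV f" "\<And>x. norm (f x) \<le> C"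
    for f :: "real ^ 'n \<Rightarrow> 'b::euclidean_space" and C
    unfolding square_integrable_def
  proof
    show m: "f \<in> borel_measurable (lebesgue_on \<Omega>)" by (rule continuous_lebesgue_on_measurable[OF that(1)])
    show "integrable (lebesgue_on \<Omega>) (\<lambda>x. (norm (f x))\<^sup>2)"
    proof (rule bounded_integrable[OF \<Omega>, where C = "C\<^sup>2"])
      show "(\<lambda>x. (norm (f x))\<^sup>2) \<in> borel_measurable (lebesgue_on \<Omega>)" using m by measurable
      show "AE x in lebesgue_on \<Omega>. norm ((norm (f x))\<^sup>2) \<le> C\<^sup>2"
        using that(2) by (intro AE_I2) (simp add: power_mono)
    qed
  qed
  have "\<phi> \<in> H1 \<Omega>"
    unfolding H1_def
    using sq[OF smooth_continuous[OF test_functionD(1)[OF \<phi>]], of B] LB(2)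
      sq[OF smooth_continuous_grad[OF test_functionD(1)[OF \<phi>]] gL] test_function_has_weak_grad[OF \<Omega>(1) \<phi>]
    by auto
  moreover have "H1_norm \<Omega> (\<lambda>x. \<phi> x - \<phi> x) = 0"
  proof -
    have "has_weak_grad \<Omega> (\<lambda>x. 0) (\<lambda>x. 0)"
      using has_weak_grad_lincomb[OF \<Omega>(1) test_function_has_weak_grad[OF \<Omega>(1) \<phi>]
          test_function_has_weak_grad[OF \<Omega>(1) \<phi>], of 0 0] by simp
    from wgrad_eq(2)[OF \<Omega>(1) this] have "AE x in lebesgue_on \<Omega>. (norm (wgrad \<Omega> (\<lambda>x. 0) x))\<^sup>2 = 0"
      by eventually_elim simp
    then have "(LINT x|lebesgue_on \<Omega>. (norm (wgrad \<Omega> (\<lambda>x. 0) x))\<^sup>2) = 0"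
      by (rule integral_eq_zero_AE)
    then show ?thesis by (simp add: H1_norm_def)
  qed
  ultimately show ?thesis
    unfolding H10_def using \<phi> by (auto intro!: exI[of _ "\<lambda>_. \<phi>"])
qed

lemma test_function_diff:
  assumes "test_function \<Omega> \<phi>" "test_function \<Omega> \<psi>"
  shows "test_function \<Omega> (\<lambda>x. \<phi> x - \<psi> x)"
proof -
  obtain K K' where K: "compact K" "K \<subseteq> \<Omega>" "\<And>x. x \<notin> K \<Longrightarrow> \<phi> x = 0"
    "compact K'" "K' \<subseteq> \<Omega>" "\<And>x. x \<notin> K' \<Longrightarrow> \<psi> x = 0"
    using assms[THEN test_functionD(2)] by metis
  have "compact (K \<union> K')" "K \<union> K' \<subseteq> \<Omega>" "\<forall>x. x \<notin> K \<union> K' \<longrightarrow> \<phi> x - \<psi> x = 0"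
    using K by (auto intro: compact_Un)
  moreover have "smooth (\<lambda>x. \<phi> x - \<psi> x)"
    using assms by (intro smooth_diff test_functionD(1))
  ultimately show ?thesis unfolding test_function_def smooth_def by blast
qed

text \<open>
  Subtracting \<open>\<phi>\<close> from the approximating sequence leaves all approximation errors unchanged.
\<close>

lemma H10_diff_test_function:
  assumes \<Omega>: "open \<Omega>" "bounded \<Omega>" and u: "u \<in> H10 \<Omega>" and \<phi>: "test_function \<Omega> \<phi>"
  shows "(\<lambda>x. u x - \<phi> x) \<in> H10 \<Omega>"
proof -
  obtain \<psi> where \<psi>: "\<And>k. test_function \<Omega> (\<psi> k)" "(\<lambda>k. H1_norm \<Omega> (\<lambda>x. u x - \<psi> k x)) \<longlonglongrightarrow> 0"
    using u by (auto simp: H10_def)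
  have "(\<lambda>x. u x - \<phi> x) \<in> H1 \<Omega>"
    using H1_lincomb[OF \<Omega>(1), of u \<phi> 1 "-1"] u test_function_H10[OF \<Omega> \<phi>] by (simp add: H10_def)
  moreover have "test_function \<Omega> (\<lambda>x. \<psi> k x - \<phi> x)" for k by (rule test_function_diff[OF \<psi>(1) \<phi>])
  moreover have "(\<lambda>k. H1_norm \<Omega> (\<lambda>x. (u x - \<phi> x) - (\<psi> k x - \<phi> x))) \<longlonglongrightarrow> 0" using \<psi>(2) by simp
  ultimately show ?thesis unfolding H10_def by (auto intro!: exI[of _ "\<lambda>k x. \<psi> k x - \<phi> x"])
qed

locale diffusion =
  fixes \<Omega> :: "(real ^ 'n) set" and \<alpha> :: "real ^ 'n \<Rightarrow> real" and \<alpha>_lo \<alpha>_hi :: real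
  assumes \<Omega>: "open \<Omega>" "bounded \<Omega>"
    and \<alpha>_measurable: "\<alpha> \<in> borel_measurable (lebesgue_on \<Omega>)"
    and \<alpha>_lo: "0 < \<alpha>_lo" and \<alpha>: "\<And>x. x \<in> \<Omega> \<Longrightarrow> \<alpha>_lo \<le> \<alpha> x \<and> \<alpha> x \<le> \<alpha>_hi"
begin

lemma \<alpha>_pos: "x \<in> \<Omega> \<Longrightarrow> 0 < \<alpha> x" and \<alpha>_abs: "x \<in> \<Omega> \<Longrightarrow> \<bar>\<alpha> x\<bar> \<le> \<alpha>_hi"
  using \<alpha>[of x] \<alpha>_lo by auto

lemma wgrad_measurable:
  "finite_energy \<Omega> u \<Longrightarrow> wgrad \<Omega> u \<in> borel_measurable (lebesgue_on \<Omega>)"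
  using finite_energyD(2)[OF \<Omega>(1)] by (simp add: square_integrable_def)

lemma diffusion_form_integrable:
  assumes "finite_energy \<Omega> u" "finite_energy \<Omega> w"
  shows "integrable (lebesgue_on \<Omega>) (\<lambda>x. \<alpha> x * (wgrad \<Omega> u x \<bullet> wgrad \<Omega> w x))"
proof (rule Bochner_Integration.integrable_bound)
  show "integrable (lebesgue_on \<Omega>) (\<lambda>x. \<alpha>_hi * ((norm (wgrad \<Omega> u x))\<^sup>2 + (norm (wgrad \<Omega> w x))\<^sup>2))"
    using assms[THEN finite_energyD(2)[OF \<Omega>(1)]] by (auto simp: square_integrable_def)
  show "(\<lambda>x. \<alpha> x * (wgrad \<Omega> u x \<bullet> wgrad \<Omega> w x)) \<in> borel_measurable (lebesgue_on \<Omega>)"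
    using \<alpha>_measurable assms[THEN wgrad_measurable] by measurable
  show "AE x in lebesgue_on \<Omega>. norm (\<alpha> x * (wgrad \<Omega> u x \<bullet> wgrad \<Omega> w x))
      \<le> norm (\<alpha>_hi * ((norm (wgrad \<Omega> u x))\<^sup>2 + (norm (wgrad \<Omega> w x))\<^sup>2))"
  proof (rule AE_I2)
    fix x assume "x \<in> space (lebesgue_on \<Omega>)"
    then have x: "x \<in> \<Omega>" by simp
    let ?a = "norm (wgrad \<Omega> u x)" and ?b = "norm (wgrad \<Omega> w x)"
    have "\<bar>wgrad \<Omega> u x \<bullet> wgrad \<Omega> w x\<bar> \<le> ?a * ?b" by (rule Cauchy_Schwarz_ineq2)
    also have "\<dots> \<le> ?a\<^sup>2 + ?b\<^sup>2"
    proof -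
      have "2 * (?a * ?b) \<le> ?a\<^sup>2 + ?b\<^sup>2"
        using zero_le_power2[of "?a - ?b"] by (simp add: power2_diff mult.assoc)
      moreover have "0 \<le> ?a * ?b" by simp
      ultimately show ?thesis by linarith
    qed
    finally have "\<bar>\<alpha> x\<bar> * \<bar>wgrad \<Omega> u x \<bullet> wgrad \<Omega> w x\<bar> \<le> \<alpha>_hi * (?a\<^sup>2 + ?b\<^sup>2)"
      using \<alpha>_abs[OF x] by (intro mult_mono) auto
    then show "norm (\<alpha> x * (wgrad \<Omega> u x \<bullet> wgrad \<Omega> w x)) \<le> norm (\<alpha>_hi * (?a\<^sup>2 + ?b\<^sup>2))"
      by (simp only: real_norm_def abs_mult[symmetric] abs_ge_self order_trans[OF _ abs_ge_self])
  qed
qed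

lemma diffusion_form_sym: "diffusion_form \<Omega> \<alpha> u w = diffusion_form \<Omega> \<alpha> w u"
  by (simp add: diffusion_form_def inner_commute)

lemma diffusion_form_lincomb:
  assumes "finite_energy \<Omega> u" "finite_energy \<Omega> w" "finite_energy \<Omega> z"
  shows "diffusion_form \<Omega> \<alpha> (\<lambda>x. a * u x + b * w x) z = a * diffusion_form \<Omega> \<alpha> u z + b * diffusion_form \<Omega> \<alpha> w z"
proof -
  note fe = finite_energy_lincomb[OF \<Omega>(1) assms(1,2), of a b]
  have "diffusion_form \<Omega> \<alpha> (\<lambda>x. a * u x + b * w x) z =
      (LINT x|lebesgue_on \<Omega>. a * (\<alpha> x * (wgrad \<Omega> u x \<bullet> wgrad \<Omega> z x)) + b * (\<alpha> x * (wgrad \<Omega> w x \<bullet> wgrad \<Omega> z x)))"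
    unfolding diffusion_form_def
  proof (rule integral_cong_AE)
    show "(\<lambda>x. \<alpha> x * (wgrad \<Omega> (\<lambda>x. a * u x + b * w x) x \<bullet> wgrad \<Omega> z x)) \<in> borel_measurable (lebesgue_on \<Omega>)"
      by (rule borel_measurable_integrable[OF diffusion_form_integrable[OF fe(1) assms(3)]])
    show "(\<lambda>x. a * (\<alpha> x * (wgrad \<Omega> u x \<bullet> wgrad \<Omega> z x)) + b * (\<alpha> x * (wgrad \<Omega> w x \<bullet> wgrad \<Omega> z x)))
        \<in> borel_measurable (lebesgue_on \<Omega>)"
      using diffusion_form_integrable[OF assms(1,3)] diffusion_form_integrable[OF assms(2,3)] by measurable
    show "AE x in lebesgue_on \<Omega>. \<alpha> x * (wgrad \<Omega> (\<lambda>x. a * u x + b * w x) x \<bullet> wgrad \<Omega> z x) =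
      a * (\<alpha> x * (wgrad \<Omega> u x \<bullet> wgrad \<Omega> z x)) + b * (\<alpha> x * (wgrad \<Omega> w x \<bullet> wgrad \<Omega> z x))"
      using fe(2) by eventually_elim (simp add: inner_add_left algebra_simps)
  qed
  then show ?thesis
    using diffusion_form_integrable[OF assms(1,3)] diffusion_form_integrable[OF assms(2,3)]
    by (simp add: diffusion_form_def)
qed

lemma diffusion_form_nonneg: "0 \<le> diffusion_form \<Omega> \<alpha> u u"
  unfolding diffusion_form_def by (intro integral_nonneg_AE AE_I2 mult_nonneg_nonneg) (auto intro: less_imp_le[OF \<alpha>_pos])

lemma Y_norm_eq_form: "Y_norm \<Omega> \<alpha> u = sqrt (diffusion_form \<Omega> \<alpha> u u)"
  by (simp add: Y_norm_def diffusion_form_def power2_norm_eq_inner)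

lemma Y_norm_square: "(Y_norm \<Omega> \<alpha> u)\<^sup>2 = diffusion_form \<Omega> \<alpha> u u"
  using diffusion_form_nonneg by (simp add: Y_norm_eq_form)

lemma Y_norm_nonneg: "0 \<le> Y_norm \<Omega> \<alpha> u"
  using diffusion_form_nonneg by (simp add: Y_norm_eq_form)

lemma Y_norm_le_H1_norm:
  assumes "finite_energy \<Omega> u"
  shows "Y_norm \<Omega> \<alpha> u \<le> sqrt \<bar>\<alpha>_hi\<bar> * H1_norm \<Omega> u"
proof -
  let ?n = "\<lambda>x. (norm (wgrad \<Omega> u x))\<^sup>2"
  have int: "integrable (lebesgue_on \<Omega>) ?n"
    using finite_energyD(2)[OF \<Omega>(1) assms] by (simp add: square_integrable_def)
  have "(LINT x|lebesgue_on \<Omega>. \<alpha> x * ?n x) \<le> (LINT x|lebesgue_on \<Omega>. \<bar>\<alpha>_hi\<bar> * ?n x)"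
  proof (rule integral_mono)
    show "integrable (lebesgue_on \<Omega>) (\<lambda>x. \<alpha> x * ?n x)"
      using diffusion_form_integrable[OF assms assms] by (simp add: power2_norm_eq_inner)
    show "integrable (lebesgue_on \<Omega>) (\<lambda>x. \<bar>\<alpha>_hi\<bar> * ?n x)" using int by simp
    fix x assume "x \<in> space (lebesgue_on \<Omega>)"
    then show "\<alpha> x * ?n x \<le> \<bar>\<alpha>_hi\<bar> * ?n x" using \<alpha>[of x] by (intro mult_right_mono) auto
  qed
  also have "\<dots> \<le> \<bar>\<alpha>_hi\<bar> * ((LINT x|lebesgue_on \<Omega>. (u x)\<^sup>2) + (LINT x|lebesgue_on \<Omega>. ?n x))"
    using int by (auto intro!: mult_left_mono)
  finally show ?thesis
    unfolding Y_norm_def H1_norm_def real_sqrt_mult[symmetric] by (rule real_sqrt_le_mono)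
qed

end

section \<open>The dual space and the convection functional\<close>

context diffusion
begin

lemma Y_dual_lincomb:
  assumes "F \<in> Y_dual \<Omega> \<alpha>" "q \<in> H10 \<Omega>" "r \<in> H10 \<Omega>"
  shows "F (\<lambda>x. a * q x + b * r x) = a * F q + b * F r"
  using assms by (simp add: Y_dual_def)

lemma Y_dual_bound:
  assumes "F \<in> Y_dual \<Omega> \<alpha>"
  obtains C where "0 \<le> C" "\<And>q. q \<in> H10 \<Omega> \<Longrightarrow> \<bar>F q\<bar> \<le> C * Y_norm \<Omega> \<alpha> q"
proof -
  obtain C where C: "\<And>q. q \<in> H10 \<Omega> \<Longrightarrow> \<bar>F q\<bar> \<le> C * Y_norm \<Omega> \<alpha> q"
    using assms unfolding Y_dual_def by blast
  have "\<bar>F q\<bar> \<le> \<bar>C\<bar> * Y_norm \<Omega> \<alpha> q" if "q \<in> H10 \<Omega>" for q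
    using C[OF that] mult_right_mono[OF abs_ge_self[of C] Y_norm_nonneg[of q]] by linarith
  then show ?thesis using that[of "\<bar>C\<bar>"] by simp
qed

lemma Y_dual_diff_bound:
  assumes F: "F \<in> Y_dual \<Omega> \<alpha>" and C: "\<And>q. q \<in> H10 \<Omega> \<Longrightarrow> \<bar>F q\<bar> \<le> C * Y_norm \<Omega> \<alpha> q"
    and q: "q \<in> H10 \<Omega>" and \<phi>: "test_function \<Omega> \<phi>"
  shows "\<bar>F q - F \<phi>\<bar> \<le> C * Y_norm \<Omega> \<alpha> (\<lambda>x. q x - \<phi> x)"
  using C[OF H10_diff_test_function[OF \<Omega> q \<phi>]] Y_dual_lincomb[OF F q test_function_H10[OF \<Omega> \<phi>], of 1 "-1"]
  by simp

text \<open>Test functions are dense, so they determine a bounded functional.\<close>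

lemma Y_dual_eqI:
  assumes F: "F \<in> Y_dual \<Omega> \<alpha>" and F': "F' \<in> Y_dual \<Omega> \<alpha>"
    and eq: "\<And>\<phi>. test_function \<Omega> \<phi> \<Longrightarrow> F \<phi> = F' \<phi>" and q: "q \<in> H10 \<Omega>"
  shows "F q = F' q"
proof -
  obtain C where C: "0 \<le> C" "\<And>q. q \<in> H10 \<Omega> \<Longrightarrow> \<bar>F q\<bar> \<le> C * Y_norm \<Omega> \<alpha> q"
    using Y_dual_bound[OF F] by metis
  obtain C' where C': "0 \<le> C'" "\<And>q. q \<in> H10 \<Omega> \<Longrightarrow> \<bar>F' q\<bar> \<le> C' * Y_norm \<Omega> \<alpha> q"
    using Y_dual_bound[OF F'] by metis
  obtain \<phi> where \<phi>: "\<And>k. test_function \<Omega> (\<phi> k)" "(\<lambda>k. H1_norm \<Omega> (\<lambda>x. q x - \<phi> k x)) \<longlonglongrightarrow> 0"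
    using q by (auto simp: H10_def)
  let ?h = "\<lambda>k. (C + C') * (sqrt \<bar>\<alpha>_hi\<bar> * H1_norm \<Omega> (\<lambda>x. q x - \<phi> k x))"
  have "\<bar>F q - F' q\<bar> \<le> ?h k" for k
  proof -
    have "\<bar>F q - F' q\<bar> \<le> (C + C') * Y_norm \<Omega> \<alpha> (\<lambda>x. q x - \<phi> k x)"
      using Y_dual_diff_bound[OF F C(2) q \<phi>(1), of k] Y_dual_diff_bound[OF F' C'(2) q \<phi>(1), of k] eq[OF \<phi>(1), of k]
      by (simp add: distrib_right)
    also have "\<dots> \<le> ?h k"
      using C(1) C'(1)
      by (intro mult_left_mono Y_norm_le_H1_norm H10_finite_energy H10_diff_test_function \<Omega> q \<phi>) auto
    finally show ?thesis .
  qed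
  moreover have "?h \<longlonglongrightarrow> (C + C') * (sqrt \<bar>\<alpha>_hi\<bar> * 0)"
    by (intro tendsto_intros \<phi>(2))
  ultimately have "\<bar>F q - F' q\<bar> \<le> (C + C') * (sqrt \<bar>\<alpha>_hi\<bar> * 0)"
    by (intro LIMSEQ_le_const[of ?h]) auto
  then show ?thesis by simp
qed

lemma pairing_represents:
  "represents \<Omega> \<alpha> g F \<Longrightarrow> represents \<Omega> \<alpha> g (pairing \<Omega> \<alpha> g)"
  unfolding pairing_def by (rule someI[of "represents \<Omega> \<alpha> g"])

lemma represents_unique:
  assumes "represents \<Omega> \<alpha> g F" "represents \<Omega> \<alpha> g H" "q \<in> H10 \<Omega>"
  shows "F q = H q"
  by (rule Y_dual_eqI[OF _ _ _ assms(3)]) (use assms in \<open>auto simp: represents_def\<close>)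

lemma Y_dual_combination:
  assumes F: "F \<in> Y_dual \<Omega> \<alpha>" and H: "H \<in> Y_dual \<Omega> \<alpha>"
  shows "(\<lambda>q. a * F q + b * H q) \<in> Y_dual \<Omega> \<alpha>"
proof -
  obtain C where C: "\<And>q. q \<in> H10 \<Omega> \<Longrightarrow> \<bar>F q\<bar> \<le> C * Y_norm \<Omega> \<alpha> q"
    using Y_dual_bound[OF F] by metis
  obtain D where D: "\<And>q. q \<in> H10 \<Omega> \<Longrightarrow> \<bar>H q\<bar> \<le> D * Y_norm \<Omega> \<alpha> q"
    using Y_dual_bound[OF H] by metis
  have "\<bar>a * F q + b * H q\<bar> \<le> (\<bar>a\<bar> * C + \<bar>b\<bar> * D) * Y_norm \<Omega> \<alpha> q" if q: "q \<in> H10 \<Omega>" for q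
  proof -
    have "\<bar>a * F q + b * H q\<bar> \<le> \<bar>a\<bar> * \<bar>F q\<bar> + \<bar>b\<bar> * \<bar>H q\<bar>"
      by (metis abs_mult abs_triangle_ineq)
    also have "\<dots> \<le> \<bar>a\<bar> * (C * Y_norm \<Omega> \<alpha> q) + \<bar>b\<bar> * (D * Y_norm \<Omega> \<alpha> q)"
      using C[OF q] D[OF q] by (intro add_mono mult_left_mono) auto
    finally show ?thesis by (simp add: algebra_simps)
  qed
  then have "\<exists>C. \<forall>q\<in>H10 \<Omega>. \<bar>a * F q + b * H q\<bar> \<le> C * Y_norm \<Omega> \<alpha> q" by blast
  then show ?thesis
    using Y_dual_lincomb[OF F] Y_dual_lincomb[OF H]
    by (simp add: Y_dual_def) (simp add: algebra_simps)
qed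

text \<open>
  Equality almost everywhere is the natural hypothesis on \<open>k\<close>, since the chosen weak gradient of
  a linear combination agrees with the combination of the weak gradients only almost everywhere.
\<close>

lemma represents_lincomb:
  assumes g: "represents \<Omega> \<alpha> g F" and h: "represents \<Omega> \<alpha> h H"
    and k: "k \<in> borel_measurable (lebesgue_on \<Omega>)" "AE x in lebesgue_on \<Omega>. k x = a * g x + b * h x"
  shows "represents \<Omega> \<alpha> k (\<lambda>q. a * F q + b * H q)"
proof -
  have loc: "locally_integrable \<Omega> g" "locally_integrable \<Omega> h" using g h by (auto simp: represents_def)
  have lock: "locally_integrable \<Omega> k"
    unfolding locally_integrable_def
  proof (intro conjI allI impI)
    fix K assume K: "compact K \<and> K \<subseteq> \<Omega>"
    then have Ks: "K \<in> sets lebesgue" by (simp add: fmeasurableD lmeasurable_compact)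
    have "integrable (lebesgue_on K) (\<lambda>x. a * g x + b * h x)"
      using loc K by (auto simp: locally_integrable_def)
    then show "integrable (lebesgue_on K) k"
    proof (rule integrable_cong_AE_imp)
      have "k \<in> borel_measurable (restrict_space (lebesgue_on \<Omega>) K)"
        by (rule measurable_restrict_space1[OF k(1)])
      moreover have "restrict_space (lebesgue_on \<Omega>) K = lebesgue_on K"
        using K \<Omega>(1) Ks by (subst restrict_restrict_space) (auto intro: arg_cong[where f="lebesgue_on"])
      ultimately show "k \<in> borel_measurable (lebesgue_on K)" by simp
      have "AE x in lebesgue. x \<in> \<Omega> \<longrightarrow> k x = a * g x + b * h x"
        using k(2) unfolding AE_lebesgue_on[OF \<Omega>(1)] .
      then have "AE x in lebesgue. x \<in> K \<longrightarrow> a * g x + b * h x = k x"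
        by eventually_elim (use K in auto)
      then show "AE x in lebesgue_on K. a * g x + b * h x = k x"
        using AE_restrict_space_iff[of K lebesgue] Ks by simp
    qed
  qed (rule k(1))
  have "a * F \<phi> + b * H \<phi> = (LINT x|lebesgue_on \<Omega>. k x * \<phi> x)" if \<phi>: "test_function \<Omega> \<phi>" for \<phi>
  proof -
    obtain K where K: "compact K" "K \<subseteq> \<Omega>" "\<And>x. x \<notin> K \<Longrightarrow> \<phi> x = 0"
      using test_functionD(2)[OF \<phi>] by blast
    note cont = smooth_continuous[OF test_functionD(1)[OF \<phi>]]
    note ints = integrable_test_product[OF loc(1) \<Omega>(1) K cont] integrable_test_product[OF loc(2) \<Omega>(1) K cont]
    have "(LINT x|lebesgue_on \<Omega>. k x * \<phi> x) = (LINT x|lebesgue_on \<Omega>. a * (g x * \<phi> x) + b * (h x * \<phi> x))"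
    proof (rule integral_cong_AE)
      show "(\<lambda>x. k x * \<phi> x) \<in> borel_measurable (lebesgue_on \<Omega>)"
        by (intro borel_measurable_times k(1) continuous_lebesgue_on_measurable[OF cont])
      show "(\<lambda>x. a * (g x * \<phi> x) + b * (h x * \<phi> x)) \<in> borel_measurable (lebesgue_on \<Omega>)"
        using ints by measurable
      show "AE x in lebesgue_on \<Omega>. k x * \<phi> x = a * (g x * \<phi> x) + b * (h x * \<phi> x)"
        using k(2) by eventually_elim (simp add: algebra_simps)
    qed
    also have "\<dots> = a * F \<phi> + b * H \<phi>"
      using ints g h \<phi> by (simp add: represents_def)
    finally show ?thesis by simp
  qed
  then show ?thesis
    using lock Y_dual_combination g h by (simp add: represents_def)
qed

text \<open>
  Members of \<open>X_space\<close> have this property, and it passes to linear combinations, so it covers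
  the errors of the discrete solutions.
\<close>

definition convectable :: "(real ^ 'n \<Rightarrow> real ^ 'n) \<Rightarrow> (real ^ 'n \<Rightarrow> real) \<Rightarrow> bool" where
  "convectable v u \<longleftrightarrow> finite_energy \<Omega> u \<and> (\<exists>F. represents \<Omega> \<alpha> (convection \<Omega> v u) F)"

lemma X_space_convectable: "u \<in> X_space \<Omega> \<alpha> v \<Longrightarrow> convectable v u"
  by (auto simp: X_space_def convectable_def H10_finite_energy)

lemma convection_measurable:
  assumes "v \<in> borel_measurable (lebesgue_on \<Omega>)" "finite_energy \<Omega> u"
  shows "convection \<Omega> v u \<in> borel_measurable (lebesgue_on \<Omega>)"
  unfolding convection_def[abs_def] using assms(1) wgrad_measurable[OF assms(2)] by measurable

lemma convectable_lincomb:
  assumes v: "v \<in> borel_measurable (lebesgue_on \<Omega>)" and u: "convectable v u" and w: "convectable v w"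
  shows "convectable v (\<lambda>x. a * u x + b * w x)"
    and "q \<in> H10 \<Omega> \<Longrightarrow> pairing \<Omega> \<alpha> (convection \<Omega> v (\<lambda>x. a * u x + b * w x)) q =
        a * pairing \<Omega> \<alpha> (convection \<Omega> v u) q + b * pairing \<Omega> \<alpha> (convection \<Omega> v w) q"
proof -
  have fe: "finite_energy \<Omega> u" "finite_energy \<Omega> w" using u w by (auto simp: convectable_def)
  note fe' = finite_energy_lincomb[OF \<Omega>(1) fe, of a b]
  have r: "represents \<Omega> \<alpha> (convection \<Omega> v u) (pairing \<Omega> \<alpha> (convection \<Omega> v u))"
    "represents \<Omega> \<alpha> (convection \<Omega> v w) (pairing \<Omega> \<alpha> (convection \<Omega> v w))"
    using u w pairing_represents by (auto simp: convectable_def)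
  have "AE x in lebesgue_on \<Omega>. convection \<Omega> v (\<lambda>x. a * u x + b * w x) x
      = a * convection \<Omega> v u x + b * convection \<Omega> v w x"
    using fe'(2) by eventually_elim (simp add: convection_def inner_add_right)
  note rep = represents_lincomb[OF r convection_measurable[OF v fe'(1)] this]
  show "convectable v (\<lambda>x. a * u x + b * w x)"
    using fe'(1) rep by (auto simp: convectable_def)
  show "pairing \<Omega> \<alpha> (convection \<Omega> v (\<lambda>x. a * u x + b * w x)) q =
        a * pairing \<Omega> \<alpha> (convection \<Omega> v u) q + b * pairing \<Omega> \<alpha> (convection \<Omega> v w) q" if "q \<in> H10 \<Omega>"
    by (rule represents_unique[OF pairing_represents[OF rep] rep that])
qed

end

section \<open>Positivity of the convection term\<close>

text \<open>
  For a test function \<open>\<phi>\<close> the integrand is \<open>v \<bullet> \<nabla>(\<phi>\<^sup>2 / 2)\<close>, and \<open>\<phi>\<^sup>2\<close> is again a test function.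
\<close>

lemma convection_test_function_nonneg:
  fixes \<Omega> :: "(real ^ 'n) set"
  assumes div: "has_weak_div \<Omega> v d" "AE x in lebesgue_on \<Omega>. d x \<le> 0" and \<phi>: "test_function \<Omega> \<phi>"
  shows "0 \<le> (LINT x|lebesgue_on \<Omega>. (v x \<bullet> grad \<phi> x) * \<phi> x)"
proof -
  have smooth: "smooth \<phi>" by (rule test_functionD[OF \<phi>])
  obtain K where K: "compact K" "K \<subseteq> \<Omega>" "\<And>x. x \<notin> K \<Longrightarrow> \<phi> x = 0"
    using test_functionD(2)[OF \<phi>] by blast
  have test: "test_function \<Omega> (\<lambda>x. \<phi> x * \<phi> x)"
    unfolding test_function_def smooth_def[symmetric]
    using smooth_mult[OF smooth smooth] K by (intro conjI exI[of _ K]) auto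
  have "grad (\<lambda>x. \<phi> x * \<phi> x) x = (2 * \<phi> x) *\<^sub>R grad \<phi> x" for x
    using partial_mult[OF smooth_differentiable[OF smooth] smooth_differentiable[OF smooth]]
    by (simp add: grad_def vec_eq_iff)
  then have "(LINT x|lebesgue_on \<Omega>. v x \<bullet> grad (\<lambda>x. \<phi> x * \<phi> x) x)
      = (LINT x|lebesgue_on \<Omega>. 2 * ((v x \<bullet> grad \<phi> x) * \<phi> x))"
    by (intro Bochner_Integration.integral_cong) (simp_all add: mult_ac)
  then have "(LINT x|lebesgue_on \<Omega>. v x \<bullet> grad (\<lambda>x. \<phi> x * \<phi> x) x)
      = 2 * (LINT x|lebesgue_on \<Omega>. (v x \<bullet> grad \<phi> x) * \<phi> x)"
    by simp
  moreover have "(LINT x|lebesgue_on \<Omega>. v x \<bullet> grad (\<lambda>x. \<phi> x * \<phi> x) x)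
      = (LINT x|lebesgue_on \<Omega>. - (d x * (\<phi> x * \<phi> x)))"
    using div(1) test by (simp add: has_weak_div_def)
  moreover have "0 \<le> (LINT x|lebesgue_on \<Omega>. - (d x * (\<phi> x * \<phi> x)))"
    using div(2) by (intro integral_nonneg_AE) (auto elim!: eventually_mono intro: mult_nonpos_nonneg)
  ultimately show ?thesis by linarith
qed

text \<open>
  Composing with this function turns a function with zero boundary values into one whose support
  is compact in the domain, while its gradient is either unchanged or zero.
\<close>

definition soft_threshold :: "real \<Rightarrow> real \<Rightarrow> real" where
  "soft_threshold \<epsilon> s = max 0 (s - \<epsilon>) - max 0 (- s - \<epsilon>)"

lemma soft_threshold_lipschitz: "0 < \<epsilon> \<Longrightarrow> \<bar>soft_threshold \<epsilon> s - soft_threshold \<epsilon> t\<bar> \<le> \<bar>s - t\<bar>"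
  by (auto simp: soft_threshold_def max_def)

lemma soft_threshold_eq_0: "\<bar>s\<bar> \<le> \<epsilon> \<Longrightarrow> soft_threshold \<epsilon> s = 0"
  by (auto simp: soft_threshold_def max_def)

lemma locally_affine_soft_threshold:
  fixes q :: "real ^ 'n \<Rightarrow> real"
  assumes q: "continuous_on UNIV q" and a: "locally_affine q x a" and \<epsilon>: "0 < \<epsilon>" "a \<noteq> 0 \<longrightarrow> \<bar>q x\<bar> \<noteq> \<epsilon>"
  shows "locally_affine (\<lambda>y. soft_threshold \<epsilon> (q y)) x (if \<epsilon> < \<bar>q x\<bar> then a else 0)"
proof -
  obtain r where r: "0 < r" "\<And>y. y \<in> ball x r \<Longrightarrow> q y = q x + a \<bullet> (y - x)"
    using a unfolding locally_affine_def by blast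
  show ?thesis
  proof (cases "a = 0")
    case True
    then have "\<forall>y\<in>ball x r. soft_threshold \<epsilon> (q y) = soft_threshold \<epsilon> (q x) + 0 \<bullet> (y - x)"
      using r(2) by simp
    then show ?thesis using r(1) True unfolding locally_affine_def by (metis (full_types))
  next
    case False
    then have ne: "\<bar>q x\<bar> \<noteq> \<epsilon>" using \<epsilon> by simp
    have near: "\<exists>s>0. \<forall>y\<in>ball x s. q y \<in> U" if U: "open U" "q x \<in> U" for U
    proof -
      have "open (q -` U)" using U(1) q by (rule open_vimage)
      moreover have "x \<in> q -` U" using U(2) by simp
      ultimately obtain s where "0 < s" "ball x s \<subseteq> q -` U" by (rule openE)
      then show ?thesis by blast
    qed
    have shifted: "locally_affine (\<lambda>y. soft_threshold \<epsilon> (q y)) x a"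
      if U: "open U" "q x \<in> U" and eq: "\<And>t. t \<in> U \<Longrightarrow> soft_threshold \<epsilon> t = t + c" for U c
    proof -
      obtain s where s: "0 < s" "\<forall>y\<in>ball x s. q y \<in> U" using near[OF U] by blast
      have "soft_threshold \<epsilon> (q y) = soft_threshold \<epsilon> (q x) + a \<bullet> (y - x)" if y: "y \<in> ball x (min r s)" for y
      proof -
        have "q y = q x + a \<bullet> (y - x)" using y by (intro r(2)) simp
        moreover have "q y \<in> U" using y s(2) by simp
        ultimately show ?thesis using eq U(2) by simp
      qed
      moreover have "0 < min r s" using r(1) s(1) by simp
      ultimately show ?thesis unfolding locally_affine_def by blast
    qed
    consider "\<epsilon> < q x" | "q x < - \<epsilon>" | "\<bar>q x\<bar> < \<epsilon>" using ne by linarith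
    then show ?thesis
    proof cases
      case 1
      then have "locally_affine (\<lambda>y. soft_threshold \<epsilon> (q y)) x a"
        using \<epsilon>(1) by (intro shifted[of "{\<epsilon><..}" "- \<epsilon>"]) (auto simp: soft_threshold_def)
      moreover have "\<epsilon> < \<bar>q x\<bar>" using 1 \<epsilon>(1) by linarith
      ultimately show ?thesis by simp
    next
      case 2
      then have "locally_affine (\<lambda>y. soft_threshold \<epsilon> (q y)) x a"
        using \<epsilon>(1) by (intro shifted[of "{..<- \<epsilon>}" \<epsilon>]) (auto simp: soft_threshold_def)
      moreover have "\<epsilon> < \<bar>q x\<bar>" using 2 \<epsilon>(1) by linarith
      ultimately show ?thesis by simp
    next
      case 3
      then obtain s where s: "0 < s" "\<forall>y\<in>ball x s. q y \<in> {- \<epsilon><..<\<epsilon>}"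
        using near[of "{- \<epsilon><..<\<epsilon>}"] by (auto simp: abs_less_iff)
      have "soft_threshold \<epsilon> (q y) = 0" if "y \<in> ball x s" for y
        using bspec[OF s(2) that] by (intro soft_threshold_eq_0) auto
      then have "\<forall>y\<in>ball x s. soft_threshold \<epsilon> (q y) = soft_threshold \<epsilon> (q x) + 0 \<bullet> (y - x)"
        using s(1) by simp
      then have "locally_affine (\<lambda>y. soft_threshold \<epsilon> (q y)) x 0"
        unfolding locally_affine_def using s(1) by blast
      then show ?thesis using 3 by simp
    qed
  qed
qed

context diffusion
begin

text \<open>
  The truncated function \<open>\<psi>\<close> is approximated by test functions \<open>\<phi>\<^sub>k\<close> with uniformly bounded
  gradients, which is what a merely locally integrable velocity needs.  The values \<open>F \<phi>\<^sub>k\<close> differ from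
  \<open>\<integral> (v \<bullet> \<nabla>\<phi>\<^sub>k) \<phi>\<^sub>k \<ge> 0\<close> by a null sequence, and the boundedness of \<open>F\<close> controls
  \<open>F q - F \<phi>\<^sub>k\<close> by the energy norm of \<open>q - \<phi>\<^sub>k\<close>, which tends to that of \<open>q - \<psi>\<close>.
\<close>

lemma convection_nonneg_up_to_truncation:
  fixes q :: "real ^ 'n \<Rightarrow> real"
  assumes v: "locally_integrable \<Omega> v"
    and div: "has_weak_div \<Omega> v d" "AE x in lebesgue_on \<Omega>. d x \<le> 0"
    and q: "q \<in> H10 \<Omega>" and q_lip: "L-lipschitz_on UNIV q" and q_bound: "\<And>x. \<bar>q x\<bar> \<le> B"
    and q_zero: "\<And>x. x \<notin> \<Omega> \<Longrightarrow> q x = 0"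
    and q_affine: "\<And>s. AE x in lebesgue. \<exists>a. locally_affine q x a \<and> (a \<noteq> 0 \<longrightarrow> q x \<noteq> s)"
    and F: "represents \<Omega> \<alpha> (convection \<Omega> v q) F"
    and C: "\<And>q. q \<in> H10 \<Omega> \<Longrightarrow> \<bar>F q\<bar> \<le> C * Y_norm \<Omega> \<alpha> q" and \<epsilon>: "0 < \<epsilon>"
  shows "- C * sqrt (LINT x|lebesgue_on \<Omega>. \<alpha> x * (norm (if \<epsilon> < \<bar>q x\<bar> then 0 else grad q x))\<^sup>2) \<le> F q"
proof -
  let ?M = "lebesgue_on \<Omega>"
  define \<psi> where "\<psi> x = soft_threshold \<epsilon> (q x)" for x
  define A where "A = grad q"
  define A\<epsilon> where "A\<epsilon> x = (if \<epsilon> < \<bar>q x\<bar> then A x else 0)" for x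
  have q_cont: "continuous_on UNIV q" by (rule lipschitz_on_continuous_on[OF q_lip])
  have L0: "0 \<le> L" by (rule lipschitz_on_nonneg[OF q_lip])
  have A_deriv: "AE x in lebesgue. (q has_derivative (\<lambda>h. A x \<bullet> h)) (at x)"
    using q_affine[of 0] unfolding A_def
    by eventually_elim (metis locally_affine_grad locally_affine_has_derivative)
  note A = lipschitz_has_weak_grad[OF \<Omega>(1) q_lip q_bound A_deriv]
  have Am: "A \<in> borel_measurable ?M" by (rule measurable_restrict_space1[OF A(1)])
  have Ab: "AE x in ?M. norm (A x) \<le> L"
    unfolding AE_lebesgue_on[OF \<Omega>(1)] using A(2) by eventually_elim simp
  have wgrad_q: "AE x in ?M. wgrad \<Omega> q x = A x" by (rule wgrad_eq(2)[OF \<Omega>(1) A(3)])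
  have \<psi>_lip: "L-lipschitz_on UNIV \<psi>"
  proof (rule lipschitz_onI)
    fix x y
    show "dist (\<psi> x) (\<psi> y) \<le> L * dist x y"
      using soft_threshold_lipschitz[OF \<epsilon>, of "q x" "q y"] lipschitz_onD[OF q_lip, of x y]
      by (simp add: \<psi>_def dist_real_def)
  qed (rule L0)
  define K where "K = {x. \<epsilon> \<le> \<bar>q x\<bar>}"
  have K_sub: "K \<subseteq> \<Omega>" using q_zero \<epsilon> by (force simp: K_def)
  have "closed K" unfolding K_def by (intro closed_Collect_le continuous_intros q_cont)
  then have K: "compact K" using K_sub \<Omega>(2) bounded_subset compact_eq_bounded_closed by blast
  have \<psi>_zero: "\<psi> x = 0" if "x \<notin> K" for x
    using that soft_threshold_eq_0 by (simp add: \<psi>_def K_def)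
  have \<psi>_affine: "AE x in ?M. locally_affine \<psi> x (A\<epsilon> x)"
  proof -
    have "AE x in lebesgue. locally_affine \<psi> x (A\<epsilon> x)"
      using q_affine[of \<epsilon>] q_affine[of "- \<epsilon>"]
    proof eventually_elim
      case (elim x)
      then obtain a a' where a: "locally_affine q x a" "a \<noteq> 0 \<longrightarrow> q x \<noteq> \<epsilon>"
        "locally_affine q x a'" "a' \<noteq> 0 \<longrightarrow> q x \<noteq> - \<epsilon>" by blast
      then have "a = A x" "a' = A x" using locally_affine_grad unfolding A_def by metis+
      then have "A x \<noteq> 0 \<longrightarrow> \<bar>q x\<bar> \<noteq> \<epsilon>" "locally_affine q x (A x)" using a by auto
      from locally_affine_soft_threshold[OF q_cont this(2) \<epsilon> this(1)]
      show ?case by (simp add: \<psi>_def[abs_def] A\<epsilon>_def)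
    qed
    then show ?thesis unfolding AE_lebesgue_on[OF \<Omega>(1)] by eventually_elim simp
  qed
  obtain \<phi> K' B' where \<phi>: "compact K'" "K' \<subseteq> \<Omega>" "\<And>k. test_function \<Omega> (\<phi> k)"
    "\<And>k x. x \<notin> K' \<Longrightarrow> \<phi> k x = 0" "\<And>k. L-lipschitz_on UNIV (\<phi> k)"
    "\<And>k x. \<bar>\<phi> k x\<bar> \<le> B'" "\<And>x. (\<lambda>k. \<phi> k x) \<longlonglongrightarrow> \<psi> x"
    "\<And>x a. locally_affine \<psi> x a \<Longrightarrow> \<forall>\<^sub>F k in sequentially. grad (\<phi> k) x = a"
  proof (rule lipschitz_test_function_approximation[OF \<Omega>(1) K K_sub \<psi>_lip \<psi>_zero])
  qed (assumption | (rule that; assumption))+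
  have smooth: "smooth (\<phi> k)" for k by (rule test_functionD[OF \<phi>(3)])
  have grad_b: "norm (grad (\<phi> k) x) \<le> L" for k x
    by (rule lipschitz_derivative_bound[OF \<phi>(5) has_derivative_grad[OF smooth_differentiable[OF smooth]]])
  have \<phi>m: "\<phi> k \<in> borel_measurable ?M" and gm: "grad (\<phi> k) \<in> borel_measurable ?M" for k
    by (intro continuous_lebesgue_on_measurable smooth_continuous smooth_continuous_grad smooth)+
  have vm: "v \<in> borel_measurable ?M" using v by (simp add: locally_integrable_def)
  have \<psi>m: "\<psi> \<in> borel_measurable ?M"
    by (intro continuous_lebesgue_on_measurable lipschitz_on_continuous_on[OF \<psi>_lip])
  have qm: "q \<in> borel_measurable ?M" by (intro continuous_lebesgue_on_measurable q_cont)
  have A\<epsilon>m: "A\<epsilon> \<in> borel_measurable ?M"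
    unfolding A\<epsilon>_def[abs_def] using Am qm by measurable
  have B'0: "0 \<le> B'" using \<phi>(6)[of 0 0] by linarith
  note dom = locally_integrable_dominant(2)[OF v \<Omega>(1) \<phi>(1,2)]
  \<comment> \<open>Where \<open>\<psi>\<close> does not vanish it has the same gradient as \<open>q\<close>, so the error made by replacing
    the gradient of \<open>q\<close> by that of \<open>\<phi>\<close> disappears in the limit.\<close>
  have "(\<lambda>k. LINT x|?M. (v x \<bullet> (A x - grad (\<phi> k) x)) * \<phi> k x) \<longlonglongrightarrow> (LINT x|?M. (v x \<bullet> (A x - A\<epsilon> x)) * \<psi> x)"
    (is "?E \<longlonglongrightarrow> _")
  proof (rule integral_dominated_convergence[OF _ _ dom[of "2 * L * B'"]])
    show "(\<lambda>x. (v x \<bullet> (A x - A\<epsilon> x)) * \<psi> x) \<in> borel_measurable ?M"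
      using vm Am A\<epsilon>m \<psi>m by measurable
    show "(\<lambda>x. (v x \<bullet> (A x - grad (\<phi> k) x)) * \<phi> k x) \<in> borel_measurable ?M" for k
      using vm Am gm[of k] \<phi>m[of k] by measurable
    show "AE x in ?M. (\<lambda>k. (v x \<bullet> (A x - grad (\<phi> k) x)) * \<phi> k x) \<longlonglongrightarrow> (v x \<bullet> (A x - A\<epsilon> x)) * \<psi> x"
      using \<psi>_affine
    proof eventually_elim
      case (elim x)
      have "(\<lambda>k. grad (\<phi> k) x) \<longlonglongrightarrow> A\<epsilon> x" by (rule tendsto_eventually[OF \<phi>(8)[OF elim]])
      then show ?case by (intro tendsto_intros \<phi>(7))
    qed
    show "AE x in ?M. norm ((v x \<bullet> (A x - grad (\<phi> k) x)) * \<phi> k x) \<le> 2 * L * B' * (indicator K' x * norm (v x))" for k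
      using Ab
    proof eventually_elim
      case (elim x)
      show ?case
      proof (cases "x \<in> K'")
        case True
        have "norm (A x - grad (\<phi> k) x) \<le> 2 * L"
          using norm_triangle_ineq4[of "A x" "grad (\<phi> k) x"] elim grad_b[of k x] by linarith
        then have "\<bar>v x \<bullet> (A x - grad (\<phi> k) x)\<bar> \<le> norm (v x) * (2 * L)"
          by (intro order_trans[OF Cauchy_Schwarz_ineq2] mult_left_mono) auto
        then have "\<bar>v x \<bullet> (A x - grad (\<phi> k) x)\<bar> * \<bar>\<phi> k x\<bar> \<le> norm (v x) * (2 * L) * B'"
          using L0 \<phi>(6) by (intro mult_mono) auto
        then show ?thesis using True by (simp add: abs_mult mult_ac)
      qed (simp add: \<phi>(4))
    qed
  qed
  moreover have "(v x \<bullet> (A x - A\<epsilon> x)) * \<psi> x = 0" for x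
    using soft_threshold_eq_0[of "q x" \<epsilon>] by (simp add: A\<epsilon>_def \<psi>_def)
  ultimately have E: "?E \<longlonglongrightarrow> 0" by simp
  have F_ge: "?E k \<le> F (\<phi> k)" for k
  proof -
    have bounded_int: "integrable ?M (\<lambda>x. (v x \<bullet> H x) * \<phi> k x)"
      if H: "H \<in> borel_measurable ?M" "AE x in ?M. norm (H x) \<le> L" for H
    proof (rule Bochner_Integration.integrable_bound[OF dom[of "L * B'"]])
      show "(\<lambda>x. (v x \<bullet> H x) * \<phi> k x) \<in> borel_measurable ?M" using vm H(1) \<phi>m[of k] by measurable
      show "AE x in ?M. norm ((v x \<bullet> H x) * \<phi> k x) \<le> norm (L * B' * (indicator K' x * norm (v x)))"
        using H(2)
      proof eventually_elim
        case (elim x)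
        show ?case
        proof (cases "x \<in> K'")
          case True
          have "\<bar>v x \<bullet> H x\<bar> \<le> norm (v x) * L"
            using elim by (intro order_trans[OF Cauchy_Schwarz_ineq2] mult_left_mono) auto
          then have "\<bar>v x \<bullet> H x\<bar> * \<bar>\<phi> k x\<bar> \<le> norm (v x) * L * B'"
            using L0 \<phi>(6) by (intro mult_mono) auto
          then show ?thesis using True L0 B'0 by (simp add: abs_mult mult_ac)
        qed (simp add: \<phi>(4))
      qed
    qed
    have "F (\<phi> k) = (LINT x|?M. convection \<Omega> v q x * \<phi> k x)"
      using F \<phi>(3) by (simp add: represents_def)
    also have "\<dots> = (LINT x|?M. (v x \<bullet> A x) * \<phi> k x)"
    proof (rule integral_cong_AE)
      have "convection \<Omega> v q \<in> borel_measurable ?M" using F by (simp add: represents_def locally_integrable_def)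
      then show "(\<lambda>x. convection \<Omega> v q x * \<phi> k x) \<in> borel_measurable ?M" using \<phi>m[of k] by measurable
      show "(\<lambda>x. (v x \<bullet> A x) * \<phi> k x) \<in> borel_measurable ?M" using vm Am \<phi>m[of k] by measurable
      show "AE x in ?M. convection \<Omega> v q x * \<phi> k x = (v x \<bullet> A x) * \<phi> k x"
        using wgrad_q by eventually_elim (simp add: convection_def)
    qed
    also have "\<dots> = ?E k + (LINT x|?M. (v x \<bullet> grad (\<phi> k) x) * \<phi> k x)"
      using bounded_int[OF Am Ab] bounded_int[OF gm[of k]] grad_b[of k]
      by (simp add: inner_diff_right left_diff_distrib)
    finally show ?thesis using convection_test_function_nonneg[OF div \<phi>(3)[of k]] by linarith
  qed
  have Y_lim: "(\<lambda>k. Y_norm \<Omega> \<alpha> (\<lambda>x. q x - \<phi> k x)) \<longlonglongrightarrow> sqrt (LINT x|?M. \<alpha> x * (norm (A x - A\<epsilon> x))\<^sup>2)"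
  proof -
    have "Y_norm \<Omega> \<alpha> (\<lambda>x. q x - \<phi> k x) = sqrt (LINT x|?M. \<alpha> x * (norm (A x - grad (\<phi> k) x))\<^sup>2)" for k
    proof -
      have wg: "has_weak_grad \<Omega> (\<lambda>x. q x - \<phi> k x) (\<lambda>x. A x - grad (\<phi> k) x)"
        using has_weak_grad_lincomb[OF \<Omega>(1) A(3) test_function_has_weak_grad[OF \<Omega>(1) \<phi>(3)], of 1 "-1"] by simp
      have "(LINT x|?M. \<alpha> x * (norm (wgrad \<Omega> (\<lambda>x. q x - \<phi> k x) x))\<^sup>2) = (LINT x|?M. \<alpha> x * (norm (A x - grad (\<phi> k) x))\<^sup>2)"
      proof (rule integral_cong_AE)
        have "wgrad \<Omega> (\<lambda>x. q x - \<phi> k x) \<in> borel_measurable ?M"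
          using wgrad_eq(1)[OF \<Omega>(1) wg] by (simp add: has_weak_grad_def locally_integrable_def)
        then show "(\<lambda>x. \<alpha> x * (norm (wgrad \<Omega> (\<lambda>x. q x - \<phi> k x) x))\<^sup>2) \<in> borel_measurable ?M"
          using \<alpha>_measurable by measurable
        show "(\<lambda>x. \<alpha> x * (norm (A x - grad (\<phi> k) x))\<^sup>2) \<in> borel_measurable ?M"
          using \<alpha>_measurable Am gm[of k] by measurable
        show "AE x in ?M. \<alpha> x * (norm (wgrad \<Omega> (\<lambda>x. q x - \<phi> k x) x))\<^sup>2 = \<alpha> x * (norm (A x - grad (\<phi> k) x))\<^sup>2"
          using wgrad_eq(2)[OF \<Omega>(1) wg] by eventually_elim simp
      qed
      then show ?thesis by (simp add: Y_norm_def)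
    qed
    moreover have "(\<lambda>k. LINT x|?M. \<alpha> x * (norm (A x - grad (\<phi> k) x))\<^sup>2) \<longlonglongrightarrow> (LINT x|?M. \<alpha> x * (norm (A x - A\<epsilon> x))\<^sup>2)"
    proof (rule integral_dominated_convergence[where w = "\<lambda>x. \<alpha>_hi * (2 * L)\<^sup>2"])
      show "(\<lambda>x. \<alpha> x * (norm (A x - A\<epsilon> x))\<^sup>2) \<in> borel_measurable ?M"
        using \<alpha>_measurable Am A\<epsilon>m by measurable
      show "(\<lambda>x. \<alpha> x * (norm (A x - grad (\<phi> k) x))\<^sup>2) \<in> borel_measurable ?M" for k
        using \<alpha>_measurable Am gm[of k] by measurable
      show "integrable ?M (\<lambda>x. \<alpha>_hi * (2 * L)\<^sup>2)"
        by (rule bounded_integrable[OF \<Omega>, of _ "\<bar>\<alpha>_hi * (2 * L)\<^sup>2\<bar>"]) auto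
      show "AE x in ?M. (\<lambda>k. \<alpha> x * (norm (A x - grad (\<phi> k) x))\<^sup>2) \<longlonglongrightarrow> \<alpha> x * (norm (A x - A\<epsilon> x))\<^sup>2"
        using \<psi>_affine
      proof eventually_elim
        case (elim x)
        have "(\<lambda>k. grad (\<phi> k) x) \<longlonglongrightarrow> A\<epsilon> x" by (rule tendsto_eventually[OF \<phi>(8)[OF elim]])
        then show ?case by (intro tendsto_intros)
      qed
      show "AE x in ?M. norm (\<alpha> x * (norm (A x - grad (\<phi> k) x))\<^sup>2) \<le> \<alpha>_hi * (2 * L)\<^sup>2" for k
        using Ab AE_space
      proof eventually_elim
        case (elim x)
        have "norm (A x - grad (\<phi> k) x) \<le> 2 * L"
          using norm_triangle_ineq4[of "A x" "grad (\<phi> k) x"] elim grad_b[of k x] by linarith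
        then have "(norm (A x - grad (\<phi> k) x))\<^sup>2 \<le> (2 * L)\<^sup>2" by (intro power_mono) auto
        then have "\<bar>\<alpha> x\<bar> * (norm (A x - grad (\<phi> k) x))\<^sup>2 \<le> \<alpha>_hi * (2 * L)\<^sup>2"
          using \<alpha>_abs[of x] elim by (intro mult_mono) auto
        then show ?case by (simp add: abs_mult)
      qed
    qed
    ultimately show ?thesis by (simp add: tendsto_real_sqrt)
  qed
  have "?E k - C * Y_norm \<Omega> \<alpha> (\<lambda>x. q x - \<phi> k x) \<le> F q" for k
    using F_ge[of k] Y_dual_diff_bound[OF _ C q \<phi>(3)[of k]] F by (auto simp: represents_def)
  then have "0 - C * sqrt (LINT x|?M. \<alpha> x * (norm (A x - A\<epsilon> x))\<^sup>2) \<le> F q"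
    by (intro LIMSEQ_le_const2[OF tendsto_diff[OF E tendsto_mult_left[OF Y_lim]]]) auto
  moreover have "A x - A\<epsilon> x = (if \<epsilon> < \<bar>q x\<bar> then 0 else grad q x)" for x
    by (simp add: A\<epsilon>_def A_def)
  ultimately show ?thesis by simp
qed

text \<open>
  As the threshold decreases to zero, the energy lost by the truncation decreases to the energy
  of \<open>q\<close> on its zero set, which is zero.
\<close>

lemma convection_nonneg:
  fixes q :: "real ^ 'n \<Rightarrow> real"
  assumes v: "locally_integrable \<Omega> v"
    and div: "has_weak_div \<Omega> v d" "AE x in lebesgue_on \<Omega>. d x \<le> 0"
    and q: "q \<in> H10 \<Omega>" and q_lip: "L-lipschitz_on UNIV q" and q_bound: "\<And>x. \<bar>q x\<bar> \<le> B"
    and q_zero: "\<And>x. x \<notin> \<Omega> \<Longrightarrow> q x = 0"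
    and q_affine: "\<And>s. AE x in lebesgue. \<exists>a. locally_affine q x a \<and> (a \<noteq> 0 \<longrightarrow> q x \<noteq> s)"
    and F: "represents \<Omega> \<alpha> (convection \<Omega> v q) F"
  shows "0 \<le> F q"
proof -
  let ?M = "lebesgue_on \<Omega>"
  have "F \<in> Y_dual \<Omega> \<alpha>" using F by (simp add: represents_def)
  then obtain C where C: "\<And>q. q \<in> H10 \<Omega> \<Longrightarrow> \<bar>F q\<bar> \<le> C * Y_norm \<Omega> \<alpha> q"
    using Y_dual_bound by metis
  define \<epsilon> where "\<epsilon> k = inverse (real (Suc k))" for k
  have \<epsilon>: "0 < \<epsilon> k" for k by (simp add: \<epsilon>_def)
  have q_cont: "continuous_on UNIV q" by (rule lipschitz_on_continuous_on[OF q_lip])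
  have deriv: "AE x in lebesgue. (q has_derivative (\<lambda>h. grad q x \<bullet> h)) (at x)"
    using q_affine[of 0] by eventually_elim (metis locally_affine_grad locally_affine_has_derivative)
  note A = lipschitz_has_weak_grad[OF \<Omega>(1) q_lip q_bound deriv]
  have Am: "grad q \<in> borel_measurable ?M" by (rule measurable_restrict_space1[OF A(1)])
  have qm: "q \<in> borel_measurable ?M" by (intro continuous_lebesgue_on_measurable q_cont)
  let ?R = "\<lambda>k x. if \<epsilon> k < \<bar>q x\<bar> then 0 else grad q x"
  have "(\<lambda>k. LINT x|?M. \<alpha> x * (norm (?R k x))\<^sup>2) \<longlonglongrightarrow> (LINT x|?M. 0)"
  proof (rule integral_dominated_convergence[where w = "\<lambda>x. \<alpha>_hi * L\<^sup>2"])
    show "(\<lambda>x. \<alpha> x * (norm (?R k x))\<^sup>2) \<in> borel_measurable ?M" for k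
      using \<alpha>_measurable Am qm by measurable
    show "integrable ?M (\<lambda>x. \<alpha>_hi * L\<^sup>2)"
      by (rule bounded_integrable[OF \<Omega>, of _ "\<bar>\<alpha>_hi * L\<^sup>2\<bar>"]) auto
    \<comment> \<open>Almost everywhere on the zero set of \<open>q\<close> the gradient vanishes.\<close>
    show "AE x in ?M. (\<lambda>k. \<alpha> x * (norm (?R k x))\<^sup>2) \<longlonglongrightarrow> 0"
    proof -
      have "AE x in lebesgue. (\<lambda>k. \<alpha> x * (norm (?R k x))\<^sup>2) \<longlonglongrightarrow> 0"
        using q_affine[of 0]
      proof eventually_elim
        case (elim x)
        then have ne: "grad q x \<noteq> 0 \<longrightarrow> q x \<noteq> 0" by (metis locally_affine_grad)
        show ?case
        proof (cases "q x = 0")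
          case True
          with ne have "?R k x = 0" for k by auto
          then show ?thesis by simp
        next
          case False
          have "\<forall>\<^sub>F k in sequentially. \<epsilon> k < \<bar>q x\<bar>"
            unfolding \<epsilon>_def using False by (intro order_tendstoD(2)[OF LIMSEQ_inverse_real_of_nat]) simp
          then have "\<forall>\<^sub>F k in sequentially. \<alpha> x * (norm (?R k x))\<^sup>2 = 0"
            by eventually_elim simp
          then show ?thesis by (rule tendsto_eventually)
        qed
      qed
      then show ?thesis unfolding AE_lebesgue_on[OF \<Omega>(1)] by eventually_elim simp
    qed
    show "AE x in ?M. norm (\<alpha> x * (norm (?R k x))\<^sup>2) \<le> \<alpha>_hi * L\<^sup>2" for k
    proof -
      have "AE x in ?M. norm (grad q x) \<le> L"
        unfolding AE_lebesgue_on[OF \<Omega>(1)] using A(2) by eventually_elim simp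
      then show ?thesis
        using AE_space
      proof eventually_elim
        case (elim x)
        have "norm (?R k x) \<le> L" using elim(1) lipschitz_on_nonneg[OF q_lip] by simp
        then have "(norm (?R k x))\<^sup>2 \<le> L\<^sup>2" by (intro power_mono) auto
        then have "\<bar>\<alpha> x\<bar> * (norm (?R k x))\<^sup>2 \<le> \<alpha>_hi * L\<^sup>2"
          using \<alpha>_abs[of x] elim by (intro mult_mono) auto
        then show ?case by (simp only: real_norm_def abs_mult abs_power2)
      qed
    qed
  qed simp
  then have "(\<lambda>k. - C * sqrt (LINT x|?M. \<alpha> x * (norm (?R k x))\<^sup>2)) \<longlonglongrightarrow> - C * sqrt 0"
    by (intro tendsto_mult_left tendsto_real_sqrt) simp
  moreover have "- C * sqrt (LINT x|?M. \<alpha> x * (norm (?R k x))\<^sup>2) \<le> F q" for k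
    by (rule convection_nonneg_up_to_truncation[OF v div q q_lip q_bound q_zero q_affine F C \<epsilon>])
  ultimately have "- C * sqrt 0 \<le> F q" by (intro LIMSEQ_le_const2) auto
  then show ?thesis by simp
qed

end

section \<open>Galerkin problems\<close>

text \<open>
  Gram-Schmidt in the form of an induction on the number of evaluation points that separate the
  elements of \<open>Y\<close>: the elements vanishing at one of the points form a subspace \<open>Y'\<close>, and a
  vector \<open>z'\<close> orthogonal to \<open>Y'\<close> spans a complement.  The functional vanishes on degenerate
  vectors, so the form may be semidefinite.
\<close>

lemma finite_dimensional_riesz:
  fixes Y :: "('a \<Rightarrow> real) set" and form :: "('a \<Rightarrow> real) \<Rightarrow> ('a \<Rightarrow> real) \<Rightarrow> real"
  assumes "finite V" "Y \<noteq> {}"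
    and "\<And>q r s t. q \<in> Y \<Longrightarrow> r \<in> Y \<Longrightarrow> (\<lambda>x. s * q x + t * r x) \<in> Y"
    and "\<And>q. q \<in> Y \<Longrightarrow> \<forall>x\<in>V. q x = 0 \<Longrightarrow> q = (\<lambda>x. 0)"
    and "\<And>q r z s t. q \<in> Y \<Longrightarrow> r \<in> Y \<Longrightarrow> z \<in> Y \<Longrightarrow> form (\<lambda>x. s * q x + t * r x) z = s * form q z + t * form r z"
    and "\<And>q r. q \<in> Y \<Longrightarrow> r \<in> Y \<Longrightarrow> form q r = form r q"
    and "\<And>q. q \<in> Y \<Longrightarrow> 0 \<le> form q q"
    and "\<And>q r s t. q \<in> Y \<Longrightarrow> r \<in> Y \<Longrightarrow> l (\<lambda>x. s * q x + t * r x) = s * l q + t * l r"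
    and "\<And>q. q \<in> Y \<Longrightarrow> form q q = 0 \<Longrightarrow> l q = 0"
  shows "\<exists>w\<in>Y. \<forall>q\<in>Y. form w q = l q"
  using assms
proof (induction V arbitrary: Y l rule: finite_induct)
  case empty
  note lin = empty.prems(2) and det = empty.prems(3) and form_lin = empty.prems(4) and l_lin = empty.prems(7)
  obtain z where z: "z \<in> Y" using empty.prems(1) by blast
  have all: "q = (\<lambda>x. 0)" if "q \<in> Y" for q using det[OF that] by blast
  have "form z z = 0" "l z = 0"
    using form_lin[OF z z z, of 0 0] l_lin[OF z z, of 0 0] all[OF z] by simp_all
  then show ?case using z all by (metis)
next
  case (insert v V)
  note lin = insert.prems(2) and det = insert.prems(3) and form_lin = insert.prems(4)
    and sym = insert.prems(5) and pos = insert.prems(6) and l_lin = insert.prems(7) and null = insert.prems(8)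
  define Y' where "Y' = {q \<in> Y. q v = 0}"
  have sub: "q \<in> Y" if "q \<in> Y'" for q using that by (simp add: Y'_def)
  obtain y where y: "y \<in> Y" using insert.prems(1) by blast
  have IH: "\<exists>w\<in>Y'. \<forall>q\<in>Y'. form w q = l' q"
    if l'_lin: "\<And>q r s t. q \<in> Y' \<Longrightarrow> r \<in> Y' \<Longrightarrow> l' (\<lambda>x. s * q x + t * r x) = s * l' q + t * l' r"
      and l'_null: "\<And>q. q \<in> Y' \<Longrightarrow> form q q = 0 \<Longrightarrow> l' q = 0" for l'
  proof (rule insert.IH)
    show "Y' \<noteq> {}" using lin[OF y y, of 0 0] by (auto simp: Y'_def)
    show "(\<lambda>x. s * q x + t * r x) \<in> Y'" if "q \<in> Y'" "r \<in> Y'" for q r s t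
      using that lin by (simp add: Y'_def)
    show "q = (\<lambda>x. 0)" if "q \<in> Y'" "\<forall>x\<in>V. q x = 0" for q
      using that det by (simp add: Y'_def)
    show "form (\<lambda>x. s * q x + t * r x) z = s * form q z + t * form r z" if "q \<in> Y'" "r \<in> Y'" "z \<in> Y'" for q r z s t
      using that form_lin sub by blast
    show "form q r = form r q" if "q \<in> Y'" "r \<in> Y'" for q r using that sym sub by blast
    show "0 \<le> form q q" if "q \<in> Y'" for q using that pos sub by blast
  qed (fact l'_lin l'_null)+
  have form_lin2: "form z (\<lambda>x. s * q x + t * r x) = s * form z q + t * form z r"
    if "q \<in> Y" "r \<in> Y" "z \<in> Y" for q r z s t
    using form_lin[OF that] sym[OF that(3) lin[OF that(1,2)]] sym[OF that(1,3)] sym[OF that(2,3)] by simp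
  have degenerate: "form z q = 0" if z: "z \<in> Y" and q: "q \<in> Y" and "form q q = 0" for z q
  proof (rule ccontr)
    assume ne: "form z q \<noteq> 0"
    have zq: "form z z + 2 * t * form z q \<ge> 0" for t
    proof -
      have "form (\<lambda>x. 1 * z x + t * q x) (\<lambda>x. 1 * z x + t * q x)
          = form z z + t * form z q + t * (form q z + t * form q q)"
        using form_lin[OF z q lin[OF z q], of 1 t 1 t] form_lin2[OF z q z, of 1 t] form_lin2[OF z q q, of 1 t] by simp
      then show ?thesis using pos[OF lin[OF z q], of 1 t] sym[OF z q] \<open>form q q = 0\<close> by simp
    qed
    from zq[of "- (form z z + 1) / (2 * form z q)"] show False using ne by (simp add: field_simps)
  qed
  obtain w0 where w0: "w0 \<in> Y'" "\<And>q. q \<in> Y' \<Longrightarrow> form w0 q = l q"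
  proof -
    have "\<exists>w\<in>Y'. \<forall>q\<in>Y'. form w q = l q"
      by (rule IH) (simp_all add: l_lin null sub)
    then show ?thesis using that by blast
  qed
  show ?case
  proof (cases "\<forall>q\<in>Y. q v = 0")
    case True
    then have "Y' = Y" by (auto simp: Y'_def)
    with w0 show ?thesis by blast
  next
    case False
    then obtain z where z: "z \<in> Y" "z v \<noteq> 0" by blast
    obtain z0 where z0: "z0 \<in> Y'" "\<And>q. q \<in> Y' \<Longrightarrow> form z0 q = form z q"
    proof -
      have "\<exists>w\<in>Y'. \<forall>q\<in>Y'. form w q = form z q"
        by (rule IH) (simp_all add: form_lin2 degenerate sub z(1))
      then show ?thesis using that by blast
    qed
    define z' where "z' = (\<lambda>x. 1 * z x + (- 1) * z0 x)"
    have z': "z' \<in> Y" "z' v \<noteq> 0"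
      unfolding z'_def by (rule lin[OF z(1) sub[OF z0(1)]]) (use z(2) z0(1) in \<open>simp add: Y'_def\<close>)
    have orth: "form z' q = 0" if "q \<in> Y'" for q
      using form_lin[OF z(1) sub[OF z0(1)] sub[OF that], of 1 "- 1"] z0(2)[OF that] by (simp add: z'_def)
    \<comment> \<open>If \<open>z'\<close> is degenerate the quotient is \<open>0\<close> by convention, and \<open>l z'\<close> vanishes as well.\<close>
    define t where "t = l z' / form z' z'"
    have t: "t * form z' z' = l z'" using null[OF z'(1)] by (cases "form z' z' = 0") (auto simp: t_def)
    let ?w = "\<lambda>x. 1 * w0 x + t * z' x"
    have w: "?w \<in> Y" by (rule lin[OF sub[OF w0(1)] z'(1)])
    have "form ?w q = l q" if q: "q \<in> Y" for q
    proof -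
      define c where "c = q v / z' v"
      define q' where "q' = (\<lambda>x. 1 * q x + (- c) * z' x)"
      have "q' \<in> Y" unfolding q'_def by (rule lin[OF q z'(1)])
      then have q': "q' \<in> Y'" using z'(2) by (simp add: Y'_def q'_def c_def)
      have q_eq: "q = (\<lambda>x. 1 * q' x + c * z' x)" by (simp add: q'_def)
      have "form ?w q = form ?w q' + c * form ?w z'"
        using form_lin2[OF sub[OF q'] z'(1) w, of 1 c] q_eq by simp
      also have "form ?w q' = l q'"
        using form_lin[OF sub[OF w0(1)] z'(1) sub[OF q'], of 1 t] w0(2)[OF q'] orth[OF q'] by simp
      also have "form ?w z' = l z'"
        using form_lin[OF sub[OF w0(1)] z'(1) z'(1), of 1 t] t orth[OF w0(1)] sym[OF sub[OF w0(1)] z'(1)] by simp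
      also have "l q' + c * l z' = l q"
        using l_lin[OF sub[OF q'] z'(1), of 1 c] q_eq by simp
      finally show ?thesis .
    qed
    with w show ?thesis by blast
  qed
qed

text \<open>
  Existence of the Galerkin solution; hence the choice operator in the definition of \<open>w_h\<close> picks
  an actual solution.
\<close>

lemma (in diffusion) w_h_solves:
  assumes T: "simplicial_decomposition \<Omega> T" and Y: "fe_space \<Omega> T \<subseteq> H10 \<Omega>"
    and u: "convectable v u"
  shows "w_h \<Omega> \<alpha> v (fe_space \<Omega> T) u \<in> fe_space \<Omega> T"
    and "q \<in> fe_space \<Omega> T \<Longrightarrow>
      diffusion_form \<Omega> \<alpha> (w_h \<Omega> \<alpha> v (fe_space \<Omega> T) u) q = pairing \<Omega> \<alpha> (convection \<Omega> v u) q"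
proof -
  let ?Y = "fe_space \<Omega> T" and ?l = "pairing \<Omega> \<alpha> (convection \<Omega> v u)"
  have l: "?l \<in> Y_dual \<Omega> \<alpha>"
    using u pairing_represents by (auto simp: convectable_def represents_def)
  obtain C where C: "\<And>q. q \<in> H10 \<Omega> \<Longrightarrow> \<bar>?l q\<bar> \<le> C * Y_norm \<Omega> \<alpha> q" using Y_dual_bound[OF l] by metis
  obtain V where V: "finite V" "\<And>q. q \<in> ?Y \<Longrightarrow> \<forall>x\<in>V. q x = 0 \<Longrightarrow> q = (\<lambda>x. 0)"
    using fe_space_determined_by_vertices[OF T] by metis
  have fe: "finite_energy \<Omega> q" if "q \<in> ?Y" for q using that Y H10_finite_energy by blast
  have "\<exists>w\<in>?Y. \<forall>q\<in>?Y. diffusion_form \<Omega> \<alpha> w q = ?l q"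
  proof (rule finite_dimensional_riesz[OF V(1)])
    have "(\<lambda>x. 0) \<in> ?Y" by (auto simp: fe_space_def intro: exI[of _ 0])
    then show "?Y \<noteq> {}" by blast
    show "(\<lambda>x. s * q x + t * r x) \<in> ?Y" if "q \<in> ?Y" "r \<in> ?Y" for q r s t
      by (rule fe_space_lincomb[OF that])
    show "diffusion_form \<Omega> \<alpha> (\<lambda>x. s * q x + t * r x) z = s * diffusion_form \<Omega> \<alpha> q z + t * diffusion_form \<Omega> \<alpha> r z"
      if "q \<in> ?Y" "r \<in> ?Y" "z \<in> ?Y" for q r z s t
      by (rule diffusion_form_lincomb[OF that[THEN fe]])
    show "?l (\<lambda>x. s * q x + t * r x) = s * ?l q + t * ?l r" if "q \<in> ?Y" "r \<in> ?Y" for q r s t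
      using Y_dual_lincomb[OF l] that Y by blast
    show "?l q = 0" if "q \<in> ?Y" "diffusion_form \<Omega> \<alpha> q q = 0" for q
      using C[of q] that Y by (auto simp: Y_norm_eq_form)
  qed (use V(2) diffusion_form_sym diffusion_form_nonneg in auto)
  then have "\<exists>w. w \<in> ?Y \<and> (\<forall>q\<in>?Y. diffusion_form \<Omega> \<alpha> w q = ?l q)" by blast
  from someI_ex[OF this]
  show "w_h \<Omega> \<alpha> v ?Y u \<in> ?Y" "q \<in> ?Y \<Longrightarrow> diffusion_form \<Omega> \<alpha> (w_h \<Omega> \<alpha> v ?Y u) q = ?l q"
    unfolding w_h_def by blast+
qed

lemma (in diffusion) pairing_fe_nonneg:
  assumes v: "locally_integrable \<Omega> v"
    and div: "has_weak_div \<Omega> v d" "AE x in lebesgue_on \<Omega>. d x \<le> 0"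
    and T: "simplicial_decomposition \<Omega> T"
    and q: "q \<in> fe_space \<Omega> T" "q \<in> X_space \<Omega> \<alpha> v"
  shows "0 \<le> pairing \<Omega> \<alpha> (convection \<Omega> v q) q"
proof -
  obtain L where L: "L-lipschitz_on UNIV q" using fe_space_lipschitz[OF \<Omega>(1) T q(1)] .
  obtain B where B: "\<And>x. \<bar>q x\<bar> \<le> B" using fe_space_bounded[OF \<Omega>(2) q(1)] by metis
  have "represents \<Omega> \<alpha> (convection \<Omega> v q) (pairing \<Omega> \<alpha> (convection \<Omega> v q))"
    using q(2) pairing_represents by (auto simp: X_space_def)
  moreover have "q \<in> H10 \<Omega>" using q(2) by (simp add: X_space_def)
  moreover have "q x = 0" if "x \<notin> \<Omega>" for x using q(1) that by (simp add: fe_space_def)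
  ultimately show ?thesis
    using convection_nonneg[OF v div _ L B _ fe_space_ae_affine[OF \<Omega>(2) T q(1)]] by blast
qed

section \<open>The reliability estimate\<close>

text \<open>
  Functions that vanish almost everywhere have zero energy, so the form is only semidefinite on
  functions; the Cauchy-Schwarz inequality is derived from the discriminant with the degenerate cases treated apart.
\<close>

lemma (in diffusion) Y_norm_triangle:
  assumes u: "finite_energy \<Omega> u" and w: "finite_energy \<Omega> w"
  shows "Y_norm \<Omega> \<alpha> (\<lambda>x. u x + w x) \<le> Y_norm \<Omega> \<alpha> u + Y_norm \<Omega> \<alpha> w"
proof -
  let ?a = "diffusion_form \<Omega> \<alpha>"
  note fe = finite_energy_lincomb(1)[OF \<Omega>(1)]
  have expand: "?a (\<lambda>x. s * u x + t * w x) (\<lambda>x. s * u x + t * w x) = s\<^sup>2 * ?a u u + 2 * s * t * ?a u w + t\<^sup>2 * ?a w w" for s t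
    using diffusion_form_lincomb[OF u w fe[OF u w], of s t s t]
      diffusion_form_lincomb[OF u w u, of s t] diffusion_form_lincomb[OF u w w, of s t]
      diffusion_form_sym[of u "\<lambda>x. s * u x + t * w x"] diffusion_form_sym[of w "\<lambda>x. s * u x + t * w x"]
      diffusion_form_sym[of w u]
    by (simp add: power2_eq_square algebra_simps)
  let ?U = "Y_norm \<Omega> \<alpha> u" and ?W = "Y_norm \<Omega> \<alpha> w"
  have cs: "?a u w \<le> ?U * ?W"
  proof (rule ccontr)
    assume "\<not> ?thesis"
    then have gt: "?U * ?W < ?a u w" by simp
    have UW: "0 \<le> ?U" "0 \<le> ?W" by (rule Y_norm_nonneg)+
    have bound: "0 \<le> s\<^sup>2 * ?U\<^sup>2 + 2 * s * t * ?a u w + t\<^sup>2 * ?W\<^sup>2" for s t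
      using diffusion_form_nonneg[of "\<lambda>x. s * u x + t * w x"] expand[of s t] by (simp add: Y_norm_square)
    have pos: "0 < ?a u w" using gt mult_nonneg_nonneg[OF UW] by linarith
    consider "?U = 0" | "?W = 0" | "0 < ?U" "0 < ?W" using UW by linarith
    then show False
    proof cases
      case 1
      then show False using bound[of "- (?W\<^sup>2 + 1) / (2 * ?a u w)" 1] pos by (simp add: field_simps)
    next
      case 2
      then show False using bound[of 1 "- (?U\<^sup>2 + 1) / (2 * ?a u w)"] pos by (simp add: field_simps)
    next
      case 3
      have "0 \<le> 2 * (?U * ?W) * (?U * ?W - ?a u w)"
        using bound[of ?W "- ?U"] by (simp add: power2_eq_square algebra_simps)
      moreover have "0 < ?U * ?W" using 3 by simp
      ultimately show False using gt by (simp add: zero_le_mult_iff)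
    qed
  qed
  have "?a (\<lambda>x. u x + w x) (\<lambda>x. u x + w x) = ?U\<^sup>2 + 2 * ?a u w + ?W\<^sup>2"
    using expand[of 1 1] by (simp add: Y_norm_square)
  also have "\<dots> \<le> (?U + ?W)\<^sup>2" using cs by (simp add: power2_sum)
  finally show ?thesis
    unfolding Y_norm_eq_form[of "\<lambda>x. u x + w x"]
    by (intro real_le_lsqrt) (auto simp: Y_norm_nonneg diffusion_form_nonneg)
qed

text \<open>
  Both sides of a Galerkin equation may be tested with \<open>p\<close> and with \<open>r\<close>.
\<close>

lemma (in diffusion) galerkin_Y_norm_eq:
  assumes "p \<in> Y" "r \<in> Y" "\<And>q. q \<in> Y \<Longrightarrow> diffusion_form \<Omega> \<alpha> p q = diffusion_form \<Omega> \<alpha> r q"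
  shows "Y_norm \<Omega> \<alpha> p = Y_norm \<Omega> \<alpha> r"
  using assms diffusion_form_sym[of p r] by (simp add: Y_norm_eq_form)

theorem lemma2p9:
  fixes \<Omega> :: "(real ^ 'n) set"
    and \<alpha> :: "real ^ 'n \<Rightarrow> real"
    and v :: "real ^ 'n \<Rightarrow> real ^ 'n"
    and div_v :: "real ^ 'n \<Rightarrow> real"
    and \<alpha>_lo \<alpha>_hi \<sigma> \<eta> :: real
    and T\<^sub>H T\<^sub>h :: "(real ^ 'n) set set"
    and X\<^sub>H X\<^sub>h Y\<^sub>h :: "(real ^ 'n \<Rightarrow> real) set"
    and f :: "(real ^ 'n \<Rightarrow> real) \<Rightarrow> real"
    and u u\<^sub>H u\<^sub>h p\<^sub>h pbar\<^sub>h :: "real ^ 'n \<Rightarrow> real"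
  assumes dim: "CARD('n) \<in> {1, 2, 3}"
    and domain: "bounded_lipschitz_domain \<Omega>"
    and alpha_measurable: "\<alpha> \<in> borel_measurable (lebesgue_on \<Omega>)"
    and alpha_bounds: "0 < \<alpha>_lo" "\<And>x. x \<in> \<Omega> \<Longrightarrow> \<alpha>_lo \<le> \<alpha> x \<and> \<alpha> x \<le> \<alpha>_hi"
    and velocity: "locally_integrable \<Omega> v"
    and divergence: "has_weak_div \<Omega> v div_v" "AE x in lebesgue_on \<Omega>. div_v x \<le> 0"
    and bijective: "B_bijective \<Omega> \<alpha> v"
    and coarse_mesh: "simplicial_decomposition \<Omega> T\<^sub>H" "shape_regular \<sigma> T\<^sub>H"
    and fine_mesh: "simplicial_decomposition \<Omega> T\<^sub>h" "mesh_refinement T\<^sub>h T\<^sub>H"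
    and spaces: "X\<^sub>H = fe_space \<Omega> T\<^sub>H" "Y\<^sub>h = fe_space \<Omega> T\<^sub>h" "X\<^sub>h = Y\<^sub>h"
    and conforming: "X\<^sub>H \<subseteq> X_space \<Omega> \<alpha> v" "X\<^sub>h \<subseteq> X_space \<Omega> \<alpha> v" "Y\<^sub>h \<subseteq> H10 \<Omega>"
    and nested: "X\<^sub>H \<subseteq> Y\<^sub>h" "X\<^sub>H \<noteq> Y\<^sub>h"
    and rhs: "f \<in> Y_dual \<Omega> \<alpha>"
    and solution: "u \<in> X_space \<Omega> \<alpha> v" "\<And>q. q \<in> H10 \<Omega> \<Longrightarrow> b_form \<Omega> \<alpha> v u q = f q"
    and coarse_solution: "solves_mixed_system \<Omega> \<alpha> v f Y\<^sub>h X\<^sub>H p\<^sub>h u\<^sub>H"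
    and fine_solution: "solves_mixed_system \<Omega> \<alpha> v f Y\<^sub>h X\<^sub>h pbar\<^sub>h u\<^sub>h"
    and eta: "0 < \<eta>" "\<eta> < 1"
    and saturation: "X_h_norm \<Omega> \<alpha> v Y\<^sub>h (\<lambda>x. u x - u\<^sub>h x)
                       \<le> \<eta> * X_h_norm \<Omega> \<alpha> v Y\<^sub>h (\<lambda>x. u x - u\<^sub>H x)"
  shows "X_h_norm \<Omega> \<alpha> v Y\<^sub>h (\<lambda>x. u x - u\<^sub>H x) \<le> 1 / (1 - \<eta>) * Y_norm \<Omega> \<alpha> p\<^sub>h"
proof -
  have \<Omega>: "open \<Omega>" "bounded \<Omega>" using domain by (auto simp: bounded_lipschitz_domain_def)
  interpret diffusion \<Omega> \<alpha> \<alpha>_lo \<alpha>_hi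
    by unfold_locales (use \<Omega> alpha_measurable alpha_bounds in auto)
  have vm: "v \<in> borel_measurable (lebesgue_on \<Omega>)" using velocity by (simp add: locally_integrable_def)
  let ?a = "diffusion_form \<Omega> \<alpha>" and ?N = "Y_norm \<Omega> \<alpha>" and ?X = "X_h_norm \<Omega> \<alpha> v Y\<^sub>h"
  let ?c = "\<lambda>z. pairing \<Omega> \<alpha> (convection \<Omega> v z)" and ?w = "w_h \<Omega> \<alpha> v Y\<^sub>h"
  have mem: "u\<^sub>H \<in> X\<^sub>H" "p\<^sub>h \<in> Y\<^sub>h" "u\<^sub>h \<in> Y\<^sub>h" "pbar\<^sub>h \<in> Y\<^sub>h"
    using coarse_solution fine_solution spaces(3) by (auto simp: solves_mixed_system_def)
  have H10: "q \<in> H10 \<Omega>" if "q \<in> Y\<^sub>h" for q using that conforming(3) by blast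
  have fe: "finite_energy \<Omega> q" if "q \<in> Y\<^sub>h" for q using H10[OF that] by (rule H10_finite_energy)
  have lin: "(\<lambda>x. s * q x + t * r x) \<in> Y\<^sub>h" if "q \<in> Y\<^sub>h" "r \<in> Y\<^sub>h" for q r s t
    using that unfolding spaces(2) by (rule fe_space_lincomb)
  have sum: "(\<lambda>x. q x + r x) \<in> Y\<^sub>h" and diff: "(\<lambda>x. q x - r x) \<in> Y\<^sub>h" if "q \<in> Y\<^sub>h" "r \<in> Y\<^sub>h" for q r
    using lin[OF that, of 1 1] lin[OF that, of 1 "-1"] by simp_all
  have a_sum: "?a (\<lambda>x. q x + r x) z = ?a q z + ?a r z" and a_diff: "?a (\<lambda>x. q x - r x) z = ?a q z - ?a r z"
    if "q \<in> Y\<^sub>h" "r \<in> Y\<^sub>h" "z \<in> Y\<^sub>h" for q r z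
    using diffusion_form_lincomb[OF that[THEN fe], of 1 1] diffusion_form_lincomb[OF that[THEN fe], of 1 "-1"] by simp_all
  have cv: "convectable v u" "convectable v u\<^sub>H" "convectable v u\<^sub>h"
    using solution(1) mem conforming spaces(3) by (auto intro: X_space_convectable)
  note w = w_h_solves[OF fine_mesh(1) conforming(3)[unfolded spaces(2)], folded spaces(2)]
  have c_nonneg: "0 \<le> ?c q q" if "q \<in> Y\<^sub>h" for q
    using pairing_fe_nonneg[OF velocity divergence fine_mesh(1)] that spaces(2,3) conforming(2) by blast
  let ?coarse = "\<lambda>x. u x - u\<^sub>H x" and ?fine = "\<lambda>x. u x - u\<^sub>h x" and ?jump = "\<lambda>x. u\<^sub>h x - u\<^sub>H x"
  have cvd: "convectable v (\<lambda>x. y x - z x)"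
    and c_diff: "\<And>q. q \<in> Y\<^sub>h \<Longrightarrow> ?c (\<lambda>x. y x - z x) q = ?c y q - ?c z q"
    if "convectable v y" "convectable v z" for y z
    using convectable_lincomb[OF vm that, where a = 1 and b = "-1"] H10 by simp_all
  have uH: "u\<^sub>H \<in> Y\<^sub>h" using mem(1) nested(1) by blast
  have e: "?jump \<in> Y\<^sub>h" by (rule diff[OF mem(3) uH])
  note w0 = w[OF cvd[OF cv(1,2)]] and w1 = w[OF cvd[OF cv(1,3)]] and w2 = w[OF cvd[OF cv(3,2)]]
  \<comment> \<open>Since \<open>X\<^sub>h = Y\<^sub>h\<close>, the fine residual representative may be inserted for \<open>z\<close> in its own
    constraint, where diffusion and convection are both nonnegative.\<close>
  have pbar: "?N pbar\<^sub>h = 0"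
  proof -
    have "?a pbar\<^sub>h pbar\<^sub>h + ?c pbar\<^sub>h pbar\<^sub>h = 0"
      using fine_solution mem(4) spaces(3) by (simp add: solves_mixed_system_def b_form_def)
    then show ?thesis
      using diffusion_form_nonneg[of "pbar\<^sub>h"] c_nonneg[OF mem(4)] by (simp add: Y_norm_eq_form)
  qed
  \<comment> \<open>The difference of the two mixed systems: the right-hand side \<open>f\<close> cancels.\<close>
  have "?N (\<lambda>x. p\<^sub>h x - pbar\<^sub>h x) = ?N (\<lambda>x. ?jump x + ?w ?jump x)"
  proof (rule galerkin_Y_norm_eq[of _ Y\<^sub>h])
    fix q assume q: "q \<in> Y\<^sub>h"
    have "?a p\<^sub>h q - ?a pbar\<^sub>h q = ?a u\<^sub>h q - ?a u\<^sub>H q + (?c u\<^sub>h q - ?c u\<^sub>H q)"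
      using coarse_solution fine_solution q by (simp add: solves_mixed_system_def b_form_def) (smt (verit))
    then show "?a (\<lambda>x. p\<^sub>h x - pbar\<^sub>h x) q = ?a (\<lambda>x. ?jump x + ?w ?jump x) q"
      using a_diff[OF mem(2,4) q] a_sum[OF e w2(1) q] a_diff[OF mem(3) uH q] w2(2)[OF q] c_diff[OF cv(3,2) q] by simp
  qed (use diff mem sum e w2(1) in auto)
  moreover have "?N (\<lambda>x. p\<^sub>h x - pbar\<^sub>h x) \<le> ?N p\<^sub>h"
  proof -
    have neg: "(\<lambda>x. - pbar\<^sub>h x) \<in> Y\<^sub>h" using lin[OF mem(4,4), of "-1" 0] by simp
    have a_neg: "?a (\<lambda>x. - pbar\<^sub>h x) z = - ?a pbar\<^sub>h z" if "z \<in> Y\<^sub>h" for z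
      using diffusion_form_lincomb[OF fe[OF mem(4)] fe[OF mem(4)] fe[OF that], where a = "-1" and b = 0] by simp
    have "?N (\<lambda>x. - pbar\<^sub>h x) = ?N pbar\<^sub>h"
      using a_neg[OF neg] a_neg[OF mem(4)] diffusion_form_sym[of "pbar\<^sub>h" "\<lambda>x. - pbar\<^sub>h x"]
      by (simp add: Y_norm_eq_form)
    then show ?thesis
      using Y_norm_triangle[OF fe[OF mem(2)] fe[OF neg]] pbar by simp
  qed
  moreover have "?X ?jump \<le> ?N (\<lambda>x. ?jump x + ?w ?jump x)"
  proof -
    let ?s = "\<lambda>x. ?jump x + ?w ?jump x"
    have s: "?s \<in> Y\<^sub>h" by (rule sum[OF e w2(1)])
    \<comment> \<open>The mixed term of the square is the convection functional of the jump, tested with itself.\<close>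
    have "(?N ?s)\<^sup>2 = (?N ?jump)\<^sup>2 + 2 * ?a (?w ?jump) ?jump + (?N (?w ?jump))\<^sup>2"
      using a_sum[OF e w2(1) s] a_sum[OF e w2(1) e] a_sum[OF e w2(1) w2(1)]
        diffusion_form_sym[of ?jump ?s] diffusion_form_sym[of "?w ?jump" ?s] diffusion_form_sym[of ?jump "?w ?jump"]
      by (simp add: Y_norm_square)
    moreover have "0 \<le> ?a (?w ?jump) ?jump" using w2(2)[OF e] c_nonneg[OF e] by simp
    ultimately show ?thesis
      unfolding X_h_norm_def by (intro real_le_lsqrt Y_norm_nonneg) auto
  qed
  ultimately have fine_coarse: "?X ?jump \<le> ?N p\<^sub>h" by linarith
  have "?X ?coarse \<le> ?X ?fine + ?X ?jump"
  proof -
    have "?N (?w ?coarse) = ?N (\<lambda>x. ?w ?fine x + ?w ?jump x)"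
    proof (rule galerkin_Y_norm_eq[of _ Y\<^sub>h, OF w0(1) sum[OF w1(1) w2(1)]])
      fix q assume q: "q \<in> Y\<^sub>h"
      show "?a (?w ?coarse) q = ?a (\<lambda>x. ?w ?fine x + ?w ?jump x) q"
        using a_sum[OF w1(1) w2(1) q] w0(2)[OF q] w1(2)[OF q] w2(2)[OF q]
          c_diff[OF cv(1,2) q] c_diff[OF cv(1,3) q] c_diff[OF cv(3,2) q] by simp
    qed
    then have 1: "?N (?w ?coarse) \<le> ?N (?w ?fine) + ?N (?w ?jump)"
      using Y_norm_triangle[OF fe[OF w1(1)] fe[OF w2(1)]] by simp
    have "finite_energy \<Omega> ?fine" using cvd[OF cv(1,3)] by (simp add: convectable_def)
    then have 2: "?N ?coarse \<le> ?N ?fine + ?N ?jump"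
      using Y_norm_triangle[OF _ fe[OF e], of ?fine] by simp
    have "?X ?coarse \<le> sqrt ((?N ?fine + ?N ?jump)\<^sup>2 + (?N (?w ?fine) + ?N (?w ?jump))\<^sup>2)"
      unfolding X_h_norm_def
      by (intro real_sqrt_le_mono add_mono power_mono 1 2 Y_norm_nonneg)
    also have "\<dots> \<le> ?X ?fine + ?X ?jump"
      unfolding X_h_norm_def by (rule real_sqrt_sum_squares_triangle_ineq)
    finally show ?thesis .
  qed
  then have "(1 - \<eta>) * ?X ?coarse \<le> ?N p\<^sub>h"
    using saturation fine_coarse by (simp add: left_diff_distrib)
  then show ?thesis using eta by (simp add: field_simps)
qed

end
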